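(* For every statement $S$ (relative to a fixed procedure declaration), every parameterized quantum predicate term $P$ and every assignment $v$ of quantum predicates to the predicate variables of $P$: (a) $\mathrm{wp}.S.(P^v)=\llbracket S\rrbracket^*(P^v)$; (b) $\mathrm{wlp}.S.(P^v)=I-\mathrm{wp}.S.(I-P^v)$, i.e. $=\mathrm{wp}.S.(P^v)+(I-\mathrm{wp}.S.I)$.
   Context: Quantum variables have type Boolean (space $\mathbb{C}^2$) or integer (infinite-dimensional space with basis $\{|n\rangle:n\in\mathbb{Z}\}$); operators/operations on subsystems are tensored with identity on the remaining variables. A quantum operation (QOP) is a linear, completely positive, trace-nonincreasing superoperator; $A\diamond B$ denotes $\rho\mapsto A\rho B$; $\mathcal{E}^*$ is the Schrödinger–Heisenberg dual ($\mathrm{tr}(A\,\mathcal{E}(\rho))=\mathrm{tr}(\mathcal{E}^*(A)\rho)$); $\sqsubseteq$ is the Löwner order, extended to QOPs pointwise; monotone sequences have least upper / greatest lower bounds. Programs: procedures $\mathbf{proc}_i\Leftarrow S_i$ ($1\le i\le n$) and statements $S::=\mathbf{bottom}\mid\mathbf{skip}\mid q:=|0\rangle\mid\bar q:=U\bar q\mid S_1;S_2\mid\mathbf{if}\ (\Box m\cdot M[\bar q]=m\to S_m)\ \mathbf{fi}\ (\sum_mM_m^\dagger M_m=I)\mid\mathbf{call}\ \mathbf{proc}_i$. Denotational semantics: $\llbracket\mathbf{bottom}\rrbracket=0\diamond0$, $\llbracket\mathbf{skip}\rrbracket=I\diamond I$, $\llbracket q:=|0\rangle\rrbracket=\sum_i|0\rangle_q\langle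 i|\diamond|i\rangle_q\langle0|$, $\llbracket\bar q:=U\bar q\rrbracket=U\diamond U^\dagger$, $\llbracket S_1;S_2\rrbracket=\llbracket S_2\rrbracket\circ\llbracket S_1\rrbracket$, $\llbracket\mathbf{if}\cdots\rrbracket=\sum_m\llbracket S_m\rrbracket\circ(M_m\diamond M_m^\dagger)$, $\llbracket\mathbf{call}\ \mathbf{proc}_i\rrbracket=\bigsqcup_k\llbracket S_i^{(k)}\rrbracket$, where $S_i^{(0)}=\mathbf{bottom}$ and $S_i^{(k+1)}$ is $S_i$ with every $\mathbf{call}\ \mathbf{proc}_j$ simultaneously replaced by $\mathbf{skip};S_j^{(k)}$. Formal weakest (liberal) preconditions, for $\mathrm{xp}\in\{\mathrm{wp},\mathrm{wlp}\}$ and an operator $P$: $\mathrm{wp}.\mathbf{bottom}.P=0$, $\mathrm{wlp}.\mathbf{bottom}.P=I$; $\mathrm{xp}.\mathbf{skip}.P=P$; $\mathrm{xp}.(q:=|0\rangle).P=\sum_i|i\rangle_q\langle0|P|0\rangle_q\langle i|$; $\mathrm{xp}.(\bar q:=U\bar q).P=U^\dagger PU$; $\mathrm{xp}.(S_1;S_2).P=\mathrm{xp}.S_1.(\mathrm{xp}.S_2.P)$; $\mathrm{xp}.(\mathbf{if}\cdots\mathbf{fi}).P=\sum_mM_m^\dagger(\mathrm{xp}.S_m.P)M_m$; $\mathrm{wp}.(\mathbf{call}\ \mathbf{proc}_i).P$ is the least upper bound of the increasing sequence $\mathrm{wp}.S_i^{(k)}.P$, and $\mathrm{wlp}.(\mathbf{call}\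 \mathbf{proc}_i).P$ the greatest lower bound of the decreasing sequence $\mathrm{wlp}.S_i^{(k)}.P$. A parameterized quantum predicate term (PQPT) on $\bar q$ is $\mathcal{E}^*(\mathcal{B})+\mathcal{F}^*(I)$ with $\mathcal{E},\mathcal{F}$ QOPs on $\mathcal{H}_{\bar q}$, $\mathcal{E}+\mathcal{F}\sqsubseteq I\diamond I$, and base $\mathcal{B}$ built from quantum predicate variables (ranging over Hermitian $0\sqsubseteq X\sqsubseteq I$) and identities by tensor product; $P^v$ is its value under assignment $v$. *)

theory Defs
  imports "HOL-Analysis.Analysis" "HOL-Library.Lub_Glb"
begin

section \<open>The Hilbert space of square-summable functions\<close>

class scaleC =
  fixes scaleC :: "complex \<Rightarrow> 'a \<Rightarrow> 'a"  (infixr \<open>*\<^sub>C\<close> 75)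

typedef 'a ell2 = "{x :: 'a \<Rightarrow> complex. (\<lambda>i. (cmod (x i))\<^sup>2) summable_on UNIV}"
  morphisms coord Abs_ell2
  by (rule exI[of _ "\<lambda>_. 0"]) simp

setup_lifting type_definition_ell2

lemma square_summable_add:
  fixes x y :: "'a \<Rightarrow> complex"
  assumes x: "(\<lambda>i. (cmod (x i))\<^sup>2) summable_on A" and y: "(\<lambda>i. (cmod (y i))\<^sup>2) summable_on A"
  shows "(\<lambda>i. (cmod (x i + y i))\<^sup>2) summable_on A"
proof (rule summable_on_comparison_test)
  show "(\<lambda>i. 2 * (cmod (x i))\<^sup>2 + 2 * (cmod (y i))\<^sup>2) summable_on A"
    by (intro summable_on_add summable_on_cmult_right x y)
  fix i
  have "(cmod (x i + y i))\<^sup>2 \<le> (cmod (x i) + cmod (y i))\<^sup>2"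
    by (intro power_mono norm_triangle_ineq) auto
  also have "\<dots> \<le> 2 * (cmod (x i))\<^sup>2 + 2 * (cmod (y i))\<^sup>2"
    using sum_squares_bound[of "cmod (x i)" "cmod (y i)"] by (simp add: power2_sum)
  finally show "(cmod (x i + y i))\<^sup>2 \<le> 2 * (cmod (x i))\<^sup>2 + 2 * (cmod (y i))\<^sup>2" .
qed auto

lemma square_summable_cmult:
  fixes x :: "'a \<Rightarrow> complex"
  assumes "(\<lambda>i. (cmod (x i))\<^sup>2) summable_on A"
  shows "(\<lambda>i. (cmod (c * x i))\<^sup>2) summable_on A"
  using summable_on_cmult_right[OF assms, of "(cmod c)\<^sup>2"] by (simp add: norm_mult power_mult_distrib)

lemma summable_cnj_mult:
  fixes x y :: "'a \<Rightarrow> complex"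
  assumes x: "(\<lambda>i. (cmod (x i))\<^sup>2) summable_on A" and y: "(\<lambda>i. (cmod (y i))\<^sup>2) summable_on A"
  shows "(\<lambda>i. cnj (x i) * y i) summable_on A"
proof (rule abs_summable_summable, rule abs_summable_product)
  show "(\<lambda>i. norm (cnj (x i) * cnj (x i))) summable_on A"
    using x by (simp add: norm_mult power2_eq_square)
  show "(\<lambda>i. norm (y i * y i)) summable_on A"
    using y by (simp add: norm_mult power2_eq_square)
qed

instantiation ell2 :: (type) real_vector
begin
lift_definition zero_ell2 :: "'a ell2" is "\<lambda>_. 0" by simp
lift_definition plus_ell2 :: "'a ell2 \<Rightarrow> 'a ell2 \<Rightarrow> 'a ell2" is "\<lambda>x y i. x i + y i"
  by (rule square_summable_add)
lift_definition uminus_ell2 :: "'a ell2 \<Rightarrow> 'a ell2" is "\<lambda>x i. - x i" by simp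
lift_definition minus_ell2 :: "'a ell2 \<Rightarrow> 'a ell2 \<Rightarrow> 'a ell2" is "\<lambda>x y i. x i - y i"
  subgoal for x y using square_summable_add[of x UNIV "\<lambda>i. - y i"] by simp
  done
lift_definition scaleR_ell2 :: "real \<Rightarrow> 'a ell2 \<Rightarrow> 'a ell2" is "\<lambda>r x i. complex_of_real r * x i"
  by (rule square_summable_cmult)
instance
  by standard (transfer, simp add: fun_eq_iff algebra_simps)+
end

instantiation ell2 :: (type) scaleC
begin
lift_definition scaleC_ell2 :: "complex \<Rightarrow> 'a ell2 \<Rightarrow> 'a ell2" is "\<lambda>c x i. c * x i"
  by (rule square_summable_cmult)
instance ..
end

definition cinner :: "'a ell2 \<Rightarrow> 'a ell2 \<Rightarrow> complex"
  where "cinner x y = (\<Sum>\<^sub>\<infinity>i. cnj (coord x i) * coord y i)"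

lemma coord_square_summable: "(\<lambda>i. (cmod (coord x i))\<^sup>2) summable_on A"
  using coord[of x] summable_on_subset_banach[of _ UNIV A] by auto

lemma coord_mult_summable: "(\<lambda>i. cnj (coord x i) * coord y i) summable_on A"
  by (intro summable_cnj_mult coord_square_summable)

lemma cinner_add_left: "cinner (x + y) z = cinner x z + cinner y z"
  by (simp add: cinner_def plus_ell2.rep_eq ring_distribs infsum_add coord_mult_summable)

lemma cinner_add_right: "cinner x (y + z) = cinner x y + cinner x z"
  by (simp add: cinner_def plus_ell2.rep_eq ring_distribs infsum_add coord_mult_summable)

lemma cinner_scaleC_left: "cinner (c *\<^sub>C x) y = cnj c * cinner x y"
  by (simp add: cinner_def scaleC_ell2.rep_eq mult.assoc infsum_cmult_right')

lemma cinner_scaleC_right: "cinner x (c *\<^sub>C y) = c * cinner x y"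
  by (simp add: cinner_def scaleC_ell2.rep_eq mult.left_commute infsum_cmult_right')

lemma cinner_commute: "cinner x y = cnj (cinner y x)"
  by (simp add: cinner_def flip: infsum_cnj) (simp add: mult.commute)

lemma cinner_self: "cinner x x = complex_of_real (\<Sum>\<^sub>\<infinity>i. (cmod (coord x i))\<^sup>2)"
proof -
  have "cinner x x = (\<Sum>\<^sub>\<infinity>i. complex_of_real ((cmod (coord x i))\<^sup>2))"
    unfolding cinner_def by (rule infsum_cong) (metis complex_norm_square mult.commute)
  also have "\<dots> = complex_of_real (\<Sum>\<^sub>\<infinity>i. (cmod (coord x i))\<^sup>2)"
    by (intro infsumI has_sum_of_real has_sum_infsum coord_square_summable)
  finally show ?thesis .
qed

lemma scaleR_scaleC: "r *\<^sub>R (x :: 'a ell2) = complex_of_real r *\<^sub>C x"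
  by transfer simp

instantiation ell2 :: (type) real_inner
begin
definition inner_ell2 :: "'a ell2 \<Rightarrow> 'a ell2 \<Rightarrow> real" where "inner_ell2 x y = Re (cinner x y)"
definition norm_ell2 :: "'a ell2 \<Rightarrow> real" where "norm_ell2 x = sqrt (inner x x)"
definition dist_ell2 :: "'a ell2 \<Rightarrow> 'a ell2 \<Rightarrow> real" where "dist_ell2 x y = norm (x - y)"
definition sgn_ell2 :: "'a ell2 \<Rightarrow> 'a ell2" where "sgn_ell2 x = x /\<^sub>R norm x"
definition uniformity_ell2 :: "('a ell2 \<times> 'a ell2) filter"
  where "uniformity_ell2 = (INF e\<in>{0<..}. principal {(x, y). dist x y < e})"
definition open_ell2 :: "'a ell2 set \<Rightarrow> bool"
  where "open_ell2 S \<longleftrightarrow> (\<forall>x\<in>S. \<forall>\<^sub>F (x', y) in uniformity. x' = x \<longrightarrow> y \<in> S)"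
instance
proof
  fix x y z :: "'a ell2" and r :: real
  show "inner x y = inner y x"
    unfolding inner_ell2_def by (subst cinner_commute) simp
  show "inner (x + y) z = inner x z + inner y z"
    by (simp add: inner_ell2_def cinner_add_left)
  show "inner (r *\<^sub>R x) y = r * inner x y"
    by (simp add: inner_ell2_def scaleR_scaleC cinner_scaleC_left)
  show "0 \<le> inner x x"
    by (simp add: inner_ell2_def cinner_self infsum_nonneg)
  show "(inner x x = 0) = (x = 0)"
  proof
    assume "inner x x = 0"
    then have "coord x i = 0" for i
      using nonneg_infsum_le_0D[OF _ coord_square_summable[of x UNIV], of i]
      by (simp add: inner_ell2_def cinner_self)
    then show "x = 0"
      by (metis coord_inject ext zero_ell2.rep_eq)
  qed (simp add: inner_ell2_def cinner_def zero_ell2.rep_eq)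
qed (simp_all add: norm_ell2_def dist_ell2_def sgn_ell2_def uniformity_ell2_def open_ell2_def)
end

lemma cinner_cauchy_schwarz: "cmod (cinner x y) \<le> norm x * norm y"
proof (cases "cinner x y = 0")
  case False
  define c where "c = cnj (cinner x y) / cmod (cinner x y)"
  have c: "cmod c = 1" using False by (simp add: c_def norm_divide)
  have "c * cinner x y = complex_of_real (cmod (cinner x y))"
    using False complex_norm_square[of "cinner x y"]
    by (simp add: c_def field_simps power2_eq_square)
  then have "cmod (cinner x y) = inner x (c *\<^sub>C y)"
    by (simp add: inner_ell2_def cinner_scaleC_right)
  also have "\<dots> \<le> norm x * norm (c *\<^sub>C y)" by (rule norm_cauchy_schwarz)
  also have "cinner (c *\<^sub>C y) (c *\<^sub>C y) = cinner y y"
    using complex_norm_square[of c] c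
    by (simp add: cinner_scaleC_right cinner_scaleC_left flip: mult.assoc)
  then have "norm (c *\<^sub>C y) = norm y" by (simp add: norm_eq_sqrt_inner inner_ell2_def)
  finally show ?thesis .
qed simp

lemma norm_scaleC: "norm (c *\<^sub>C (x :: 'a ell2)) = cmod c * norm x"
proof -
  have "cinner (c *\<^sub>C x) (c *\<^sub>C x) = complex_of_real ((cmod c)\<^sup>2) * cinner x x"
    unfolding complex_norm_square
    by (simp add: cinner_scaleC_left cinner_scaleC_right mult_ac)
  then have "inner (c *\<^sub>C x) (c *\<^sub>C x) = (cmod c)\<^sup>2 * inner x x"
    by (simp add: inner_ell2_def)
  then show ?thesis
    by (simp add: norm_eq_sqrt_inner real_sqrt_mult)
qed

lift_definition ket :: "'a \<Rightarrow> 'a ell2" is "\<lambda>s i. if i = s then 1 else 0"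
  subgoal for s
    by (subst summable_on_cong_neutral[where T = "{s}" and g = "\<lambda>_. 1"]) auto
  done


section \<open>Bounded operators\<close>

typedef 'a operator =
  "{f :: 'a ell2 \<Rightarrow> 'a ell2. bounded_linear f \<and> (\<forall>c x. f (c *\<^sub>C x) = c *\<^sub>C f x)}"
  morphisms op_apply Abs_operator
  by (rule exI[of _ "\<lambda>x. x"]) (simp add: bounded_linear_ident)

setup_lifting type_definition_operator

notation op_apply (infixr \<open>*\<^sub>V\<close> 70)

lemma scaleC_ell2_simps:
  fixes x y :: "'a ell2"
  shows "c *\<^sub>C (x + y) = c *\<^sub>C x + c *\<^sub>C y" "c *\<^sub>C (x - y) = c *\<^sub>C x - c *\<^sub>C y"
    "c *\<^sub>C (- x) = - (c *\<^sub>C x)" "c *\<^sub>C (0 :: 'a ell2) = 0" "(c + d) *\<^sub>C x = c *\<^sub>C x + d *\<^sub>C x"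
    "c *\<^sub>C (d *\<^sub>C x) = (c * d) *\<^sub>C x" "1 *\<^sub>C x = x"
  by (transfer, simp add: fun_eq_iff algebra_simps)+

lemma bounded_linear_scaleC: "bounded_linear (\<lambda>x :: 'a ell2. c *\<^sub>C x)"
  by (rule bounded_linear_intro[of _ "cmod c"])
    (simp_all add: scaleC_ell2_simps scaleR_scaleC norm_scaleC mult_ac)

text \<open>The multiplication is composition.  There is deliberately no unit in the class instance:
  the identity of a subsystem is \<open>idop\<close> below.\<close>

instantiation operator :: (type) "{ring, scaleC}"
begin
lift_definition zero_operator :: "'a operator" is "\<lambda>_. 0"
  by (simp add: scaleC_ell2_simps)
lift_definition plus_operator :: "'a operator \<Rightarrow> 'a operator \<Rightarrow> 'a operator" is "\<lambda>f g x. f x + g x"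
  by (auto intro: bounded_linear_add simp: scaleC_ell2_simps)
lift_definition uminus_operator :: "'a operator \<Rightarrow> 'a operator" is "\<lambda>f x. - f x"
  by (auto intro: bounded_linear_minus simp: scaleC_ell2_simps)
lift_definition minus_operator :: "'a operator \<Rightarrow> 'a operator \<Rightarrow> 'a operator" is "\<lambda>f g x. f x - g x"
  by (auto intro: bounded_linear_sub simp: scaleC_ell2_simps)
lift_definition times_operator :: "'a operator \<Rightarrow> 'a operator \<Rightarrow> 'a operator" is "\<lambda>f g x. f (g x)"
  by (auto intro: bounded_linear_compose)
lift_definition scaleC_operator :: "complex \<Rightarrow> 'a operator \<Rightarrow> 'a operator" is "\<lambda>c f x. c *\<^sub>C f x"
  by (auto intro: bounded_linear_compose[OF bounded_linear_scaleC] simp: scaleC_ell2_simps mult.commute)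
instance
  by standard (transfer, auto simp: fun_eq_iff algebra_simps linear_simps)+
end

lemma operator_eqI: "(\<And>x. A *\<^sub>V x = B *\<^sub>V x) \<Longrightarrow> A = B"
  by transfer auto

definition adj :: "'a operator \<Rightarrow> 'a operator"  (\<open>_\<^sup>\<dagger>\<close> [1000] 1000)
  where "A\<^sup>\<dagger> = (THE B. \<forall>x y. cinner (B *\<^sub>V x) y = cinner x (A *\<^sub>V y))"

lemma ketbra_bounded:
  fixes x y :: "'a ell2"
  shows "bounded_linear (\<lambda>z. cinner y z *\<^sub>C x) \<and>
    (\<forall>c z. cinner y (c *\<^sub>C z) *\<^sub>C x = c *\<^sub>C cinner y z *\<^sub>C x)"
proof (intro conjI allI)
  show "bounded_linear (\<lambda>z. cinner y z *\<^sub>C x)"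
  proof (rule bounded_linear_intro[of _ "norm y * norm x"])
    fix u v :: "'a ell2" and r :: real
    show "cinner y (u + v) *\<^sub>C x = cinner y u *\<^sub>C x + cinner y v *\<^sub>C x"
      by (simp add: cinner_add_right scaleC_ell2_simps)
    show "cinner y (r *\<^sub>R u) *\<^sub>C x = r *\<^sub>R cinner y u *\<^sub>C x"
      by (simp add: scaleR_scaleC cinner_scaleC_right scaleC_ell2_simps)
    show "norm (cinner y u *\<^sub>C x) \<le> norm u * (norm y * norm x)"
      using mult_right_mono[OF cinner_cauchy_schwarz[of y u], of "norm x"]
      by (simp add: norm_scaleC mult_ac)
  qed
  show "cinner y (c *\<^sub>C z) *\<^sub>C x = c *\<^sub>C cinner y z *\<^sub>C x" for c z
    by (simp add: cinner_scaleC_right scaleC_ell2_simps)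
qed

definition ketbra :: "'a ell2 \<Rightarrow> 'a ell2 \<Rightarrow> 'a operator"
  where "ketbra x y = Abs_operator (\<lambda>z. cinner y z *\<^sub>C x)"

lemma ketbra_apply: "ketbra x y *\<^sub>V z = cinner y z *\<^sub>C x"
  unfolding ketbra_def by (subst Abs_operator_inverse) (use ketbra_bounded in auto)

text \<open>The Loewner order.  \<open>\<le>\<close> on complex numbers includes that the difference is real.\<close>

lemma quadratic_form_zero:
  assumes "\<And>x. cinner x (A *\<^sub>V x) = 0"
  shows "A = 0"
proof -
  have add: "A *\<^sub>V (x + y) = A *\<^sub>V x + A *\<^sub>V y" for x y
    by transfer (simp add: linear_simps)
  have scale: "A *\<^sub>V (c *\<^sub>C x) = c *\<^sub>C (A *\<^sub>V x)" for c x
    by transfer simp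
  have "cinner y (A *\<^sub>V x) = 0" for x y
  proof -
    have 1: "cinner y (A *\<^sub>V x) + cinner x (A *\<^sub>V y) = 0"
      using assms[of "x + y"] assms[of x] assms[of y]
      by (simp add: add cinner_add_left cinner_add_right)
    have "\<i> * cinner y (A *\<^sub>V x) - \<i> * cinner x (A *\<^sub>V y) = 0"
      using assms[of "\<i> *\<^sub>C x + y"] assms[of x] assms[of y]
      by (simp add: add scale cinner_add_left cinner_add_right cinner_scaleC_left cinner_scaleC_right
          algebra_simps)
    then have "cinner y (A *\<^sub>V x) = cinner x (A *\<^sub>V y)"
      by simp
    with 1 show ?thesis by simp
  qed
  then have "inner (A *\<^sub>V x) (A *\<^sub>V x) = 0" for x
    by (simp add: inner_ell2_def)
  then show ?thesis
    by (intro operator_eqI) (simp add: zero_operator.rep_eq)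
qed

instantiation operator :: (type) order
begin
definition less_eq_operator :: "'a operator \<Rightarrow> 'a operator \<Rightarrow> bool"
  where "A \<le> B \<longleftrightarrow> (\<forall>x. 0 \<le> cinner x ((B - A) *\<^sub>V x))"
definition less_operator :: "'a operator \<Rightarrow> 'a operator \<Rightarrow> bool"
  where "less_operator A B \<longleftrightarrow> A \<le> B \<and> \<not> B \<le> A"
instance
proof
  fix A B C :: "'a operator"
  show "A \<le> A"
    by (simp add: less_eq_operator_def zero_operator.rep_eq cinner_def zero_ell2.rep_eq)
  have add: "cinner x ((C - A) *\<^sub>V x) = cinner x ((C - B) *\<^sub>V x) + cinner x ((B - A) *\<^sub>V x)"
    for x and A B C :: "'a operator"
    by (simp add: minus_operator.rep_eq flip: cinner_add_right)
  show "A \<le> B \<Longrightarrow> B \<le> C \<Longrightarrow> A \<le> C"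
    unfolding less_eq_operator_def using add[where A = A and C = C and B = B] by (metis add_nonneg_nonneg)
  show "A = B" if "A \<le> B" "B \<le> A"
  proof -
    have "cinner x ((A - B) *\<^sub>V x) = 0" for x
    proof -
      have "cinner x ((A - B) *\<^sub>V x) + cinner x ((B - A) *\<^sub>V x) = 0"
        unfolding add[where A = A and C = A and B = B, symmetric]
        by (simp add: zero_operator.rep_eq cinner_def zero_ell2.rep_eq)
      moreover have "0 \<le> cinner x ((A - B) *\<^sub>V x)" "0 \<le> cinner x ((B - A) *\<^sub>V x)"
        using that by (auto simp: less_eq_operator_def)
      ultimately show ?thesis by (metis add_nonneg_eq_0_iff)
    qed
    then show ?thesis using quadratic_form_zero by fastforce
  qed
qed (auto simp: less_operator_def)
end

text \<open>The Hilbert space with orthonormal basis \<open>X\<close> is the closed subspace of \<open>'a ell2\<close> of vectors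
  supported on \<open>X\<close>.  An operator on it is identified with its extension by zero on the orthogonal
  complement; its identity \<open>idop X\<close> is thus the projection onto the subspace.\<close>

definition vecs :: "'a set \<Rightarrow> 'a ell2 set"
  where "vecs X = {x. \<forall>i. i \<notin> X \<longrightarrow> coord x i = 0}"

lemma square_summable_restrict:
  fixes x :: "'a \<Rightarrow> complex"
  assumes "(\<lambda>i. (cmod (x i))\<^sup>2) summable_on UNIV"
  shows "(\<lambda>i. (cmod (if i \<in> X then x i else 0))\<^sup>2) summable_on UNIV"
  by (rule summable_on_comparison_test[OF assms]) auto

lift_definition restrict_vec :: "'a set \<Rightarrow> 'a ell2 \<Rightarrow> 'a ell2" is "\<lambda>X x i. if i \<in> X then x i else 0"
  by (rule square_summable_restrict)

lemma norm_restrict_vec: "norm (restrict_vec X x) \<le> norm x"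
proof -
  have "(\<Sum>\<^sub>\<infinity>i. (cmod (coord (restrict_vec X x) i))\<^sup>2) \<le> (\<Sum>\<^sub>\<infinity>i. (cmod (coord x i))\<^sup>2)"
    by (rule infsum_mono)
      (simp_all add: coord_square_summable restrict_vec.rep_eq square_summable_restrict)
  then show ?thesis
    by (simp add: norm_eq_sqrt_inner inner_ell2_def cinner_self)
qed

lift_definition idop :: "'a set \<Rightarrow> 'a operator" is restrict_vec
proof (intro conjI allI)
  fix X :: "'a set"
  show "bounded_linear (restrict_vec X)"
    by (rule bounded_linear_intro[of _ 1])
      (simp add: norm_restrict_vec | transfer, simp add: fun_eq_iff)+
  show "restrict_vec X (c *\<^sub>C x) = c *\<^sub>C restrict_vec X x" for c and x :: "'a ell2"
    by transfer (simp add: fun_eq_iff)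
qed

definition bops :: "'a set \<Rightarrow> 'a operator set"
  where "bops X = {A. idop X * A * idop X = A}"


section \<open>Trace-class operators and quantum operations\<close>

definition tr :: "'a operator \<Rightarrow> complex"
  where "tr A = (\<Sum>\<^sub>\<infinity>s. cinner (ket s) (A *\<^sub>V ket s))"

definition pos_tc :: "'a set \<Rightarrow> 'a operator set"
  where "pos_tc X = {A \<in> bops X. 0 \<le> A \<and> (\<lambda>s. cinner (ket s) (A *\<^sub>V ket s)) summable_on UNIV}"

text \<open>The trace class is the complex linear span of the cone of positive operators of finite trace.\<close>

definition tc :: "'a set \<Rightarrow> 'a operator set"
  where "tc X = {A - B + \<i> *\<^sub>C (C - D) | A B C D.
    A \<in> pos_tc X \<and> B \<in> pos_tc X \<and> C \<in> pos_tc X \<and> D \<in> pos_tc X}"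

text \<open>Superoperators act on the trace class.  As in \<open>HOL-Library.FuncSet\<close> they take the value
  \<open>undefined\<close> elsewhere, so that equal superoperators are equal functions.\<close>

type_synonym 'a superop = "'a operator \<Rightarrow> 'a operator"

definition superop_linear :: "'a set \<Rightarrow> 'a superop \<Rightarrow> bool"
  where "superop_linear X E \<longleftrightarrow>
    (\<forall>\<rho>\<in>tc X. \<forall>\<sigma>\<in>tc X. E (\<rho> + \<sigma>) = E \<rho> + E \<sigma>) \<and> (\<forall>c. \<forall>\<rho>\<in>tc X. E (c *\<^sub>C \<rho>) = c *\<^sub>C E \<rho>)"

text \<open>Complete positivity: an \<open>n \<times> n\<close> block matrix \<open>R\<close> of trace-class operators is a trace-class operator on
  the tensor product with an \<open>n\<close>-dimensional ancilla, on which \<open>E \<otimes> id\<close> acts blockwise.\<close>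

definition block_pos :: "nat \<Rightarrow> (nat \<Rightarrow> nat \<Rightarrow> 'a operator) \<Rightarrow> bool"
  where "block_pos n R \<longleftrightarrow>
    (\<forall>x :: nat \<Rightarrow> 'a ell2. 0 \<le> (\<Sum>i<n. \<Sum>j<n. cinner (x i) (R i j *\<^sub>V x j)))"

definition completely_positive :: "'a set \<Rightarrow> 'a superop \<Rightarrow> bool"
  where "completely_positive X E \<longleftrightarrow>
    (\<forall>n R. (\<forall>i<n. \<forall>j<n. R i j \<in> tc X) \<and> block_pos n R \<longrightarrow> block_pos n (\<lambda>i j. E (R i j)))"

definition qop :: "'a set \<Rightarrow> 'a superop \<Rightarrow> bool"
  where "qop X E \<longleftrightarrow> E \<in> tc X \<rightarrow>\<^sub>E tc X \<and> superop_linear X E \<and> completely_positive X E \<and>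
    (\<forall>\<rho>\<in>tc X. 0 \<le> \<rho> \<longrightarrow> tr (E \<rho>) \<le> tr \<rho>)"

definition superop_le :: "'a set \<Rightarrow> 'a superop \<Rightarrow> 'a superop \<Rightarrow> bool"
  where "superop_le X E F \<longleftrightarrow> (\<forall>\<rho>\<in>tc X. 0 \<le> \<rho> \<longrightarrow> E \<rho> \<le> F \<rho>)"

definition qop_Lub :: "'a set \<Rightarrow> (nat \<Rightarrow> 'a superop) \<Rightarrow> 'a superop"
  where "qop_Lub X E = (THE L. qop X L \<and> (\<forall>k. superop_le X (E k) L) \<and>
    (\<forall>F. qop X F \<and> (\<forall>k. superop_le X (E k) F) \<longrightarrow> superop_le X L F))"

definition op_Lub :: "'a set \<Rightarrow> (nat \<Rightarrow> 'a operator) \<Rightarrow> 'a operator"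
  where "op_Lub X A = (THE L. isLub (bops X) (range A) L)"

definition op_Glb :: "'a set \<Rightarrow> (nat \<Rightarrow> 'a operator) \<Rightarrow> 'a operator"
  where "op_Glb X A = (THE L. isGlb (bops X) (range A) L)"

text \<open>Possibly infinite sums of operators converge in the weak operator topology.\<close>

definition op_has_sum :: "('i \<Rightarrow> 'a operator) \<Rightarrow> 'i set \<Rightarrow> 'a operator \<Rightarrow> bool"
  where "op_has_sum f I A \<longleftrightarrow> (\<forall>x y. ((\<lambda>i. cinner x (f i *\<^sub>V y)) has_sum cinner x (A *\<^sub>V y)) I)"

definition op_sum :: "('i \<Rightarrow> 'a operator) \<Rightarrow> 'i set \<Rightarrow> 'a operator"
  where "op_sum f I = (THE A. op_has_sum f I A)"

definition superop_sum :: "'a set \<Rightarrow> ('i \<Rightarrow> 'a superop) \<Rightarrow> 'i set \<Rightarrow> 'a superop"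
  where "superop_sum X E I = (\<lambda>\<rho>\<in>tc X. op_sum (\<lambda>i. E i \<rho>) I)"

definition diamond :: "'a set \<Rightarrow> 'a operator \<Rightarrow> 'a operator \<Rightarrow> 'a superop"
  where "diamond X A B = (\<lambda>\<rho>\<in>tc X. A * \<rho> * B)"

definition dual :: "'a set \<Rightarrow> 'a superop \<Rightarrow> 'a operator \<Rightarrow> 'a operator"
  where "dual X E A = (THE B. B \<in> bops X \<and> (\<forall>\<rho>\<in>tc X. tr (A * E \<rho>) = tr (B * \<rho>)))"


section \<open>Quantum variables and subsystems\<close>

datatype qvar = BoolVar nat | IntVar nat

primrec vdom :: "qvar \<Rightarrow> int set"
  where "vdom (BoolVar n) = {0, 1}" | "vdom (IntVar n) = UNIV"

type_synonym cstate = "qvar \<Rightarrow> int"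

text \<open>The computational basis of the state space of the subsystem \<open>V\<close>: the ket of \<open>s\<close> is the
  tensor product of the kets of \<open>s q\<close> for \<open>q \<in> V\<close>.\<close>

definition cstates :: "qvar set \<Rightarrow> cstate set"
  where "cstates V = (\<Pi>\<^sub>E q\<in>V. vdom q)"

abbreviation bops_on :: "qvar set \<Rightarrow> cstate operator set"
  where "bops_on V \<equiv> bops (cstates V)"

abbreviation Id_on_reg :: "qvar set \<Rightarrow> cstate operator"  (\<open>\<one>\<^bsub>_\<^esub>\<close>)
  where "\<one>\<^bsub>V\<^esub> \<equiv> idop (cstates V)"

lift_definition tensor_vec :: "qvar set \<Rightarrow> qvar set \<Rightarrow> cstate ell2 \<Rightarrow> cstate ell2 \<Rightarrow> cstate ell2"
  is "\<lambda>V W x y s. if s \<in> cstates (V \<union> W) then x (restrict s V) * y (restrict s W) else 0"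
proof -
  fix V W :: "qvar set" and x y :: "cstate \<Rightarrow> complex"
  assume x: "(\<lambda>i. (cmod (x i))\<^sup>2) summable_on UNIV" and y: "(\<lambda>i. (cmod (y i))\<^sup>2) summable_on UNIV"
  let ?r = "\<lambda>s. (restrict s V, restrict s W)" and ?S = "cstates (V \<union> W)"
  let ?g = "\<lambda>(s, t). (cmod (x s))\<^sup>2 * (cmod (y t))\<^sup>2"
  have inj: "inj_on ?r ?S"
  proof (rule inj_onI)
    fix s t assume st: "s \<in> ?S" "t \<in> ?S" "?r s = ?r t"
    then have "s q = t q" for q
      by (metis PiE_arb Un_iff cstates_def prod.inject restrict_apply)
    then show "s = t" by blast
  qed
  have "?g summable_on UNIV \<times> UNIV"
  proof (rule summable_on_SigmaI)
    show "((\<lambda>t. ?g (s, t)) has_sum (cmod (x s))\<^sup>2 * (\<Sum>\<^sub>\<infinity>t. (cmod (y t))\<^sup>2)) UNIV" for s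
      using has_sum_cmult_right[OF has_sum_infsum[OF y]] by simp
    show "(\<lambda>s. (cmod (x s))\<^sup>2 * (\<Sum>\<^sub>\<infinity>t. (cmod (y t))\<^sup>2)) summable_on UNIV"
      by (rule summable_on_cmult_left[OF x])
  qed auto
  then have "?g summable_on (?r ` ?S)"
    by (rule summable_on_subset_banach) simp
  then have "(?g \<circ> ?r) summable_on ?S"
    by (simp add: summable_on_reindex[OF inj])
  then show "(\<lambda>s. (cmod (if s \<in> ?S then x (restrict s V) * y (restrict s W) else 0))\<^sup>2) summable_on UNIV"
    by (rule summable_on_cong_neutral[THEN iffD1, rotated -1])
      (auto simp: norm_mult power_mult_distrib)
qed

text \<open>Intended for disjoint \<open>V\<close> and \<open>W\<close> and operators \<open>A\<close>, \<open>B\<close> on them.\<close>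

definition tensor_op :: "qvar set \<Rightarrow> qvar set \<Rightarrow> cstate operator \<Rightarrow> cstate operator \<Rightarrow> cstate operator"
  where "tensor_op V W A B = (THE C. C \<in> bops_on (V \<union> W) \<and>
    (\<forall>x\<in>vecs (cstates V). \<forall>y\<in>vecs (cstates W).
      C *\<^sub>V tensor_vec V W x y = tensor_vec V W (A *\<^sub>V x) (B *\<^sub>V y)))"

text \<open>The cylinder extension to \<open>Q\<close> of an operator on the subsystem \<open>V \<subseteq> Q\<close>.\<close>

definition lift_op :: "qvar set \<Rightarrow> qvar set \<Rightarrow> cstate operator \<Rightarrow> cstate operator"
  where "lift_op Q V A = tensor_op V (Q - V) A \<one>\<^bsub>Q - V\<^esub>"

definition ketbra_var :: "qvar set \<Rightarrow> qvar \<Rightarrow> int \<Rightarrow> int \<Rightarrow> cstate operator"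
  where "ketbra_var Q q i j = lift_op Q {q} (ketbra (ket (\<lambda>_\<in>{q}. i)) (ket (\<lambda>_\<in>{q}. j)))"

definition unitary_on :: "qvar set \<Rightarrow> cstate operator \<Rightarrow> bool"
  where "unitary_on V U \<longleftrightarrow> U \<in> bops_on V \<and> U\<^sup>\<dagger> * U = \<one>\<^bsub>V\<^esub> \<and> U * U\<^sup>\<dagger> = \<one>\<^bsub>V\<^esub>"

definition measurement_on :: "qvar set \<Rightarrow> nat set \<Rightarrow> (nat \<Rightarrow> cstate operator) \<Rightarrow> bool"
  where "measurement_on V I M \<longleftrightarrow>
    (\<forall>m\<in>I. M m \<in> bops_on V) \<and> op_has_sum (\<lambda>m. (M m)\<^sup>\<dagger> * M m) I \<one>\<^bsub>V\<^esub>"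

definition quantum_predicate :: "qvar set \<Rightarrow> cstate operator \<Rightarrow> bool"
  where "quantum_predicate V P \<longleftrightarrow> P \<in> bops_on V \<and> P\<^sup>\<dagger> = P \<and> 0 \<le> P \<and> P \<le> \<one>\<^bsub>V\<^esub>"


section \<open>Recursive quantum programs\<close>

text \<open>\<open>'p\<close> is the type of procedure identifiers.  The register of a unitary or a measurement is a set of
  variables: since the tensor factors are labelled by the variables, no ordering is needed.
  In \<open>If V I M S\<close>, \<open>I\<close> is the (countable, possibly infinite) set of outcomes; \<open>M m\<close> and \<open>S m\<close> are
  irrelevant for \<open>m \<notin> I\<close>.\<close>

datatype 'p stmt =
    Bottom
  | Skip
  | Init qvar
  | Unitary "qvar set" "cstate operator"
  | Seq "'p stmt" "'p stmt"
  | If "qvar set" "nat set" "nat \<Rightarrow> cstate operator" "nat \<Rightarrow> 'p stmt"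
  | Call 'p

type_synonym 'p decl = "'p \<Rightarrow> 'p stmt"

primrec wf_stmt :: "qvar set \<Rightarrow> 'p stmt \<Rightarrow> bool"
  where
    "wf_stmt Q Bottom \<longleftrightarrow> True"
  | "wf_stmt Q Skip \<longleftrightarrow> True"
  | "wf_stmt Q (Init q) \<longleftrightarrow> q \<in> Q"
  | "wf_stmt Q (Unitary V U) \<longleftrightarrow> V \<subseteq> Q \<and> unitary_on V U"
  | "wf_stmt Q (Seq S1 S2) \<longleftrightarrow> wf_stmt Q S1 \<and> wf_stmt Q S2"
  | "wf_stmt Q (If V I M S) \<longleftrightarrow> V \<subseteq> Q \<and> measurement_on V I M \<and> (\<forall>m\<in>I. wf_stmt Q (S m))"
  | "wf_stmt Q (Call p) \<longleftrightarrow> True"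

primrec subst_calls :: "('p \<Rightarrow> 'p stmt) \<Rightarrow> 'p stmt \<Rightarrow> 'p stmt"
  where
    "subst_calls \<sigma> Bottom = Bottom"
  | "subst_calls \<sigma> Skip = Skip"
  | "subst_calls \<sigma> (Init q) = Init q"
  | "subst_calls \<sigma> (Unitary V U) = Unitary V U"
  | "subst_calls \<sigma> (Seq S1 S2) = Seq (subst_calls \<sigma> S1) (subst_calls \<sigma> S2)"
  | "subst_calls \<sigma> (If V I M S) = If V I M (\<lambda>m. subst_calls \<sigma> (S m))"
  | "subst_calls \<sigma> (Call p) = \<sigma> p"

primrec approx :: "'p decl \<Rightarrow> nat \<Rightarrow> 'p \<Rightarrow> 'p stmt"
  where
    "approx D 0 p = Bottom"
  | "approx D (Suc k) p = subst_calls (\<lambda>j. Seq Skip (approx D k j)) (D p)"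

text \<open>The semantic functions are defined relative to a meaning \<open>\<eta>\<close> of the calls.  The syntactic approximations
  contain no calls, so that their meaning does not depend on \<open>\<eta>\<close>; it is then used to
  interpret the calls.  See the lemmas \<open>sem_eqs\<close>, \<open>wp_eqs\<close> and \<open>wlp_eqs\<close> for the resulting equations.\<close>

primrec sem_rel :: "qvar set \<Rightarrow> ('p \<Rightarrow> cstate superop) \<Rightarrow> 'p stmt \<Rightarrow> cstate superop"
  where
    "sem_rel Q \<eta> Bottom = diamond (cstates Q) 0 0"
  | "sem_rel Q \<eta> Skip = diamond (cstates Q) \<one>\<^bsub>Q\<^esub> \<one>\<^bsub>Q\<^esub>"
  | "sem_rel Q \<eta> (Init q) =
      superop_sum (cstates Q) (\<lambda>i. diamond (cstates Q) (ketbra_var Q q 0 i) (ketbra_var Q q i 0)) (vdom q)"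
  | "sem_rel Q \<eta> (Unitary V U) = diamond (cstates Q) (lift_op Q V U) ((lift_op Q V U)\<^sup>\<dagger>)"
  | "sem_rel Q \<eta> (Seq S1 S2) = compose (tc (cstates Q)) (sem_rel Q \<eta> S2) (sem_rel Q \<eta> S1)"
  | "sem_rel Q \<eta> (If V I M S) =
      superop_sum (cstates Q) (\<lambda>m. compose (tc (cstates Q)) (sem_rel Q \<eta> (S m))
        (diamond (cstates Q) (lift_op Q V (M m)) ((lift_op Q V (M m))\<^sup>\<dagger>))) I"
  | "sem_rel Q \<eta> (Call p) = \<eta> p"

definition sem :: "qvar set \<Rightarrow> 'p decl \<Rightarrow> 'p stmt \<Rightarrow> cstate superop"
  where "sem Q D =
    sem_rel Q (\<lambda>p. qop_Lub (cstates Q) (\<lambda>k. sem_rel Q (\<lambda>_. undefined) (approx D k p)))"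

text \<open>\<open>B\<close> is the precondition of \<open>Bottom\<close>, which is all that distinguishes wp from wlp except for calls.\<close>

primrec xp_rel :: "qvar set \<Rightarrow> cstate operator \<Rightarrow> ('p \<Rightarrow> cstate superop) \<Rightarrow>
    'p stmt \<Rightarrow> cstate operator \<Rightarrow> cstate operator"
  where
    "xp_rel Q B \<eta> Bottom P = B"
  | "xp_rel Q B \<eta> Skip P = P"
  | "xp_rel Q B \<eta> (Init q) P = op_sum (\<lambda>i. ketbra_var Q q i 0 * P * ketbra_var Q q 0 i) (vdom q)"
  | "xp_rel Q B \<eta> (Unitary V U) P = (lift_op Q V U)\<^sup>\<dagger> * P * lift_op Q V U"
  | "xp_rel Q B \<eta> (Seq S1 S2) P = xp_rel Q B \<eta> S1 (xp_rel Q B \<eta> S2 P)"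
  | "xp_rel Q B \<eta> (If V I M S) P =
      op_sum (\<lambda>m. (lift_op Q V (M m))\<^sup>\<dagger> * xp_rel Q B \<eta> (S m) P * lift_op Q V (M m)) I"
  | "xp_rel Q B \<eta> (Call p) P = \<eta> p P"

definition wp :: "qvar set \<Rightarrow> 'p decl \<Rightarrow> 'p stmt \<Rightarrow> cstate operator \<Rightarrow> cstate operator"
  where "wp Q D =
    xp_rel Q 0 (\<lambda>p P. op_Lub (cstates Q) (\<lambda>k. xp_rel Q 0 (\<lambda>_. undefined) (approx D k p) P))"

definition wlp :: "qvar set \<Rightarrow> 'p decl \<Rightarrow> 'p stmt \<Rightarrow> cstate operator \<Rightarrow> cstate operator"
  where "wlp Q D =
    xp_rel Q \<one>\<^bsub>Q\<^esub> (\<lambda>p P. op_Glb (cstates Q) (\<lambda>k. xp_rel Q \<one>\<^bsub>Q\<^esub> (\<lambda>_. undefined) (approx D k p) P))"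

primrec call_free :: "'p stmt \<Rightarrow> bool"
  where
    "call_free Bottom \<longleftrightarrow> True"
  | "call_free Skip \<longleftrightarrow> True"
  | "call_free (Init q) \<longleftrightarrow> True"
  | "call_free (Unitary V U) \<longleftrightarrow> True"
  | "call_free (Seq S1 S2) \<longleftrightarrow> call_free S1 \<and> call_free S2"
  | "call_free (If V I M S) \<longleftrightarrow> (\<forall>m. call_free (S m))"
  | "call_free (Call p) \<longleftrightarrow> False"

lemma call_free_subst_calls: "(\<And>p. call_free (\<sigma> p)) \<Longrightarrow> call_free (subst_calls \<sigma> S)"
  by (induction S) auto

lemma call_free_approx: "call_free (approx D k p)"
  by (induction k arbitrary: p) (auto intro: call_free_subst_calls)

lemma sem_rel_call_free: "call_free S \<Longrightarrow> sem_rel Q \<eta> S = sem_rel Q \<eta>' S"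
  by (induction S) auto

lemma xp_rel_call_free: "call_free S \<Longrightarrow> xp_rel Q B \<eta> S P = xp_rel Q B \<eta>' S P"
  by (induction S arbitrary: P) auto

lemma sem_approx: "sem_rel Q \<eta> (approx D k p) = sem Q D (approx D k p)"
  unfolding sem_def by (rule sem_rel_call_free[OF call_free_approx])

lemma wp_approx: "xp_rel Q 0 \<eta> (approx D k p) P = wp Q D (approx D k p) P"
  unfolding wp_def by (rule xp_rel_call_free[OF call_free_approx])

lemma wlp_approx: "xp_rel Q \<one>\<^bsub>Q\<^esub> \<eta> (approx D k p) P = wlp Q D (approx D k p) P"
  unfolding wlp_def by (rule xp_rel_call_free[OF call_free_approx])

lemma sem_eqs:
  "sem Q D Bottom = diamond (cstates Q) 0 0"
  "sem Q D Skip = diamond (cstates Q) \<one>\<^bsub>Q\<^esub> \<one>\<^bsub>Q\<^esub>"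
  "sem Q D (Init q) =
    superop_sum (cstates Q) (\<lambda>i. diamond (cstates Q) (ketbra_var Q q 0 i) (ketbra_var Q q i 0)) (vdom q)"
  "sem Q D (Unitary V U) = diamond (cstates Q) (lift_op Q V U) ((lift_op Q V U)\<^sup>\<dagger>)"
  "sem Q D (Seq S1 S2) = compose (tc (cstates Q)) (sem Q D S2) (sem Q D S1)"
  "sem Q D (If V I M S) =
    superop_sum (cstates Q) (\<lambda>m. compose (tc (cstates Q)) (sem Q D (S m))
      (diamond (cstates Q) (lift_op Q V (M m)) ((lift_op Q V (M m))\<^sup>\<dagger>))) I"
  "sem Q D (Call p) = qop_Lub (cstates Q) (\<lambda>k. sem Q D (approx D k p))"
proof -
  show "sem Q D (Call p) = qop_Lub (cstates Q) (\<lambda>k. sem Q D (approx D k p))"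
    by (subst (1) sem_def) (simp add: sem_approx)
qed (simp_all add: sem_def)

lemma wp_eqs:
  "wp Q D Bottom P = 0"
  "wp Q D Skip P = P"
  "wp Q D (Init q) P = op_sum (\<lambda>i. ketbra_var Q q i 0 * P * ketbra_var Q q 0 i) (vdom q)"
  "wp Q D (Unitary V U) P = (lift_op Q V U)\<^sup>\<dagger> * P * lift_op Q V U"
  "wp Q D (Seq S1 S2) P = wp Q D S1 (wp Q D S2 P)"
  "wp Q D (If V I M S) P =
    op_sum (\<lambda>m. (lift_op Q V (M m))\<^sup>\<dagger> * wp Q D (S m) P * lift_op Q V (M m)) I"
  "wp Q D (Call p) P = op_Lub (cstates Q) (\<lambda>k. wp Q D (approx D k p) P)"
proof -
  show "wp Q D (Call p) P = op_Lub (cstates Q) (\<lambda>k. wp Q D (approx D k p) P)"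
    by (subst (1) wp_def) (simp add: wp_approx)
qed (simp_all add: wp_def)

lemma wlp_eqs:
  "wlp Q D Bottom P = \<one>\<^bsub>Q\<^esub>"
  "wlp Q D Skip P = P"
  "wlp Q D (Init q) P = op_sum (\<lambda>i. ketbra_var Q q i 0 * P * ketbra_var Q q 0 i) (vdom q)"
  "wlp Q D (Unitary V U) P = (lift_op Q V U)\<^sup>\<dagger> * P * lift_op Q V U"
  "wlp Q D (Seq S1 S2) P = wlp Q D S1 (wlp Q D S2 P)"
  "wlp Q D (If V I M S) P =
    op_sum (\<lambda>m. (lift_op Q V (M m))\<^sup>\<dagger> * wlp Q D (S m) P * lift_op Q V (M m)) I"
  "wlp Q D (Call p) P = op_Glb (cstates Q) (\<lambda>k. wlp Q D (approx D k p) P)"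
proof -
  show "wlp Q D (Call p) P = op_Glb (cstates Q) (\<lambda>k. wlp Q D (approx D k p) P)"
    by (subst (1) wlp_def) (simp add: wlp_approx)
qed (simp_all add: wlp_def)


section \<open>Parameterized quantum predicate terms\<close>

text \<open>A predicate variable consists of a name and the register of the predicates it ranges over.\<close>

datatype base =
    PVar nat "qvar set"
  | PId "qvar set"
  | PTensor base base

primrec base_reg :: "base \<Rightarrow> qvar set"
  where
    "base_reg (PVar x V) = V"
  | "base_reg (PId V) = V"
  | "base_reg (PTensor b c) = base_reg b \<union> base_reg c"

primrec wf_base :: "base \<Rightarrow> bool"
  where
    "wf_base (PVar x V) \<longleftrightarrow> True"
  | "wf_base (PId V) \<longleftrightarrow> True"
  | "wf_base (PTensor b c) \<longleftrightarrow> wf_base b \<and> wf_base c \<and> base_reg b \<inter> base_reg c = {}"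

primrec base_pvars :: "base \<Rightarrow> (nat \<times> qvar set) set"
  where
    "base_pvars (PVar x V) = {(x, V)}"
  | "base_pvars (PId V) = {}"
  | "base_pvars (PTensor b c) = base_pvars b \<union> base_pvars c"

type_synonym assignment = "nat \<times> qvar set \<Rightarrow> cstate operator"

primrec base_val :: "assignment \<Rightarrow> base \<Rightarrow> cstate operator"
  where
    "base_val v (PVar x V) = v (x, V)"
  | "base_val v (PId V) = \<one>\<^bsub>V\<^esub>"
  | "base_val v (PTensor b c) = tensor_op (base_reg b) (base_reg c) (base_val v b) (base_val v c)"

datatype pqpt = PQPT (pqpt_E: "cstate superop") (pqpt_F: "cstate superop") (pqpt_base: base)

definition pqpt_reg :: "pqpt \<Rightarrow> qvar set"
  where "pqpt_reg P = base_reg (pqpt_base P)"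

definition wf_pqpt :: "pqpt \<Rightarrow> bool"
  where "wf_pqpt P \<longleftrightarrow> (let X = cstates (pqpt_reg P) in
    wf_base (pqpt_base P) \<and> qop X (pqpt_E P) \<and> qop X (pqpt_F P) \<and>
    superop_le X (\<lambda>\<rho>\<in>tc X. pqpt_E P \<rho> + pqpt_F P \<rho>) (diamond X (idop X) (idop X)))"

definition assignment_for :: "assignment \<Rightarrow> pqpt \<Rightarrow> bool"
  where "assignment_for v P \<longleftrightarrow> (\<forall>(x, V)\<in>base_pvars (pqpt_base P). quantum_predicate V (v (x, V)))"

definition pqpt_val :: "assignment \<Rightarrow> pqpt \<Rightarrow> cstate operator"
  where "pqpt_val v P = (let X = cstates (pqpt_reg P) in
    dual X (pqpt_E P) (base_val v (pqpt_base P)) + dual X (pqpt_F P) (idop X))"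

end

theory Submission
  imports Defs
begin

text \<open>For a quantum operation \<open>E\<close> and \<open>0 \<le> P \<le> I\<close>, the dual \<open>E\<^sup>*(P)\<close> is the operator of the bounded
  positive form \<open>(x, y) \<mapsto> tr (P E(|y\<rangle>\<langle>x|))\<close>; a positive trace-class operator is a sum of rank-one operators
  converging from below in trace, so this form determines \<open>tr (P E(\<rho>))\<close> for all \<open>\<rho>\<close>.  Hence
  \<open>E \<mapsto> E\<^sup>*(P)\<close> turns composition into reversed composition, Kraus sums into the sums that define the
  preconditions of measurements and initialisations, and monotone limits into weak operator limits.
  Relative to call meanings that are related by duality, structural induction on the
  statement therefore gives \<open>wp.S.P = \<lbrakk>S\<rbrakk>\<^sup>*(P)\<close> and \<open>wlp.S.P = I - \<lbrakk>S\<rbrakk>\<^sup>*(I - P)\<close>.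
  Induction on \<open>k\<close> extends both to the approximations of a call, and the limit \<open>k \<rightarrow> \<infinity>\<close> to the calls.
  The second form of the wlp is additivity of \<open>\<lbrakk>S\<rbrakk>\<^sup>*\<close>.  That \<open>P\<^sup>v\<close> is a quantum predicate rests on the
  positivity of tensor products of positive operators.\<close>

text \<open>Adjoints, duals, tensor products, infinite sums and order bounds are definite
  descriptions, so each needs a witness before any equation about it can be used. Adjoints, weak
  limits and duals all obtain theirs from a bounded sesquilinear form through
  \<open>operator_exists\<close>. The main obstacle is that duals are defined by traces, and the
  trace is not continuous for weak operator limits. Domination replaces continuity: if \<tau> \<le>
  \<sigma> and 0 \<le> P \<le> I, then |tr (P \<sigma>) - tr (P \<tau>)| \<le> tr \<sigma> - tr
  \<tau>. This estimate carries the dual from finite rank to the whole trace class, and again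
  through limits of operations. It is also why the argument is confined to predicates. The bound P
  \<le> I and trace non-increase keep the form of the dual below the identity, so duals are
  predicates again and sequential composition can be iterated; I - P stays in the class as well. The
  wlp formula rests on completeness: when the products of Kraus operators with their adjoints sum to
  I, the corresponding clause commutes with P \<mapsto> I - P.\<close>

lemmas op_apply_simps = plus_operator.rep_eq minus_operator.rep_eq uminus_operator.rep_eq
  zero_operator.rep_eq times_operator.rep_eq scaleC_operator.rep_eq idop.rep_eq

lemma bounded_linear_op_apply: "bounded_linear (op_apply A)"
  using op_apply[of A] by simp

lemma op_apply_scaleC: "A *\<^sub>V (c *\<^sub>C x) = c *\<^sub>C (A *\<^sub>V x)"
  using op_apply[of A] by simp

lemmas op_apply_linear =
  bounded_linear.linear[OF bounded_linear_op_apply, THEN linear_add]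
  bounded_linear.linear[OF bounded_linear_op_apply, THEN linear_diff]
  bounded_linear.linear[OF bounded_linear_op_apply, THEN linear_0]
  bounded_linear.linear[OF bounded_linear_op_apply, THEN linear_neg]
  op_apply_scaleC

lemma op_apply_sum_right: "A *\<^sub>V (\<Sum>i\<in>I. f i) = (\<Sum>i\<in>I. A *\<^sub>V f i)"
  by (rule linear_sum[OF bounded_linear.linear[OF bounded_linear_op_apply]])

lemma operator_bound:
  "\<exists>C\<ge>0. \<forall>x. norm (A *\<^sub>V x) \<le> C * norm x"
  using bounded_linear.nonneg_bounded[OF bounded_linear_op_apply[of A]] by (auto simp: mult.commute)

lemma op_apply_sum: "(\<Sum>i\<in>I. f i) *\<^sub>V x = (\<Sum>i\<in>I. f i *\<^sub>V x)"
  by (induction I rule: infinite_finite_induct) (simp_all add: op_apply_simps)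

section \<open>Inner product identities and coordinates\<close>

lemma cinner_zero [simp]: "cinner 0 x = 0" "cinner x 0 = 0"
  by (simp_all add: cinner_def zero_ell2.rep_eq)

lemma cinner_minus: "cinner (- x) y = - cinner x y" "cinner x (- y) = - cinner x y"
  using cinner_scaleC_left[of "-1" x y] cinner_scaleC_right[of x "-1" y]
  by (simp_all add: scaleR_scaleC[of "-1", simplified, symmetric])

lemma cinner_diff: "cinner (x - y) z = cinner x z - cinner y z" "cinner x (y - z) = cinner x y - cinner x z"
  using cinner_add_left[of x "- y" z] cinner_add_right[of x y "- z"] by (simp_all add: cinner_minus)

lemma cinner_sum_right: "cinner x (\<Sum>i\<in>I. f i) = (\<Sum>i\<in>I. cinner x (f i))"
  by (induction I rule: infinite_finite_induct) (simp_all add: cinner_add_right)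

lemma cinner_sum_left: "cinner (\<Sum>i\<in>I. f i) x = (\<Sum>i\<in>I. cinner (f i) x)"
  by (induction I rule: infinite_finite_induct) (simp_all add: cinner_add_left)

lemmas cinner_linear = cinner_add_left cinner_add_right cinner_minus cinner_diff
  cinner_scaleC_left cinner_scaleC_right

lemma cinner_norm: "cinner x x = complex_of_real ((norm x)\<^sup>2)"
proof -
  have "inner x x = Re (cinner x x)" by (simp add: inner_ell2_def)
  moreover have "Im (cinner x x) = 0" by (simp add: cinner_self)
  ultimately show ?thesis by (simp add: complex_eq_iff power2_norm_eq_inner)
qed

lemma has_sum_cinner: "((\<lambda>i. cnj (coord x i) * coord y i) has_sum cinner x y) UNIV"
  unfolding cinner_def by (intro has_sum_infsum coord_mult_summable)

lemma has_sum_norm: "((\<lambda>i. (cmod (coord x i))\<^sup>2) has_sum (norm x)\<^sup>2) UNIV"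
proof -
  have "complex_of_real (\<Sum>\<^sub>\<infinity>i. (cmod (coord x i))\<^sup>2) = complex_of_real ((norm x)\<^sup>2)"
    using cinner_self[of x] cinner_norm[of x] by simp
  then have "(\<Sum>\<^sub>\<infinity>i. (cmod (coord x i))\<^sup>2) = (norm x)\<^sup>2"
    using of_real_eq_iff by blast
  then show ?thesis by (metis has_sum_infsum coord_square_summable)
qed

lemma cinner_ket_left: "cinner (ket s) x = coord x s"
proof -
  have "((\<lambda>i. cnj (coord (ket s) i) * coord x i) has_sum (\<Sum>i\<in>{s}. cnj (coord (ket s) i) * coord x i)) UNIV"
    by (intro has_sum_finite_neutralI[of "{s}"]) (auto simp: ket.rep_eq)
  then show ?thesis using has_sum_cinner[of "ket s" x] by (auto simp: ket.rep_eq dest: has_sum_unique)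
qed

lemma cinner_ket_right: "cinner x (ket s) = cnj (coord x s)"
  by (subst cinner_commute) (simp add: cinner_ket_left)

lemma ell2_eqI: "(\<And>s. coord x s = coord y s) \<Longrightarrow> x = y"
  by (meson coord_inject ext)

lemma ell2_cinner_eqI: "(\<And>z. cinner z x = cinner z y) \<Longrightarrow> x = y"
  by (rule ell2_eqI) (metis cinner_ket_left)

lemma operator_cinner_eqI: "(\<And>x y. cinner x (A *\<^sub>V y) = cinner x (B *\<^sub>V y)) \<Longrightarrow> A = B"
  by (intro operator_eqI ell2_cinner_eqI) auto

text \<open>Over the complex numbers the quadratic form determines the operator. Identities can
  therefore be checked on the diagonal, where the order and the traces against
  \<open>ketbra x x\<close> live.\<close>

lemma operator_quad_eqI:
  assumes "\<And>x. cinner x (A *\<^sub>V x) = cinner x (B *\<^sub>V x)"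
  shows "A = B"
  using quadratic_form_zero[of "A - B"] assms by (simp add: op_apply_simps cinner_diff)

section \<open>Sesquilinear forms\<close>

lemma restrict_vec_finite_eq: "finite F \<Longrightarrow> restrict_vec F x = (\<Sum>s\<in>F. coord x s *\<^sub>C ket s)"
proof (rule ell2_cinner_eqI)
  fix z assume F: "finite F"
  have "cinner z (restrict_vec F x) = (\<Sum>i\<in>F. cnj (coord z i) * coord (restrict_vec F x) i)"
    by (rule has_sum_unique[OF has_sum_cinner], rule has_sum_finite_neutralI)
      (use F in \<open>auto simp: restrict_vec.rep_eq\<close>)
  then show "cinner z (restrict_vec F x) = cinner z (\<Sum>s\<in>F. coord x s *\<^sub>C ket s)"
    by (simp add: cinner_sum_right cinner_linear cinner_ket_right restrict_vec.rep_eq mult.commute)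
qed

text \<open>Pythagoras in coordinates: the squared distance to a truncation is the tail of the norm
  series. This is the density of the finitely supported vectors.\<close>

lemma restrict_vec_tendsto: "((\<lambda>F. norm (x - restrict_vec F x)) \<longlongrightarrow> 0) (finite_subsets_at_top UNIV)"
proof -
  have eq: "(norm (x - restrict_vec F x))\<^sup>2 = (norm x)\<^sup>2 - (\<Sum>s\<in>F. (cmod (coord x s))\<^sup>2)" if "finite F" for F
  proof (rule has_sum_unique[OF has_sum_norm])
    have 1: "((\<lambda>i. if i \<in> F then - (cmod (coord x i))\<^sup>2 else 0) has_sum - (\<Sum>s\<in>F. (cmod (coord x s))\<^sup>2)) UNIV"
      using that by (intro has_sum_finite_neutralI[of F]) (auto simp: sum_negf)
    have 2: "(cmod (coord (x - restrict_vec F x) i))\<^sup>2 =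
      (cmod (coord x i))\<^sup>2 + (if i \<in> F then - (cmod (coord x i))\<^sup>2 else 0)" for i
      by (simp add: minus_ell2.rep_eq restrict_vec.rep_eq)
    show "((\<lambda>i. (cmod (coord (x - restrict_vec F x) i))\<^sup>2) has_sum (norm x)\<^sup>2 - (\<Sum>s\<in>F. (cmod (coord x s))\<^sup>2)) UNIV"
      unfolding 2 using has_sum_add[OF has_sum_norm 1] by simp
  qed
  have "((\<lambda>F. (norm x)\<^sup>2 - (\<Sum>s\<in>F. (cmod (coord x s))\<^sup>2)) \<longlongrightarrow> (norm x)\<^sup>2 - (norm x)\<^sup>2) (finite_subsets_at_top UNIV)"
    by (intro tendsto_intros has_sum_norm[unfolded has_sum_def])
  then have "((\<lambda>F. (norm (x - restrict_vec F x))\<^sup>2) \<longlongrightarrow> 0) (finite_subsets_at_top UNIV)"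
    unfolding diff_self
    by (rule Lim_transform_eventually) (auto intro: eventually_finite_subsets_at_top_weakI simp: eq)
  from tendsto_real_sqrt[OF this] show ?thesis by simp
qed

text \<open>Additivity moves the value at \<open>x\<close> to \<open>x - restrict_vec F x\<close>,
  where the bound tends to zero. This extends identities from basis vectors to all vectors.\<close>

lemma restrict_vec_limit_eq:
  fixes D :: "'a ell2 \<Rightarrow> complex"
  assumes "\<And>x y. D (x + y) = D x + D y" "\<And>x. cmod (D x) \<le> C * norm x"
    and "\<And>F. finite F \<Longrightarrow> D (restrict_vec F x) = 0"
  shows "D x = 0"
proof -
  have 1: "cmod (D x) \<le> C * norm (x - restrict_vec F x)" if "finite F" for F
    using assms(1)[of "x - restrict_vec F x" "restrict_vec F x"] assms(2)[of "x - restrict_vec F x"] assms(3)[OF that]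
    by simp
  have "((\<lambda>F. C * norm (x - restrict_vec F x)) \<longlongrightarrow> C * 0) (finite_subsets_at_top UNIV)"
    by (intro tendsto_intros restrict_vec_tendsto)
  then have "cmod (D x) \<le> C * 0"
    by (rule tendsto_lowerbound) (auto simp: eventually_finite_subsets_at_top 1)
  then show ?thesis by simp
qed

lemma operator_ket_eqI:
  assumes "\<And>s. A *\<^sub>V ket s = B *\<^sub>V ket s"
  shows "A = B"
proof (rule operator_cinner_eqI)
  fix x y
  obtain C where C: "C \<ge> 0" "\<And>x. norm ((A - B) *\<^sub>V x) \<le> C * norm x"
    using operator_bound[of "A - B"] by auto
  have "cinner x ((A - B) *\<^sub>V y) = 0"
  proof (rule restrict_vec_limit_eq[where C = "norm x * C" and D = "\<lambda>y. cinner x ((A - B) *\<^sub>V y)"])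
    show "cmod (cinner x ((A - B) *\<^sub>V y)) \<le> norm x * C * norm y" for y
      using order_trans[OF cinner_cauchy_schwarz mult_left_mono[OF C(2)]] by (simp add: mult.assoc)
    show "cinner x ((A - B) *\<^sub>V restrict_vec F y) = 0" if "finite F" for F
      by (simp add: restrict_vec_finite_eq that op_apply_sum_right op_apply_linear)
        (simp add: op_apply_simps assms scaleC_ell2_simps)
  qed (simp add: op_apply_linear cinner_linear)
  then show "cinner x (A *\<^sub>V y) = cinner x (B *\<^sub>V y)" by (simp add: op_apply_simps cinner_linear)
qed

text \<open>Forms are treated abstractly because adjoints, weak limits and duals are known by their
  matrix elements before they are known as operators.\<close>

locale sesquilinear =
  fixes B :: "'a ell2 \<Rightarrow> 'a ell2 \<Rightarrow> complex"
  assumes add_left: "B (x + y) z = B x z + B y z"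
    and add_right: "B x (y + z) = B x y + B x z"
    and scale_left: "B (c *\<^sub>C x) y = cnj c * B x y"
    and scale_right: "B x (c *\<^sub>C y) = c * B x y"
begin

lemma zero_left: "B 0 y = 0"
  using scale_left[of 0 0 y] by (simp add: scaleC_ell2_simps)

lemma sum_left: "B (\<Sum>i\<in>I. f i) y = (\<Sum>i\<in>I. B (f i) y)"
  by (induction I rule: infinite_finite_induct) (simp_all add: add_left zero_left)

text \<open>Riesz representation in coordinates. The candidate for \<open>A *\<^sub>V y\<close> has
  coordinates \<open>B (ket s) y\<close>; testing the form on a finite truncation \<open>u\<close>
  of that candidate bounds the squared norm of \<open>u\<close> by
  \<open>C * norm u * norm y\<close>, which gives square summability together with the bound
  \<open>C\<close>.\<close>

lemma operator_exists:
  assumes C: "C \<ge> 0" "\<And>x y. cmod (B x y) \<le> C * norm x * norm y"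
  shows "\<exists>A. \<forall>x y. cinner x (A *\<^sub>V y) = B x y"
proof -
  have bound: "(\<Sum>s\<in>F. (cmod (B (ket s) y))\<^sup>2) \<le> (C * norm y)\<^sup>2" if F: "finite F" for F y
  proof -
    define S where "S = (\<Sum>s\<in>F. (cmod (B (ket s) y))\<^sup>2)"
    define u where "u = (\<Sum>s\<in>F. B (ket s) y *\<^sub>C ket s)"
    have "B u y = complex_of_real S"
      unfolding u_def S_def sum_left scale_left of_real_sum complex_norm_square by (simp add: mult.commute)
    moreover have "cinner u u = complex_of_real S"
    proof -
      have "cinner u u = (\<Sum>t\<in>F. \<Sum>s\<in>F. if s = t then B (ket s) y * cnj (B (ket s) y) else 0)"
        unfolding u_def cinner_sum_left cinner_sum_right
        by (intro sum.cong refl) (simp add: cinner_linear cinner_ket_left ket.rep_eq)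
      also have "\<dots> = (\<Sum>s\<in>F. B (ket s) y * cnj (B (ket s) y))"
        using F by (intro sum.cong refl) simp
      finally show ?thesis unfolding S_def of_real_sum complex_norm_square .
    qed
    then have "S = (norm u)\<^sup>2" unfolding cinner_norm of_real_eq_iff by (rule sym)
    moreover have "S \<ge> 0" by (simp add: S_def sum_nonneg)
    ultimately have "(norm u)\<^sup>2 \<le> C * norm u * norm y"
      using C(2)[of u y] by (simp add: norm_power)
    then have "norm u \<le> C * norm y"
    proof (cases "norm u = 0")
      case False
      have "norm u * norm u \<le> norm u * (C * norm y)"
        using \<open>(norm u)\<^sup>2 \<le> C * norm u * norm y\<close> by (simp add: power2_eq_square mult_ac)
      then show ?thesis using False by (simp add: mult_le_cancel_left)
    qed (use C(1) in simp)
    then show ?thesis using \<open>S = (norm u)\<^sup>2\<close> unfolding S_def[symmetric] by (simp add: power_mono)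
  qed
  have summ: "(\<lambda>s. (cmod (B (ket s) y))\<^sup>2) summable_on UNIV" for y
    by (rule nonneg_bdd_above_summable_on) (auto intro!: bdd_aboveI[where M = "(C * norm y)\<^sup>2"] bound)
  define f where "f y = Abs_ell2 (\<lambda>s. B (ket s) y)" for y
  have coord_f: "coord (f y) s = B (ket s) y" for s y
    unfolding f_def using summ by (simp add: Abs_ell2_inverse)
  have "bounded_linear f"
  proof (rule bounded_linear_intro[of _ C])
    fix x y :: "'a ell2" and r :: real
    show "f (x + y) = f x + f y" by (rule ell2_eqI) (simp add: coord_f plus_ell2.rep_eq add_right)
    show "f (r *\<^sub>R x) = r *\<^sub>R f x"
      by (rule ell2_eqI) (simp add: coord_f scaleR_ell2.rep_eq scaleR_scaleC scaleC_ell2.rep_eq scale_right)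
    have "(norm (f x))\<^sup>2 \<le> (C * norm x)\<^sup>2"
      using has_sum_norm[of "f x"]
      by (rule has_sum_le_finite_sums) (auto simp: coord_f bound)
    then show "norm (f x) \<le> norm x * C" using C(1) by (metis mult.commute mult_nonneg_nonneg norm_ge_zero power2_le_imp_le)
  qed
  moreover have "f (c *\<^sub>C x) = c *\<^sub>C f x" for c x
    by (rule ell2_eqI) (simp add: coord_f scaleC_ell2.rep_eq scale_right)
  ultimately have app: "Abs_operator f *\<^sub>V y = f y" for y
    by (subst Abs_operator_inverse) auto
  have "cinner x (f y) = B x y" for x y
  proof -
    \<comment> \<open>Both forms agree when the left argument is a basis vector. The conjugate makes
      the difference linear in \<open>x\<close>, and density settles the rest.\<close>
    define D where "D x = cnj (cinner x (f y) - B x y)" for x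
    have "D x = 0"
    proof (rule restrict_vec_limit_eq[where C = "norm (f y) + C * norm y" and D = D])
      show "D (x + y) = D x + D y" for x y by (simp add: D_def cinner_linear add_left)
      show "cmod (D x) \<le> (norm (f y) + C * norm y) * norm x" for x
      proof -
        have "cmod (D x) \<le> cmod (cinner x (f y)) + cmod (B x y)" 
          unfolding D_def complex_mod_cnj by (rule norm_triangle_ineq4)
        also have "\<dots> \<le> norm x * norm (f y) + C * norm x * norm y"
          by (intro add_mono cinner_cauchy_schwarz C)
        finally show ?thesis by (simp add: algebra_simps)
      qed
      show "D (restrict_vec F x) = 0" if "finite F" for F
        by (simp add: D_def restrict_vec_finite_eq[OF that] cinner_sum_left sum_left scale_left cinner_linear
            cinner_ket_left coord_f)
    qed
    then show ?thesis by (simp add: D_def)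
  qed
  then show ?thesis by (metis app)
qed

text \<open>Realness at \<open>x + y\<close> compares the imaginary parts, realness at
  \<open>x + \<i> *\<^sub>C y\<close> the real parts.\<close>

lemma real_imp_hermitian:
  assumes "\<And>x. Im (B x x) = 0"
  shows "B y x = cnj (B x y)"
proof -
  have "Im (B (x + y) (x + y)) = 0" "Im (B (x + \<i> *\<^sub>C y) (x + \<i> *\<^sub>C y)) = 0" using assms by auto
  then show ?thesis
    using assms[of x] assms[of y] by (simp add: add_left add_right scale_left scale_right complex_eq_iff)
qed

text \<open>The form is only semidefinite, so \<open>B x x\<close> may vanish for nonzero
  \<open>x\<close>; hence the case distinction on the leading coefficient of the quadratic
  polynomial.\<close>

lemma cauchy_schwarz:
  assumes pos: "\<And>x. 0 \<le> B x x"
  shows "(cmod (B x y))\<^sup>2 \<le> Re (B x x) * Re (B y y)"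
proof (cases "B x y = 0")
  case False
  define m where "m = cmod (B x y)"
  have m: "m > 0" using False by (simp add: m_def)
  \<comment> \<open>A phase that turns \<open>B x y\<close> into its modulus, so that the form at
    \<open>t x + c y\<close> is a real quadratic polynomial in \<open>t\<close>.\<close>
  define c where "c = cnj (B x y) / m"
  have im: "Im (B x x) = 0" for x using pos[of x] by (simp add: less_eq_complex_def)
  have cB: "c * B x y = m"
    using False complex_norm_square[of "B x y"] m by (simp add: c_def m_def field_simps power2_eq_square)
  have cc: "cnj c * c = 1" 
  proof -
    have "cmod c = 1" using m by (simp add: c_def m_def norm_divide)
    then show ?thesis using complex_norm_square[of c] by (simp add: mult.commute)
  qed
  have quad: "0 \<le> t\<^sup>2 * Re (B x x) + 2 * t * m + Re (B y y)" for t :: real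
  proof -
    let ?t = "complex_of_real t"
    have "B (?t *\<^sub>C x + c *\<^sub>C y) (?t *\<^sub>C x + c *\<^sub>C y) =
       ?t * ?t * B x x + ?t * (c * B x y) + ?t * cnj (c * B x y) + (cnj c * c) * B y y"
      by (simp add: add_left add_right scale_left scale_right real_imp_hermitian[OF im, of y x] algebra_simps)
    also have "Re \<dots> = t\<^sup>2 * Re (B x x) + 2 * t * m + Re (B y y)"
      unfolding cB cc by (simp add: power2_eq_square)
    finally show ?thesis using pos[of "?t *\<^sub>C x + c *\<^sub>C y"] by (simp add: less_eq_complex_def)
  qed
  have "Re (B x x) \<ge> 0" using pos[of x] by (simp add: less_eq_complex_def)
  then consider "Re (B x x) = 0" | "Re (B x x) > 0" by linarith
  then have "m\<^sup>2 \<le> Re (B x x) * Re (B y y)"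
  proof cases
    case 1
    \<comment> \<open>The polynomial is affine with slope \<open>2 * m\<close> here; at this point
      its value is \<open>-1\<close>, a contradiction.\<close>
    then show ?thesis using quad[of "- (Re (B y y) + 1) / (2 * m)"] m by (simp add: field_simps)
  next
    case 2
    \<comment> \<open>The minimiser of the quadratic polynomial.\<close>
    then show ?thesis using quad[of "- m / Re (B x x)"] by (simp add: field_simps power2_eq_square)
  qed
  then show ?thesis by (simp add: m_def)
next
  case True
  then show ?thesis using pos[of x] pos[of y] by (simp add: less_eq_complex_def)
qed

end

lemma sesquilinear_operator: "sesquilinear (\<lambda>x y. cinner x (A *\<^sub>V y))"
  by standard (simp_all add: cinner_linear op_apply_linear)

section \<open>Adjoints, order and subspaces\<close>

text \<open>The form \<open>cinner (A *\<^sub>V x) y\<close> is bounded; the operator representing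
  it is the witness for the definite description \<open>adj\<close>.\<close>

lemma cinner_adj_left: "cinner (A\<^sup>\<dagger> *\<^sub>V x) y = cinner x (A *\<^sub>V y)"
proof -
  interpret sesquilinear "\<lambda>x y. cinner (A *\<^sub>V x) y"
    by standard (simp_all add: cinner_linear op_apply_linear)
  obtain C where C: "C \<ge> 0" "\<And>x. norm (A *\<^sub>V x) \<le> C * norm x"
    using operator_bound[of A] by auto
  have "cmod (cinner (A *\<^sub>V x) y) \<le> C * norm x * norm y" for x y
    using cinner_cauchy_schwarz[of "A *\<^sub>V x" y] C(2)[of x]
    by (meson mult_right_mono norm_ge_zero order_trans)
  from operator_exists[OF C(1) this]
  obtain B where B: "\<And>x y. cinner x (B *\<^sub>V y) = cinner (A *\<^sub>V x) y" by blast
  have "\<forall>x y. cinner (B *\<^sub>V x) y = cinner x (A *\<^sub>V y)"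
    by (metis B cinner_commute)
  moreover have "B' = B" if "\<forall>x y. cinner (B' *\<^sub>V x) y = cinner x (A *\<^sub>V y)" for B'
    by (rule operator_cinner_eqI) (metis B cinner_commute that)
  ultimately have "\<forall>x y. cinner (A\<^sup>\<dagger> *\<^sub>V x) y = cinner x (A *\<^sub>V y)"
    unfolding adj_def by (rule theI)
  then show ?thesis by blast
qed

lemma cinner_adj_right: "cinner x (A\<^sup>\<dagger> *\<^sub>V y) = cinner (A *\<^sub>V x) y"
  by (metis cinner_adj_left cinner_commute)

lemma adj_eqI: "(\<And>x y. cinner x (B *\<^sub>V y) = cinner (A *\<^sub>V x) y) \<Longrightarrow> A\<^sup>\<dagger> = B"
  by (rule operator_cinner_eqI) (simp add: cinner_adj_right)

lemma adj_adj [simp]: "(A\<^sup>\<dagger>)\<^sup>\<dagger> = A"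
  by (rule adj_eqI) (simp add: cinner_adj_left)

lemma adj_mult: "(A * B)\<^sup>\<dagger> = B\<^sup>\<dagger> * A\<^sup>\<dagger>"
  by (rule adj_eqI) (simp add: cinner_adj_right op_apply_simps)

lemma less_eq_operator_iff: "A \<le> B \<longleftrightarrow> (\<forall>x. cinner x (A *\<^sub>V x) \<le> cinner x (B *\<^sub>V x))"
  by (simp add: less_eq_operator_def op_apply_simps cinner_linear)

lemma pos_operator_iff: "0 \<le> A \<longleftrightarrow> (\<forall>x. 0 \<le> cinner x (A *\<^sub>V x))"
  by (simp add: less_eq_operator_def)

instance operator :: (type) ordered_ab_group_add
  by standard (simp add: less_eq_operator_def)

text \<open>A nonnegative complex number is real, so positivity already makes the quadratic form
  real.\<close>

lemma pos_operator_hermitian: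
  assumes "0 \<le> A" shows "A\<^sup>\<dagger> = A"
proof (rule adj_eqI)
  interpret sesquilinear "\<lambda>x y. cinner x (A *\<^sub>V y)" by (rule sesquilinear_operator)
  fix x y
  have "cinner y (A *\<^sub>V x) = cnj (cinner x (A *\<^sub>V y))"
    by (rule real_imp_hermitian) (use assms in \<open>simp add: pos_operator_iff less_eq_complex_def\<close>)
  then show "cinner x (A *\<^sub>V y) = cinner (A *\<^sub>V x) y"
    by (metis cinner_commute complex_cnj_cnj)
qed

lemma pos_operator_cauchy_schwarz:
  assumes "0 \<le> A"
  shows "(cmod (cinner x (A *\<^sub>V y)))\<^sup>2 \<le> Re (cinner x (A *\<^sub>V x)) * Re (cinner y (A *\<^sub>V y))"
  using sesquilinear.cauchy_schwarz[OF sesquilinear_operator, of A x y] assms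
  by (simp add: pos_operator_iff)

lemma pos_operator_real: "0 \<le> A \<Longrightarrow> cinner x (A *\<^sub>V x) = complex_of_real (Re (cinner x (A *\<^sub>V x)))"
  by (simp add: pos_operator_iff less_eq_complex_def complex_eq_iff)

lemma pos_operator_Re: "0 \<le> A \<Longrightarrow> 0 \<le> Re (cinner x (A *\<^sub>V x))"
  by (simp add: pos_operator_iff less_eq_complex_def)

lemma sandwich_mono: "A \<le> B \<Longrightarrow> K\<^sup>\<dagger> * A * K \<le> K\<^sup>\<dagger> * B * K"
  by (simp add: less_eq_operator_iff op_apply_simps cinner_adj_right)

lemma sandwich_mono': "A \<le> B \<Longrightarrow> K * A * K\<^sup>\<dagger> \<le> K * B * K\<^sup>\<dagger>"
  using sandwich_mono[of A B "K\<^sup>\<dagger>"] by simp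

lemma adj_mult_self_pos: "0 \<le> K\<^sup>\<dagger> * K"
  by (simp add: pos_operator_iff op_apply_simps cinner_adj_right cinner_norm less_eq_complex_def
      del: of_real_power)

lemma cinner_ketbra: "cinner z (ketbra x y *\<^sub>V w) = cinner z x * cinner y w"
  by (simp add: ketbra_apply cinner_linear)

lemma cinner_ketbra_self: "cinner z (ketbra x x *\<^sub>V z) = complex_of_real ((cmod (cinner x z))\<^sup>2)"
  unfolding complex_norm_square cinner_ketbra by (subst (1) cinner_commute) simp

lemma ketbra_pos: "0 \<le> ketbra x x"
  by (simp add: pos_operator_iff cinner_ketbra_self less_eq_complex_def del: of_real_power)

lemma adj_ketbra: "(ketbra x y)\<^sup>\<dagger> = ketbra y x"
  by (rule adj_eqI) (simp add: cinner_ketbra ketbra_apply cinner_linear flip: cinner_commute)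

lemma ketbra_sandwich: "K * ketbra x y * L\<^sup>\<dagger> = ketbra (K *\<^sub>V x) (L *\<^sub>V y)"
  by (rule operator_eqI) (simp add: ketbra_apply op_apply_simps op_apply_linear cinner_adj_right)

lemma vecs_iff: "x \<in> vecs X \<longleftrightarrow> restrict_vec X x = x"
proof
  assume "restrict_vec X x = x"
  then have "coord x i = 0" if "i \<notin> X" for i
    using that restrict_vec.rep_eq[of X x] by (metis (full_types))
  then show "x \<in> vecs X" by (simp add: vecs_def)
next
  assume "x \<in> vecs X"
  then show "restrict_vec X x = x"
    by (intro ell2_eqI) (simp add: vecs_def restrict_vec.rep_eq)
qed

lemma restrict_vec_in_vecs [simp]: "restrict_vec X x \<in> vecs X"
  by (simp add: vecs_def restrict_vec.rep_eq)

lemma ket_in_vecs: "ket s \<in> vecs X \<longleftrightarrow> s \<in> X"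
  by (auto simp: vecs_def ket.rep_eq)

lemma restrict_vec_restrict_vec: "restrict_vec X (restrict_vec Y x) = restrict_vec (X \<inter> Y) x"
  by (rule ell2_eqI) (simp add: restrict_vec.rep_eq)

lemma idop_mult: "idop X * idop Y = idop (X \<inter> Y)"
  by (rule operator_eqI) (simp add: op_apply_simps restrict_vec_restrict_vec)

lemma cinner_restrict_vec: "cinner (restrict_vec X x) y = cinner x (restrict_vec X y)"
  unfolding cinner_def by (rule infsum_cong) (simp add: restrict_vec.rep_eq)

lemma adj_idop [simp]: "(idop X)\<^sup>\<dagger> = idop X"
  by (rule adj_eqI) (simp add: op_apply_simps cinner_restrict_vec)

lemma restrict_vec_UNIV [simp]: "restrict_vec UNIV x = x"
  by (rule ell2_eqI) (simp add: restrict_vec.rep_eq)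

lemma idop_pos [simp]: "0 \<le> idop X"
  using adj_mult_self_pos[of "idop X"] by (simp add: idop_mult)

lemma bopsI: "idop X * A = A \<Longrightarrow> A * idop X = A \<Longrightarrow> A \<in> bops X"
  by (simp add: bops_def)

lemma bopsD: assumes "A \<in> bops X" shows "idop X * A = A" "A * idop X = A"
proof -
  have "idop X * A * idop X = A" using assms by (simp add: bops_def)
  then show "idop X * A = A" "A * idop X = A"
    by (metis idop_mult inf.idem mult.assoc)+
qed

lemma idop_bops [simp]: "idop X \<in> bops X"
  by (simp add: bops_def idop_mult)

lemma bops_zero [simp]: "0 \<in> bops X"
  by (simp add: bops_def)

lemma bops_add: "A \<in> bops X \<Longrightarrow> B \<in> bops X \<Longrightarrow> A + B \<in> bops X"
  by (simp add: bops_def algebra_simps)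

lemma bops_diff: "A \<in> bops X \<Longrightarrow> B \<in> bops X \<Longrightarrow> A - B \<in> bops X"
  by (simp add: bops_def algebra_simps)

lemma bops_sum: "(\<And>i. i \<in> I \<Longrightarrow> f i \<in> bops X) \<Longrightarrow> sum f I \<in> bops X"
  by (induction I rule: infinite_finite_induct) (auto intro: bops_add)

lemma mult_scaleC: "(A :: 'a operator) * (c *\<^sub>C B) = c *\<^sub>C (A * B)" "(c *\<^sub>C A) * B = c *\<^sub>C (A * B)"
  by (auto intro!: operator_eqI simp: op_apply_simps op_apply_linear)

lemma bops_scaleC: "A \<in> bops X \<Longrightarrow> c *\<^sub>C A \<in> bops X"
  by (simp add: bops_def mult_scaleC)

lemma bops_mult: "A \<in> bops X \<Longrightarrow> B \<in> bops X \<Longrightarrow> A * B \<in> bops X"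
  by (rule bopsI) (metis bopsD mult.assoc)+

lemma bops_adj: "A \<in> bops X \<Longrightarrow> A\<^sup>\<dagger> \<in> bops X"
  by (rule bopsI) (metis adj_idop adj_mult bopsD)+

lemma bops_ketbra: "x \<in> vecs X \<Longrightarrow> y \<in> vecs X \<Longrightarrow> ketbra x y \<in> bops X"
  by (simp add: bops_def) (metis adj_idop ketbra_sandwich idop.rep_eq vecs_iff)

lemma bops_apply_restrict_vec: "A \<in> bops X \<Longrightarrow> A *\<^sub>V restrict_vec X x = A *\<^sub>V x"
  by (metis bopsD(2) idop.rep_eq times_operator.rep_eq)

lemma bops_restrict_vec_apply: "A \<in> bops X \<Longrightarrow> restrict_vec X (A *\<^sub>V x) = A *\<^sub>V x"
  by (metis bopsD(1) idop.rep_eq times_operator.rep_eq)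

lemma bops_apply_in_vecs: "A \<in> bops X \<Longrightarrow> A *\<^sub>V x \<in> vecs X"
  by (simp add: vecs_iff bops_restrict_vec_apply)

lemma bops_cinner: "A \<in> bops X \<Longrightarrow> cinner (restrict_vec X x) (A *\<^sub>V restrict_vec X y) = cinner x (A *\<^sub>V y)"
  by (simp add: cinner_restrict_vec bops_apply_restrict_vec bops_restrict_vec_apply)

lemma bops_quad_eqI:
  assumes "A \<in> bops X" "B \<in> bops X" "\<And>x. x \<in> vecs X \<Longrightarrow> cinner x (A *\<^sub>V x) = cinner x (B *\<^sub>V x)"
  shows "A = B"
  by (rule operator_quad_eqI) (metis assms bops_cinner restrict_vec_in_vecs)

lemma bops_leI:
  assumes "A \<in> bops X" "B \<in> bops X" "\<And>x. x \<in> vecs X \<Longrightarrow> cinner x (A *\<^sub>V x) \<le> cinner x (B *\<^sub>V x)"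
  shows "A \<le> B"
  unfolding less_eq_operator_iff by (metis assms bops_cinner restrict_vec_in_vecs)

section \<open>Weak operator limits\<close>

lemma (in sesquilinear) polarization:
  "4 * B x y = B (x + y) (x + y) - B (x - y) (x - y)
    - \<i> * B (x + \<i> *\<^sub>C y) (x + \<i> *\<^sub>C y) + \<i> * B (x - \<i> *\<^sub>C y) (x - \<i> *\<^sub>C y)"
proof -
  have diff: "B (u - v) z = B u z - B v z" "B z (u - v) = B z u - B z v" for u v z
    using add_left[of "u - v" v z] add_right[of z "u - v" v] by simp_all
  show ?thesis by (simp add: diff add_left add_right scale_left scale_right algebra_simps)
qed

text \<open>An arbitrary filter, so that one notion covers both increasing sequences and the finite
  partial sums of an unordered family.\<close>

definition wot_lim :: "('i \<Rightarrow> 'a operator) \<Rightarrow> 'i filter \<Rightarrow> 'a operator \<Rightarrow> bool"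
  where "wot_lim f F A \<longleftrightarrow> (\<forall>x y. ((\<lambda>i. cinner x (f i *\<^sub>V y)) \<longlongrightarrow> cinner x (A *\<^sub>V y)) F)"

lemma op_has_sum_wot_lim: "op_has_sum f I A \<longleftrightarrow> wot_lim (sum f) (finite_subsets_at_top I) A"
  by (simp add: op_has_sum_def has_sum_def wot_lim_def op_apply_sum cinner_sum_right)

lemma wot_limD: "wot_lim f F A \<Longrightarrow> ((\<lambda>i. cinner x (f i *\<^sub>V y)) \<longlongrightarrow> cinner x (A *\<^sub>V y)) F"
  by (simp add: wot_lim_def)

lemma polarization_operator:
  "cinner x (A *\<^sub>V y) = (cinner (x + y) (A *\<^sub>V (x + y)) - cinner (x - y) (A *\<^sub>V (x - y))
    - \<i> * cinner (x + \<i> *\<^sub>C y) (A *\<^sub>V (x + \<i> *\<^sub>C y)) + \<i> * cinner (x - \<i> *\<^sub>C y) (A *\<^sub>V (x - \<i> *\<^sub>C y))) / 4"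
  using sesquilinear.polarization[OF sesquilinear_operator, of x A y] by (simp add: mult.commute)

lemma wot_limI:
  assumes "\<And>x. ((\<lambda>i. cinner x (f i *\<^sub>V x)) \<longlongrightarrow> cinner x (A *\<^sub>V x)) F"
  shows "wot_lim f F A"
  unfolding wot_lim_def
proof (intro allI)
  fix x y
  show "((\<lambda>i. cinner x (f i *\<^sub>V y)) \<longlongrightarrow> cinner x (A *\<^sub>V y)) F"
    by (subst (1 2) polarization_operator) (intro tendsto_intros assms, simp)
qed

lemma op_has_sumI:
  assumes "\<And>x. ((\<lambda>i. cinner x (f i *\<^sub>V x)) has_sum cinner x (A *\<^sub>V x)) I"
  shows "op_has_sum f I A"
  unfolding op_has_sum_wot_lim
  by (rule wot_limI) (use assms in \<open>simp add: has_sum_def op_apply_sum cinner_sum_right\<close>)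

lemma wot_lim_unique: "wot_lim f F A \<Longrightarrow> wot_lim f F B \<Longrightarrow> F \<noteq> bot \<Longrightarrow> A = B"
  by (rule operator_cinner_eqI) (metis tendsto_unique wot_limD)

lemma wot_lim_const: "wot_lim (\<lambda>_. A) F A"
  by (simp add: wot_lim_def)

lemma wot_lim_add: "wot_lim f F A \<Longrightarrow> wot_lim g F B \<Longrightarrow> wot_lim (\<lambda>i. f i + g i) F (A + B)"
  by (auto simp: wot_lim_def op_apply_simps cinner_linear intro!: tendsto_add)

lemma wot_lim_diff: "wot_lim f F A \<Longrightarrow> wot_lim g F B \<Longrightarrow> wot_lim (\<lambda>i. f i - g i) F (A - B)"
  by (auto simp: wot_lim_def op_apply_simps cinner_linear intro!: tendsto_diff)

lemma wot_lim_scaleC: "wot_lim f F A \<Longrightarrow> wot_lim (\<lambda>i. c *\<^sub>C f i) F (c *\<^sub>C A)"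
  by (auto simp: wot_lim_def op_apply_simps cinner_linear intro!: tendsto_mult)

lemma wot_lim_mult: "wot_lim f F A \<Longrightarrow> wot_lim (\<lambda>i. K * f i * L) F (K * A * L)"
proof -
  have "cinner x ((K * T * L) *\<^sub>V y) = cinner (K\<^sup>\<dagger> *\<^sub>V x) (T *\<^sub>V (L *\<^sub>V y))" for x y T
    by (simp add: op_apply_simps cinner_adj_left)
  then show "wot_lim f F A \<Longrightarrow> wot_lim (\<lambda>i. K * f i * L) F (K * A * L)"
    by (simp add: wot_lim_def)
qed

lemma wot_lim_cong: "wot_lim f F A \<Longrightarrow> \<forall>\<^sub>F i in F. f i = g i \<Longrightarrow> wot_lim g F A"
  unfolding wot_lim_def
proof (intro allI)
  fix x y assume *: "\<forall>x y. ((\<lambda>i. cinner x (f i *\<^sub>V y)) \<longlongrightarrow> cinner x (A *\<^sub>V y)) F" "\<forall>\<^sub>F i in F. f i = g i"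
  show "((\<lambda>i. cinner x (g i *\<^sub>V y)) \<longlongrightarrow> cinner x (A *\<^sub>V y)) F"
    by (rule Lim_transform_eventually[OF *(1)[rule_format]]) (use *(2) in eventually_elim, simp)
qed

lemma wot_lim_bops: 
  assumes "wot_lim f F A" "\<forall>\<^sub>F i in F. f i \<in> bops X" "F \<noteq> bot"
  shows "A \<in> bops X"
proof -
  have "wot_lim f F (idop X * A * idop X)"
    using wot_lim_mult[OF assms(1), of "idop X" "idop X"]
    by (rule wot_lim_cong) (use assms(2) in eventually_elim, simp add: bops_def)
  from wot_lim_unique[OF this assms(1,3)] show ?thesis by (simp add: bops_def)
qed

text \<open>The order on complex numbers demands equal imaginary parts; this equality survives the
  limit by uniqueness of limits.\<close>

lemma tendsto_complex_le:
  fixes f g :: "'i \<Rightarrow> complex"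
  assumes "(f \<longlongrightarrow> a) F" "(g \<longlongrightarrow> b) F" "\<forall>\<^sub>F i in F. f i \<le> g i" "F \<noteq> bot"
  shows "a \<le> b"
proof -
  have "Re a \<le> Re b"
    by (rule tendsto_le[OF assms(4) tendsto_Re[OF assms(2)] tendsto_Re[OF assms(1)]])
      (use assms(3) in eventually_elim, simp add: less_eq_complex_def)
  moreover have "((\<lambda>i. Im (f i)) \<longlongrightarrow> Im b) F"
    using tendsto_Im[OF assms(2)]
    by (rule Lim_transform_eventually) (use assms(3) in eventually_elim, simp add: less_eq_complex_def)
  then have "Im a = Im b"
    using tendsto_Im[OF assms(1)] assms(4) tendsto_unique by blast
  ultimately show ?thesis by (simp add: less_eq_complex_def)
qed

lemma wot_lim_le:
  assumes "wot_lim f F A" "wot_lim g F B" "\<forall>\<^sub>F i in F. f i \<le> g i" "F \<noteq> bot"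
  shows "A \<le> B"
  unfolding less_eq_operator_iff
proof
  fix x
  show "cinner x (A *\<^sub>V x) \<le> cinner x (B *\<^sub>V x)"
    by (rule tendsto_complex_le[OF wot_limD[OF assms(1)] wot_limD[OF assms(2)] _ assms(4)])
      (use assms(3) in eventually_elim, simp add: less_eq_operator_iff)
qed

text \<open>Cauchy-Schwarz for the form of \<open>A\<close> gives a bound that depends on
  \<open>B\<close> alone. Being uniform in \<open>A\<close>, it passes to limits.\<close>

lemma pos_operator_cmod_le:
  assumes "0 \<le> A" "A \<le> B" "\<And>x. norm (B *\<^sub>V x) \<le> C * norm x" "C \<ge> 0"
  shows "cmod (cinner x (A *\<^sub>V y)) \<le> C * norm x * norm y"
proof -
  have *: "Re (cinner z (A *\<^sub>V z)) \<le> C * (norm z)\<^sup>2" for z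
  proof -
    have "Re (cinner z (A *\<^sub>V z)) \<le> Re (cinner z (B *\<^sub>V z))"
      using assms(2) by (simp add: less_eq_operator_iff less_eq_complex_def)
    also have "\<dots> \<le> norm z * norm (B *\<^sub>V z)"
      using cinner_cauchy_schwarz complex_Re_le_cmod order_trans by blast
    also have "\<dots> \<le> norm z * (C * norm z)" by (intro mult_left_mono assms) auto
    finally show ?thesis by (simp add: power2_eq_square mult_ac)
  qed
  have "(cmod (cinner x (A *\<^sub>V y)))\<^sup>2 \<le> (C * (norm x)\<^sup>2) * (C * (norm y)\<^sup>2)"
    using pos_operator_cauchy_schwarz[OF assms(1), of x y]
      mult_mono[OF *[of x] *[of y]] pos_operator_Re[OF assms(1), of y] assms(4)
    by (smt (verit) mult_nonneg_nonneg zero_le_power2)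
  also have "\<dots> = (C * norm x * norm y)\<^sup>2" by (simp add: power2_eq_square)
  finally show ?thesis using assms(4) by (auto intro: power2_le_imp_le)
qed

text \<open>Convergence of the quadratic forms suffices: polarization yields all matrix elements,
  their limit inherits the uniform bound, and the limit form is represented by an operator.\<close>

lemma wot_lim_exists:
  assumes bnd: "\<forall>\<^sub>F i in F. 0 \<le> f i \<and> f i \<le> B" and ne: "F \<noteq> bot"
    and lim: "\<And>x. \<exists>l. ((\<lambda>i. cinner x (f i *\<^sub>V x)) \<longlongrightarrow> l) F"
  shows "\<exists>A. wot_lim f F A"
proof -
  from lim obtain q where q: "\<And>x. ((\<lambda>i. cinner x (f i *\<^sub>V x)) \<longlongrightarrow> q x) F" by metis
  have "\<exists>l. ((\<lambda>i. cinner x (f i *\<^sub>V y)) \<longlongrightarrow> l) F" for x y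
    by (subst polarization_operator) (rule exI, (rule tendsto_intros q | simp)+)
  then obtain l where l: "\<And>x y. ((\<lambda>i. cinner x (f i *\<^sub>V y)) \<longlongrightarrow> l x y) F" by metis
  note uniq = tendsto_unique[OF ne]
  obtain C where C: "C \<ge> 0" "\<And>x. norm (B *\<^sub>V x) \<le> C * norm x"
    using operator_bound[of B] by auto
  interpret sesquilinear l
  proof
    fix x y z c
    show "l (x + y) z = l x z + l y z"
      using uniq[OF l[of "x + y" z]] tendsto_add[OF l[of x z] l[of y z]] by (simp add: cinner_linear)
    show "l x (y + z) = l x y + l x z"
      using uniq[OF l[of x "y + z"]] tendsto_add[OF l[of x y] l[of x z]]
      by (simp add: cinner_linear op_apply_linear)
    show "l (c *\<^sub>C x) y = cnj c * l x y"
      using uniq[OF l[of "c *\<^sub>C x" y]] tendsto_mult[OF tendsto_const l[of x y], of "cnj c"]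
      by (simp add: cinner_linear)
    show "l x (c *\<^sub>C y) = c * l x y"
      using uniq[OF l[of x "c *\<^sub>C y"]] tendsto_mult[OF tendsto_const l[of x y], of c]
      by (simp add: cinner_linear op_apply_linear)
  qed
  have "cmod (l x y) \<le> C * norm x * norm y" for x y
    by (rule tendsto_upperbound[OF tendsto_norm[OF l] _ ne])
      (use bnd in eventually_elim, use C pos_operator_cmod_le in blast)
  from operator_exists[OF C(1) this] obtain A where "\<And>x y. cinner x (A *\<^sub>V y) = l x y" by blast
  then have "wot_lim f F A" using l by (simp add: wot_lim_def)
  then show ?thesis ..
qed

lemma has_sum_pos_Re:
  assumes "\<And>i. i \<in> I \<Longrightarrow> 0 \<le> f i"
  shows "((\<lambda>i. cinner x (f i *\<^sub>V x)) has_sum complex_of_real r) I \<longleftrightarrow>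
    ((\<lambda>i. Re (cinner x (f i *\<^sub>V x))) has_sum r) I"
proof -
  have "((\<lambda>i. cinner x (f i *\<^sub>V x)) has_sum complex_of_real r) I \<longleftrightarrow>
    ((\<lambda>i. complex_of_real (Re (cinner x (f i *\<^sub>V x)))) has_sum complex_of_real r) I"
    by (rule has_sum_cong) (use assms pos_operator_real in blast)
  then show ?thesis by (simp add: has_sum_of_real_iff)
qed

lemma op_has_sum_exists:
  assumes pos: "\<And>i. i \<in> I \<Longrightarrow> 0 \<le> f i" and bnd: "\<And>F. finite F \<Longrightarrow> F \<subseteq> I \<Longrightarrow> sum f F \<le> B"
  shows "\<exists>A. op_has_sum f I A"
  unfolding op_has_sum_wot_lim
proof (rule wot_lim_exists)
  show "\<forall>\<^sub>F F in finite_subsets_at_top I. 0 \<le> sum f F \<and> sum f F \<le> B"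
    by (rule eventually_finite_subsets_at_top_weakI) (use pos bnd in \<open>auto intro!: sum_nonneg\<close>)
  show "finite_subsets_at_top I \<noteq> bot" by simp
  fix x
  have "(\<lambda>i. Re (cinner x (f i *\<^sub>V x))) summable_on I"
  proof (rule nonneg_bdd_above_summable_on)
    show "bdd_above (sum (\<lambda>i. Re (cinner x (f i *\<^sub>V x))) ` {F. F \<subseteq> I \<and> finite F})"
      using bnd by (intro bdd_aboveI[where M = "Re (cinner x (B *\<^sub>V x))"])
        (auto simp: less_eq_operator_iff less_eq_complex_def op_apply_sum cinner_sum_right)
  qed (use pos pos_operator_Re in blast)
  then obtain r where "((\<lambda>i. Re (cinner x (f i *\<^sub>V x))) has_sum r) I" by (auto simp: summable_on_def)
  then have "((\<lambda>i. cinner x (f i *\<^sub>V x)) has_sum complex_of_real r) I"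
    using pos by (simp add: has_sum_pos_Re)
  then show "\<exists>l. ((\<lambda>F. cinner x (sum f F *\<^sub>V x)) \<longlongrightarrow> l) (finite_subsets_at_top I)"
    by (auto simp: has_sum_def op_apply_sum cinner_sum_right)
qed

lemma incseq_wot_lim_exists:
  assumes inc: "incseq f" and pos: "\<And>k. 0 \<le> f k" and bnd: "\<And>k. f k \<le> B"
  shows "\<exists>A. wot_lim f sequentially A"
proof (rule wot_lim_exists)
  show "\<forall>\<^sub>F i in sequentially. 0 \<le> f i \<and> f i \<le> B" using pos bnd by simp
  fix x
  have "incseq (\<lambda>k. Re (cinner x (f k *\<^sub>V x)))"
    using inc by (auto simp: incseq_def less_eq_operator_iff less_eq_complex_def)
  moreover have "\<forall>k. Re (cinner x (f k *\<^sub>V x)) \<le> Re (cinner x (B *\<^sub>V x))"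
    using bnd by (simp add: less_eq_operator_iff less_eq_complex_def)
  ultimately obtain l where "(\<lambda>k. Re (cinner x (f k *\<^sub>V x))) \<longlonglongrightarrow> l"
    by (rule incseq_convergent)
  from tendsto_of_real[OF this] show "\<exists>l. (\<lambda>k. cinner x (f k *\<^sub>V x)) \<longlonglongrightarrow> l"
    by (subst pos_operator_real[OF pos]) (rule exI)
qed simp

lemma incseq_wot_lim_le: 
  assumes "incseq f" "wot_lim f sequentially A"
  shows "f k \<le> A"
  by (rule wot_lim_le[OF wot_lim_const assms(2)])
    (use assms(1) in \<open>auto simp: incseq_def eventually_sequentially\<close>)

lemma op_sum_eqI: "op_has_sum f I A \<Longrightarrow> op_sum f I = A"
  unfolding op_sum_def op_has_sum_wot_lim by (rule the_equality) (auto intro: wot_lim_unique)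

text \<open>The order is closed under weak limits, so the limit of an increasing sequence is an
  upper bound lying below all others. Order bounds are thereby computed as limits.\<close>

lemma op_Lub_eqI:
  assumes "incseq f" "wot_lim f sequentially A" "A \<in> bops X"
  shows "op_Lub X f = A"
proof -
  have "isLub (bops X) (range f) A"
    using assms incseq_wot_lim_le[OF assms(1,2)] wot_lim_le[OF assms(2) wot_lim_const]
    by (auto simp: isLub_def leastP_def isUb_def setle_def setge_def)
  moreover from this have "x = A" if "isLub (bops X) (range f) x" for x
    using that by (simp add: isLub_def leastP_def setge_def setle_def order.antisym)
  ultimately show ?thesis unfolding op_Lub_def by (rule the_equality)
qed

lemma op_Glb_eqI:
  assumes "decseq f" "wot_lim f sequentially A" "A \<in> bops X"
  shows "op_Glb X f = A"
proof -
  have "A \<le> f k" for k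
    by (rule wot_lim_le[OF assms(2) wot_lim_const])
      (use assms(1) in \<open>auto simp: decseq_def eventually_sequentially\<close>)
  then have "isGlb (bops X) (range f) A"
    using assms wot_lim_le[OF wot_lim_const assms(2)]
    by (auto simp: isGlb_def greatestP_def isLb_def setle_def setge_def)
  moreover from this have "x = A" if "isGlb (bops X) (range f) x" for x
    using that by (simp add: isGlb_def greatestP_def setge_def setle_def order.antisym)
  ultimately show ?thesis unfolding op_Glb_def by (rule the_equality)
qed

section \<open>Trace-class operators\<close>

text \<open>Column \<open>s\<close> of \<open>R\<close> divided by the square root of its pivot. A
  zero pivot gives the zero vector, since division by zero yields zero; the column itself vanishes
  in that case.\<close>

definition cholesky_vec :: "'a operator \<Rightarrow> 'a \<Rightarrow> 'a ell2"
  where "cholesky_vec R s = complex_of_real (1 / sqrt (Re (cinner (ket s) (R *\<^sub>V ket s)))) *\<^sub>C (R *\<^sub>V ket s)"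

lemma scaleC_zero_minus_one: "0 *\<^sub>C x = (0 :: 'a ell2)" "(- 1) *\<^sub>C x = - (x :: 'a ell2)"
  using scaleR_scaleC[of 0 x] scaleR_scaleC[of "-1" x] by simp_all

text \<open>Cauchy-Schwarz for \<open>R\<close> at \<open>ket s\<close> and \<open>x\<close> says
  exactly that the rank-one part lies below \<open>R\<close>. Vectors killed earlier stay killed
  because \<open>cinner v x\<close> is proportional to
  \<open>cinner (ket s) (R *\<^sub>V x)\<close>.\<close>

lemma cholesky_step:
  fixes R :: "'a operator" and s :: 'a
  assumes pos: "0 \<le> R"
  defines "v \<equiv> cholesky_vec R s"
  shows "0 \<le> R - ketbra v v" "(R - ketbra v v) *\<^sub>V ket s = 0"
    "R *\<^sub>V ket t = 0 \<Longrightarrow> (R - ketbra v v) *\<^sub>V ket t = 0"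
proof -
  define d where "d = Re (cinner (ket s) (R *\<^sub>V ket s))"
  have d: "d \<ge> 0" unfolding d_def by (rule pos_operator_Re[OF pos])
  have v: "v = complex_of_real (1 / sqrt d) *\<^sub>C (R *\<^sub>V ket s)"
    by (simp add: v_def cholesky_vec_def d_def)
  have inner_v: "cinner v x = complex_of_real (1 / sqrt d) * cinner (ket s) (R *\<^sub>V x)" for x
    unfolding v cinner_scaleC_left
    by (simp add: pos_operator_hermitian[OF pos] flip: cinner_adj_right[of _ R])
  have cs: "(cmod (cinner (ket s) (R *\<^sub>V x)))\<^sup>2 \<le> d * Re (cinner x (R *\<^sub>V x))" for x
    using pos_operator_cauchy_schwarz[OF pos, of "ket s" x] by (simp add: d_def)
  have "(cmod (cinner v x))\<^sup>2 \<le> Re (cinner x (R *\<^sub>V x))" for x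
  proof (cases "d = 0")
    case True
    then show ?thesis using pos_operator_Re[OF pos, of x] by (simp add: inner_v)
  next
    case False
    then have "(cmod (cinner v x))\<^sup>2 = (cmod (cinner (ket s) (R *\<^sub>V x)))\<^sup>2 / d"
      using d by (simp add: inner_v norm_mult norm_divide power_divide)
    also have "\<dots> \<le> Re (cinner x (R *\<^sub>V x))"
      using cs[of x] d False by (simp add: divide_le_eq mult.commute)
    finally show ?thesis .
  qed
  then have "ketbra v v \<le> R"
    unfolding less_eq_operator_iff cinner_ketbra_self
    by (subst pos_operator_real[OF pos]) (simp add: less_eq_complex_def)
  then show "0 \<le> R - ketbra v v" by simp
  have R0: "R *\<^sub>V ket s = 0" if "d = 0"
  proof (rule ell2_cinner_eqI)
    fix x
    have "(cmod (cinner x (R *\<^sub>V ket s)))\<^sup>2 \<le> 0"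
      using pos_operator_cauchy_schwarz[OF pos, of x "ket s"] that by (simp add: d_def)
    then show "cinner x (R *\<^sub>V ket s) = cinner x 0" by simp
  qed
  show "(R - ketbra v v) *\<^sub>V ket s = 0"
  proof (cases "d = 0")
    case True
    then show ?thesis using R0 by (simp add: op_apply_simps ketbra_apply v scaleC_ell2_simps)
  next
    case False
    have "cinner (ket s) (R *\<^sub>V ket s) = complex_of_real d"
      unfolding d_def by (rule pos_operator_real[OF pos])
    then have "cinner v (ket s) *\<^sub>C v = (complex_of_real (1 / sqrt d) * complex_of_real d * complex_of_real (1 / sqrt d)) *\<^sub>C (R *\<^sub>V ket s)"
      unfolding inner_v by (simp add: v scaleC_ell2_simps)
    also have "complex_of_real (1 / sqrt d) * complex_of_real d * complex_of_real (1 / sqrt d) = 1"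
      using False d by (simp flip: of_real_mult)
    finally show ?thesis by (simp add: op_apply_simps ketbra_apply scaleC_ell2_simps)
  qed
  show "(R - ketbra v v) *\<^sub>V ket t = 0" if "R *\<^sub>V ket t = 0"
    using that by (simp add: op_apply_simps ketbra_apply inner_v scaleC_zero_minus_one)
qed

primrec cholesky_rest :: "(nat \<Rightarrow> 'a) \<Rightarrow> 'a operator \<Rightarrow> nat \<Rightarrow> 'a operator" where
  "cholesky_rest e A 0 = A"
| "cholesky_rest e A (Suc n) = cholesky_rest e A n -
    ketbra (cholesky_vec (cholesky_rest e A n) (e n)) (cholesky_vec (cholesky_rest e A n) (e n))"

text \<open>A Cholesky factorization along the basis, which serves in place of the spectral theorem: each step
  subtracts a rank-one operator so that the remainder is positive and kills one more basis vector.\<close>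

lemma cholesky:
  fixes A :: "'a operator"
  assumes X: "countable X" and A: "A \<in> bops X" "0 \<le> A"
  shows "\<exists>v :: nat \<Rightarrow> 'a ell2. op_has_sum (\<lambda>n. ketbra (v n) (v n)) UNIV A"
proof -
  obtain e :: "nat \<Rightarrow> 'a" where e: "X \<subseteq> range e"
    using X range_from_nat_into[of X] by (cases "X = {}") (blast, metis order_refl)
  define R where "R = cholesky_rest e A"
  define v where "v n = cholesky_vec (R n) (e n)" for n
  have R0: "R 0 = A" and RS: "R (Suc n) = R n - ketbra (v n) (v n)" for n
    by (simp_all add: R_def v_def)
  have Rpos: "0 \<le> R n" for n
    by (induction n) (simp_all add: R0 A RS cholesky_step(1) v_def del: diff_ge_0_iff_ge)
  have keep: "R (n + k) *\<^sub>V ket t = 0" if "R n *\<^sub>V ket t = 0" for n k t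
    by (induction k) (simp_all add: that RS cholesky_step(3) v_def Rpos)
  \<comment> \<open>Basis vectors in \<open>X\<close> are killed once the enumeration has reached
    them, those outside \<open>X\<close> by \<open>A\<close> itself.\<close>
  have kill: "\<exists>N. \<forall>n\<ge>N. R n *\<^sub>V ket t = 0" for t
  proof (cases "t \<in> X")
    case True
    then obtain i where "t = e i" using e by auto
    then have "R (Suc i) *\<^sub>V ket t = 0" by (simp add: RS cholesky_step(2) v_def Rpos)
    from keep[OF this] show ?thesis by (metis le_Suc_ex)
  next
    case False
    then have "restrict_vec X (ket t) = 0"
      by (intro ell2_eqI) (simp add: restrict_vec.rep_eq ket.rep_eq zero_ell2.rep_eq)
    then have "R 0 *\<^sub>V ket t = 0"
      using bops_apply_restrict_vec[OF A(1), of "ket t"] by (simp add: R0 op_apply_linear)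
    from keep[OF this] show ?thesis by auto
  qed
  have sum: "(\<Sum>i<n. ketbra (v i) (v i)) = A - R n" for n
    by (induction n) (simp_all add: R0 RS)
  have inc: "incseq (\<lambda>n. A - R n)"
    by (rule incseq_SucI) (simp add: RS ketbra_pos)
  have le: "A - R n \<le> A" for n using Rpos[of n] by simp
  have pos: "0 \<le> A - R n" for n
    unfolding sum[symmetric] by (intro sum_nonneg ketbra_pos)
  obtain M where M: "wot_lim (\<lambda>n. A - R n) sequentially M"
    using incseq_wot_lim_exists[OF inc pos le] by blast
  \<comment> \<open>Monotonicity provides some weak limit \<open>M\<close>. On each basis vector the
    remainder is eventually exactly zero, so \<open>M\<close> and \<open>A\<close> agree there, and
    boundedness of both extends the agreement.\<close>
  have "M = A"
  proof (rule operator_ket_eqI)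
    fix t
    show "M *\<^sub>V ket t = A *\<^sub>V ket t"
    proof (rule ell2_cinner_eqI)
      fix z
      obtain N where "\<And>n. n \<ge> N \<Longrightarrow> R n *\<^sub>V ket t = 0" using kill by blast
      then have "(\<lambda>n. cinner z ((A - R n) *\<^sub>V ket t)) \<longlonglongrightarrow> cinner z (A *\<^sub>V ket t)"
        by (intro tendsto_eventually eventually_sequentiallyI[of N]) (simp add: op_apply_simps)
      then show "cinner z (M *\<^sub>V ket t) = cinner z (A *\<^sub>V ket t)"
        by (rule LIMSEQ_unique[OF wot_limD[OF M]])
    qed
  qed
  \<comment> \<open>\<open>op_has_sum\<close> asks for unordered convergence; the nonnegativity of
    the diagonal terms upgrades the convergent series.\<close>
  have "op_has_sum (\<lambda>n. ketbra (v n) (v n)) UNIV A"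
  proof (rule op_has_sumI)
    fix x
    have "(\<lambda>n. \<Sum>i<n. cinner x (ketbra (v i) (v i) *\<^sub>V x)) \<longlonglongrightarrow> cinner x (A *\<^sub>V x)"
      using wot_limD[OF M, of x x] unfolding \<open>M = A\<close> sum[symmetric]
      by (simp add: op_apply_sum cinner_sum_right)
    from tendsto_Re[OF this] have "(\<lambda>n. (cmod (cinner (v n) x))\<^sup>2) sums Re (cinner x (A *\<^sub>V x))"
      by (simp add: sums_def cinner_ketbra_self)
    then have "((\<lambda>n. (cmod (cinner (v n) x))\<^sup>2) has_sum Re (cinner x (A *\<^sub>V x))) UNIV"
      by (rule sums_nonneg_imp_has_sum) simp
    from has_sum_of_real[OF this]
    show "((\<lambda>n. cinner x (ketbra (v n) (v n) *\<^sub>V x)) has_sum cinner x (A *\<^sub>V x)) UNIV"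
      unfolding cinner_ketbra_self by (subst pos_operator_real[OF A(2)])
  qed
  then show ?thesis by blast
qed

text \<open>Takes the place of an eigenvector decomposition. The vectors need be neither orthogonal
  nor normalised; their squared norms are the traces of the summands, so the second conjunct
  expresses a finite trace.\<close>

definition tc_decomp :: "'a operator \<Rightarrow> (nat \<Rightarrow> 'a ell2) \<Rightarrow> bool"
  where "tc_decomp \<rho> v \<longleftrightarrow>
    op_has_sum (\<lambda>n. ketbra (v n) (v n)) UNIV \<rho> \<and> (\<lambda>n. (norm (v n))\<^sup>2) summable_on UNIV"

section \<open>Traces through rank-one decompositions\<close>

lemma op_has_sum_sandwich: "op_has_sum f I A \<Longrightarrow> op_has_sum (\<lambda>i. K * f i * L) I (K * A * L)"
  unfolding op_has_sum_wot_lim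
  by (drule wot_lim_mult[of _ _ _ K L]) (simp add: sum_distrib_left sum_distrib_right)

lemma tc_decomp_sandwich:
  assumes "tc_decomp \<rho> v" shows "tc_decomp (K * \<rho> * K\<^sup>\<dagger>) (\<lambda>n. K *\<^sub>V v n)"
  unfolding tc_decomp_def
proof
  obtain C where C: "C \<ge> 0" "\<And>x. norm (K *\<^sub>V x) \<le> C * norm x"
    using operator_bound[of K] by auto
  show "op_has_sum (\<lambda>n. ketbra (K *\<^sub>V v n) (K *\<^sub>V v n)) UNIV (K * \<rho> * K\<^sup>\<dagger>)"
    using assms op_has_sum_sandwich[of "\<lambda>n. ketbra (v n) (v n)" UNIV \<rho> K "K\<^sup>\<dagger>"]
    by (simp add: tc_decomp_def ketbra_sandwich)
  show "(\<lambda>n. (norm (K *\<^sub>V v n))\<^sup>2) summable_on UNIV"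
  proof (rule summable_on_comparison_test)
    show "(\<lambda>n. C\<^sup>2 * (norm (v n))\<^sup>2) summable_on UNIV"
      using assms by (intro summable_on_cmult_right) (simp add: tc_decomp_def)
    show "(norm (K *\<^sub>V v n))\<^sup>2 \<le> C\<^sup>2 * (norm (v n))\<^sup>2" for n
      using power_mono[OF C(2), of "v n" 2] by (simp add: power_mult_distrib)
  qed simp
qed

lemma tc_decomp_pos: "tc_decomp \<rho> v \<Longrightarrow> 0 \<le> \<rho>"
  unfolding tc_decomp_def op_has_sum_wot_lim
  by (elim conjE, rule wot_lim_le[OF wot_lim_const]) (auto intro!: always_eventually sum_nonneg ketbra_pos)

text \<open>Fubini for the double series \<open>g\<close>: summing over \<open>s\<close> first gives
  the quadratic form of \<open>A\<close> at \<open>v n\<close>, summing over \<open>n\<close> first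
  gives the diagonal of \<open>A * \<rho>\<close>.\<close>

lemma
  assumes "tc_decomp \<rho> v"
  shows tc_decomp_has_sum_trace: "((\<lambda>n. cinner (v n) (A *\<^sub>V v n)) has_sum tr (A * \<rho>)) UNIV"
    and tc_decomp_diag_summable: "(\<lambda>s. cinner (ket s) ((A * \<rho>) *\<^sub>V ket s)) summable_on UNIV"
proof -
  define g where "g = (\<lambda>(n, s). coord (A *\<^sub>V v n) s * cnj (coord (v n) s))"
  \<comment> \<open>Dominates \<open>g\<close> because a * b \<le> a^2 + b^2 for nonnegative a and
    b; its sum over \<open>s\<close> is controlled by the squared norm of
    \<open>v n\<close>.\<close>
  define h where "h = (\<lambda>(n, s). (cmod (coord (A *\<^sub>V v n) s))\<^sup>2 + (cmod (coord (v n) s))\<^sup>2)"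
  obtain C where C: "C \<ge> 0" "\<And>x. norm (A *\<^sub>V x) \<le> C * norm x"
    using operator_bound[of A] by auto
  have sv: "(\<lambda>n. (norm (v n))\<^sup>2) summable_on UNIV" using assms by (simp add: tc_decomp_def)
  have "h summable_on UNIV \<times> UNIV"
  proof (rule summable_on_SigmaI)
    show "((\<lambda>s. h (n, s)) has_sum (norm (A *\<^sub>V v n))\<^sup>2 + (norm (v n))\<^sup>2) UNIV" for n
      unfolding h_def prod.case by (intro has_sum_add has_sum_norm)
    show "(\<lambda>n. (norm (A *\<^sub>V v n))\<^sup>2 + (norm (v n))\<^sup>2) summable_on UNIV"
    proof (rule summable_on_comparison_test)
      show "(\<lambda>n. (C\<^sup>2 + 1) * (norm (v n))\<^sup>2) summable_on UNIV"
        by (intro summable_on_cmult_right sv)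
      show "(norm (A *\<^sub>V v n))\<^sup>2 + (norm (v n))\<^sup>2 \<le> (C\<^sup>2 + 1) * (norm (v n))\<^sup>2" for n
        using power_mono[OF C(2), of "v n" 2] by (simp add: power_mult_distrib algebra_simps)
    qed simp
  qed (simp add: h_def)
  then have "(\<lambda>z. norm (g z)) summable_on UNIV \<times> UNIV"
  proof (rule summable_on_comparison_test)
    fix z :: "nat \<times> 'a"
    obtain n s where z: "z = (n, s)" by (cases z)
    have "0 \<le> cmod (coord (A *\<^sub>V v n) s) * cmod (coord (v n) s)" by simp
    then have "cmod (coord (A *\<^sub>V v n) s) * cmod (coord (v n) s)
      \<le> (cmod (coord (A *\<^sub>V v n) s))\<^sup>2 + (cmod (coord (v n) s))\<^sup>2"
      using sum_squares_bound[of "cmod (coord (A *\<^sub>V v n) s)" "cmod (coord (v n) s)"] by linarith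
    then show "norm (g z) \<le> h z"
      by (simp add: z g_def h_def norm_mult)
  qed simp
  then have gs: "g summable_on UNIV \<times> UNIV" by (rule abs_summable_summable)
  then obtain S where S: "(g has_sum S) (UNIV \<times> UNIV)" by (auto simp: summable_on_def)
  have rows: "((\<lambda>s. g (n, s)) has_sum cinner (v n) (A *\<^sub>V v n)) UNIV" for n
    using has_sum_cinner[of "v n" "A *\<^sub>V v n"] by (simp add: g_def mult.commute)
  have 1: "((\<lambda>n. cinner (v n) (A *\<^sub>V v n)) has_sum S) UNIV"
    by (rule has_sum_SigmaD[OF S]) (rule rows)
  have cols: "((\<lambda>n. g (n, s)) has_sum cinner (ket s) ((A * \<rho>) *\<^sub>V ket s)) UNIV" for s
  proof -
    have "((\<lambda>n. cinner (A\<^sup>\<dagger> *\<^sub>V ket s) (ketbra (v n) (v n) *\<^sub>V ket s)) has_sum cinner (A\<^sup>\<dagger> *\<^sub>V ket s) (\<rho> *\<^sub>V ket s)) UNIV"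
      using assms by (simp add: tc_decomp_def op_has_sum_def)
    then show ?thesis
      by (simp add: cinner_ketbra cinner_adj_left op_apply_simps g_def cinner_ket_left cinner_ket_right)
  qed
  have "((\<lambda>(s, n). g (n, s)) has_sum S) (UNIV \<times> UNIV)"
    using S by (subst (asm) has_sum_swap)
  then have 2: "((\<lambda>s. cinner (ket s) ((A * \<rho>) *\<^sub>V ket s)) has_sum S) UNIV"
    by (rule has_sum_SigmaD) (simp add: cols)
  show "((\<lambda>n. cinner (v n) (A *\<^sub>V v n)) has_sum tr (A * \<rho>)) UNIV"
    using 1 infsumI[OF 2] by (simp add: tr_def)
  show "(\<lambda>s. cinner (ket s) ((A * \<rho>) *\<^sub>V ket s)) summable_on UNIV"
    using 2 by (auto simp: summable_on_def)
qed

lemma op_mult_idop_UNIV [simp]: "idop UNIV * A = A" "A * idop UNIV = A"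
  by (auto intro!: operator_eqI simp: op_apply_simps)

lemma tc_decomp_pos_tc: "tc_decomp \<rho> v \<Longrightarrow> \<rho> \<in> bops X \<Longrightarrow> \<rho> \<in> pos_tc X"
  using tc_decomp_diag_summable[of \<rho> v "idop UNIV"] by (simp add: pos_tc_def tc_decomp_pos)

lemma tc_decomp_ketbra: "tc_decomp (ketbra x x) (\<lambda>n. if n = 0 then x else 0)"
  unfolding tc_decomp_def
proof
  have z: "ketbra 0 0 = (0 :: 'a operator)"
    by (rule operator_quad_eqI) (simp add: cinner_ketbra op_apply_simps)
  show "op_has_sum (\<lambda>n :: nat. ketbra (if n = 0 then x else 0) (if n = 0 then x else 0)) UNIV (ketbra x x)"
    by (rule op_has_sumI, rule has_sum_finite_neutralI[where B = "{0}"]) (auto simp: z op_apply_simps)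
  show "(\<lambda>n :: nat. (norm (if n = 0 then x else 0))\<^sup>2) summable_on UNIV"
    unfolding summable_on_def
    by (rule exI, rule has_sum_finite_neutralI[where B = "{0}"]) auto
qed

lemma ketbra_pos_tc: "x \<in> vecs X \<Longrightarrow> ketbra x x \<in> pos_tc X"
  by (rule tc_decomp_pos_tc[OF tc_decomp_ketbra]) (simp add: bops_ketbra)

lemma tr_mult_ketbra: "tr (A * ketbra x x) = cinner x (A *\<^sub>V x)"
  by (rule has_sum_unique[OF tc_decomp_has_sum_trace[OF tc_decomp_ketbra]],
      rule has_sum_finite_neutralI[where B = "{0}"]) auto

lemma tr_ketbra: "tr (ketbra x x) = complex_of_real ((norm x)\<^sup>2)"
  using tr_mult_ketbra[of "idop UNIV" x] by (simp add: op_apply_simps cinner_norm)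

lemma pos_tc_tc: "A \<in> pos_tc X \<Longrightarrow> A \<in> tc X"
proof -
  have "0 \<in> pos_tc X" by (simp add: pos_tc_def op_apply_simps)
  moreover have "A = A - 0 + \<i> *\<^sub>C (0 - 0)"
    by (rule operator_eqI) (simp add: op_apply_simps scaleC_ell2_simps)
  ultimately show "A \<in> pos_tc X \<Longrightarrow> A \<in> tc X" unfolding tc_def by blast
qed

lemma pos_tcD: "A \<in> pos_tc X \<Longrightarrow> A \<in> bops X" "A \<in> pos_tc X \<Longrightarrow> 0 \<le> A"
  by (auto simp: pos_tc_def)

text \<open>Reduces linear statements to the positive cone, where rank-one decompositions are
  available; the two combining steps rebuild the complex span.\<close>

lemma tc_induct [consumes 1, case_names pos diff imag]:
  assumes "\<rho> \<in> tc X"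
    and "\<And>A. A \<in> pos_tc X \<Longrightarrow> P A"
    and "\<And>A B. P A \<Longrightarrow> P B \<Longrightarrow> A \<in> tc X \<Longrightarrow> B \<in> tc X \<Longrightarrow> P (A - B)"
    and "\<And>A B. P A \<Longrightarrow> P B \<Longrightarrow> A \<in> tc X \<Longrightarrow> B \<in> tc X \<Longrightarrow> P (A + \<i> *\<^sub>C B)"
  shows "P \<rho>"
proof -
  obtain A B C D where \<rho>: "\<rho> = A - B + \<i> *\<^sub>C (C - D)"
    and ps: "A \<in> pos_tc X" "B \<in> pos_tc X" "C \<in> pos_tc X" "D \<in> pos_tc X"
    using assms(1) unfolding tc_def by blast
  have d: "A - B \<in> tc X" if "A \<in> pos_tc X" "B \<in> pos_tc X" for A B
  proof -
    have "0 \<in> pos_tc X" by (simp add: pos_tc_def op_apply_simps)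
    moreover have "A - B = A - B + \<i> *\<^sub>C (0 - 0)"
      by (rule operator_eqI) (simp add: op_apply_simps scaleC_ell2_simps)
    ultimately show ?thesis using that unfolding tc_def by blast
  qed
  show ?thesis unfolding \<rho> by (intro assms d ps pos_tc_tc)
qed

section \<open>Linear structure of the trace class\<close>

lemma pos_tc_add: "A \<in> pos_tc X \<Longrightarrow> B \<in> pos_tc X \<Longrightarrow> A + B \<in> pos_tc X"
  by (auto simp: pos_tc_def bops_add op_apply_simps cinner_linear intro: summable_on_add)

lemma pos_tc_scale:
  assumes "A \<in> pos_tc X" "r \<ge> 0" shows "complex_of_real r *\<^sub>C A \<in> pos_tc X"
  using assms
  by (auto simp: pos_tc_def bops_scaleC op_apply_simps cinner_linear pos_operator_iff less_eq_complex_def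
      intro: summable_on_cmult_right)

lemma operator_scaleC_simps:
  fixes A B :: "'a operator"
  shows "c *\<^sub>C (A + B) = c *\<^sub>C A + c *\<^sub>C B" "c *\<^sub>C (A - B) = c *\<^sub>C A - c *\<^sub>C B"
    "c *\<^sub>C d *\<^sub>C A = (c * d) *\<^sub>C A" "1 *\<^sub>C A = A" "0 *\<^sub>C A = 0" "(-1) *\<^sub>C A = - A"
    "(c + d) *\<^sub>C A = c *\<^sub>C A + d *\<^sub>C A" "c *\<^sub>C (0 :: 'a operator) = 0"
  by (auto intro!: operator_eqI simp: op_apply_simps scaleC_ell2_simps scaleC_zero_minus_one)

lemma tc_add: "A \<in> tc X \<Longrightarrow> B \<in> tc X \<Longrightarrow> A + B \<in> tc X"
proof -
  assume "A \<in> tc X" "B \<in> tc X"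
  then obtain A1 A2 A3 A4 B1 B2 B3 B4 where
    "A = A1 - A2 + \<i> *\<^sub>C (A3 - A4)" "B = B1 - B2 + \<i> *\<^sub>C (B3 - B4)"
    and ps: "A1 \<in> pos_tc X" "A2 \<in> pos_tc X" "A3 \<in> pos_tc X" "A4 \<in> pos_tc X"
      "B1 \<in> pos_tc X" "B2 \<in> pos_tc X" "B3 \<in> pos_tc X" "B4 \<in> pos_tc X"
    unfolding tc_def by blast
  then have "A + B = (A1 + B1) - (A2 + B2) + \<i> *\<^sub>C ((A3 + B3) - (A4 + B4))"
    by (simp add: operator_scaleC_simps)
  then show ?thesis unfolding tc_def using ps pos_tc_add by blast
qed

lemma tc_scaleC: 
  assumes "A \<in> tc X" shows "c *\<^sub>C A \<in> tc X"
proof -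
  have i: "\<i> *\<^sub>C A \<in> tc X" if A: "A \<in> tc X" for A :: "'a operator"
  proof -
    obtain A1 A2 A3 A4 where "A = A1 - A2 + \<i> *\<^sub>C (A3 - A4)"
      and ps: "A1 \<in> pos_tc X" "A2 \<in> pos_tc X" "A3 \<in> pos_tc X" "A4 \<in> pos_tc X"
      using A unfolding tc_def by blast
    then have "\<i> *\<^sub>C A = A4 - A3 + \<i> *\<^sub>C (A1 - A2)"
      by (simp add: operator_scaleC_simps)
    then show ?thesis using ps unfolding tc_def by blast
  qed
  have r: "complex_of_real r *\<^sub>C A \<in> tc X" if A: "A \<in> tc X" and r: "r \<ge> 0" for A :: "'a operator" and r
  proof -
    obtain A1 A2 A3 A4 where "A = A1 - A2 + \<i> *\<^sub>C (A3 - A4)"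
      and ps: "A1 \<in> pos_tc X" "A2 \<in> pos_tc X" "A3 \<in> pos_tc X" "A4 \<in> pos_tc X"
      using A unfolding tc_def by blast
    then have "complex_of_real r *\<^sub>C A = complex_of_real r *\<^sub>C A1 - complex_of_real r *\<^sub>C A2
      + \<i> *\<^sub>C (complex_of_real r *\<^sub>C A3 - complex_of_real r *\<^sub>C A4)"
      by (simp add: operator_scaleC_simps mult.commute)
    then show ?thesis using ps pos_tc_scale[OF _ r] unfolding tc_def by blast
  qed
  have m: "- A \<in> tc X" if "A \<in> tc X" for A :: "'a operator"
    using i[OF i[OF that]] by (simp add: operator_scaleC_simps)
  have r': "complex_of_real r *\<^sub>C A \<in> tc X" if "A \<in> tc X" for A :: "'a operator" and r
  proof (cases "r \<ge> 0")
    case False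
    then have "- (complex_of_real (- r) *\<^sub>C A) \<in> tc X" using that by (intro m r) auto
    then show ?thesis by (simp add: operator_scaleC_simps flip: operator_scaleC_simps(6))
  qed (rule r[OF that])
  have "c *\<^sub>C A = complex_of_real (Re c) *\<^sub>C A + \<i> *\<^sub>C (complex_of_real (Im c) *\<^sub>C A)"
    by (subst complex_eq[of c]) (simp add: operator_scaleC_simps)
  then show ?thesis using assms by (auto intro: tc_add i r')
qed

lemma tc_diff: "A \<in> tc X \<Longrightarrow> B \<in> tc X \<Longrightarrow> A - B \<in> tc X"
  using tc_add[OF _ tc_scaleC[of B X "-1"], of A] by (simp add: operator_scaleC_simps)

lemma tc_bops: "A \<in> tc X \<Longrightarrow> A \<in> bops X"
  by (induction rule: tc_induct) (auto intro: bops_add bops_diff bops_scaleC pos_tcD)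

lemma zero_tc: "0 \<in> tc X"
  by (rule pos_tc_tc) (simp add: pos_tc_def op_apply_simps)

lemma tc_sum: "(\<And>i. i \<in> I \<Longrightarrow> f i \<in> tc X) \<Longrightarrow> sum f I \<in> tc X"
  by (induction I rule: infinite_finite_induct) (auto intro: tc_add zero_tc)

text \<open>\<open>cholesky\<close> runs along an enumeration of the basis. For program states,
  countability will come from the finiteness of the register.\<close>

locale countable_basis =
  fixes X :: "'a set"
  assumes countable: "countable X"
begin

text \<open>The diagonal of \<rho> sums the squared coordinates of all the vectors of a Cholesky
  factorization. Exchanging the sums turns finite trace into summability of their squared
  norms.\<close>

lemma pos_tc_decomp:
  assumes "\<rho> \<in> pos_tc X"
  shows "\<exists>v. tc_decomp \<rho> v \<and> (\<forall>n. v n \<in> vecs X)"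
proof -
  note \<rho> = pos_tcD[OF assms]
  obtain v :: "nat \<Rightarrow> 'a ell2" where v: "op_has_sum (\<lambda>n. ketbra (v n) (v n)) UNIV \<rho>"
    using cholesky[OF countable \<rho>] by blast
  define g where "g = (\<lambda>(s, n). (cmod (coord (v n) s))\<^sup>2)"
  have "(\<lambda>s. Re (cinner (ket s) (\<rho> *\<^sub>V ket s))) summable_on UNIV"
    using assms summable_on_Re by (auto simp: pos_tc_def)
  moreover have "((\<lambda>n. g (s, n)) has_sum Re (cinner (ket s) (\<rho> *\<^sub>V ket s))) UNIV" for s
  proof -
    have "((\<lambda>n. cinner (ket s) (ketbra (v n) (v n) *\<^sub>V ket s)) has_sum cinner (ket s) (\<rho> *\<^sub>V ket s)) UNIV"
      using v by (simp add: op_has_sum_def)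
    from has_sum_Re[OF this] show ?thesis by (simp add: cinner_ketbra_self cinner_ket_right g_def)
  qed
  ultimately have "g summable_on UNIV \<times> UNIV"
    by (intro summable_on_SigmaI) (auto simp: g_def)
  then have "(\<lambda>(n, s). g (s, n)) summable_on UNIV \<times> UNIV" by (subst (asm) summable_on_swap)
  then obtain S where "((\<lambda>(n, s). g (s, n)) has_sum S) (UNIV \<times> UNIV)" by (auto simp: summable_on_def)
  then have "((\<lambda>n. (norm (v n))\<^sup>2) has_sum S) UNIV"
    by (rule has_sum_SigmaD) (simp add: g_def has_sum_norm)
  then have "tc_decomp \<rho> v" using v by (auto simp: tc_decomp_def summable_on_def)
  \<comment> \<open>Compressing by the projection leaves \<rho> unchanged but moves the vectors into
    the subspace.\<close>
  from tc_decomp_sandwich[OF this, of "idop X"] \<rho> show ?thesis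
    by (auto simp: bops_def op_apply_simps)
qed

text \<open>\<open>infsum\<close> is zero on families that are not summable, so additivity of
  \<open>tr\<close> requires that every diagonal involved be summable.\<close>

lemma diag_summable: "\<rho> \<in> tc X \<Longrightarrow> (\<lambda>s. cinner (ket s) ((A * \<rho>) *\<^sub>V ket s)) summable_on UNIV"
proof (induction rule: tc_induct)
  case (pos \<rho>)
  then show ?case using pos_tc_decomp tc_decomp_diag_summable by blast
next
  case (diff B C)
  show ?case
    using summable_on_add[OF diff(1) summable_on_uminus[THEN iffD2, OF diff(2)]]
    by (simp add: op_apply_simps op_apply_linear cinner_linear)
next
  case (imag B C)
  then show ?case
    by (auto simp: op_apply_simps op_apply_linear cinner_linear intro: summable_on_add summable_on_cmult_right)
qed

section \<open>Linearity, positivity and cyclicity of the trace\<close>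

lemma tr_mult_add: "\<rho> \<in> tc X \<Longrightarrow> \<sigma> \<in> tc X \<Longrightarrow> tr (A * (\<rho> + \<sigma>)) = tr (A * \<rho>) + tr (A * \<sigma>)"
  using diag_summable[of \<rho> A] diag_summable[of \<sigma> A]
  by (simp add: tr_def op_apply_simps op_apply_linear cinner_linear infsum_add)

lemma tr_mult_scaleC: "tr (A * (c *\<^sub>C \<rho>)) = c * tr (A * \<rho>)"
  by (simp add: tr_def op_apply_simps op_apply_linear cinner_linear infsum_cmult_right')

lemma tr_mult_diff: "\<rho> \<in> tc X \<Longrightarrow> \<sigma> \<in> tc X \<Longrightarrow> tr (A * (\<rho> - \<sigma>)) = tr (A * \<rho>) - tr (A * \<sigma>)"
  using tr_mult_add[of \<rho> "(-1) *\<^sub>C \<sigma>" A] tr_mult_scaleC[of A "-1" \<sigma>] tc_scaleC[of \<sigma> X "-1"]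
  by (simp add: operator_scaleC_simps)

lemma tr_add_mult: "\<rho> \<in> tc X \<Longrightarrow> tr ((A + B) * \<rho>) = tr (A * \<rho>) + tr (B * \<rho>)"
  using diag_summable[of \<rho> A] diag_summable[of \<rho> B]
  by (simp add: tr_def op_apply_simps op_apply_linear cinner_linear infsum_add)

lemma tr_diff_mult: "\<rho> \<in> tc X \<Longrightarrow> tr ((A - B) * \<rho>) = tr (A * \<rho>) - tr (B * \<rho>)"
  using tr_add_mult[of \<rho> "A - B" B] by simp

lemma tr_mult_zero: "tr (A * 0) = 0"
  by (simp add: tr_def op_apply_simps)

lemma tr_mult_sum: "(\<And>i. i \<in> I \<Longrightarrow> f i \<in> tc X) \<Longrightarrow> tr (A * sum f I) = (\<Sum>i\<in>I. tr (A * f i))"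
proof (induction I rule: infinite_finite_induct)
  case (insert i I)
  then show ?case by (simp add: tr_mult_add tc_sum del: mult_1 distrib_left)
qed (simp_all add: tr_def op_apply_simps)

lemma tr_sum: "(\<And>i. i \<in> I \<Longrightarrow> f i \<in> tc X) \<Longrightarrow> tr (sum f I) = (\<Sum>i\<in>I. tr (f i))"
  using tr_mult_sum[of I f "idop UNIV"] by simp

lemma tr_add: "\<rho> \<in> tc X \<Longrightarrow> \<sigma> \<in> tc X \<Longrightarrow> tr (\<rho> + \<sigma>) = tr \<rho> + tr \<sigma>"
  using tr_mult_add[of \<rho> \<sigma> "idop UNIV"] by simp

lemma tr_diff: "\<rho> \<in> tc X \<Longrightarrow> \<sigma> \<in> tc X \<Longrightarrow> tr (\<rho> - \<sigma>) = tr \<rho> - tr \<sigma>"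
  using tr_mult_diff[of \<rho> \<sigma> "idop UNIV"] by simp

lemma tr_pos:
  assumes "0 \<le> A" "\<rho> \<in> pos_tc X" shows "0 \<le> tr (A * \<rho>)"
proof -
  obtain v where v: "tc_decomp \<rho> v" using pos_tc_decomp[OF assms(2)] by blast
  show ?thesis
    by (rule tendsto_complex_le[OF tendsto_const tc_decomp_has_sum_trace[OF v, of A, unfolded has_sum_def]])
      (use assms(1) in \<open>auto intro!: always_eventually sum_nonneg simp: pos_operator_iff less_eq_complex_def\<close>)
qed

lemma tr_mono: "A \<le> B \<Longrightarrow> \<rho> \<in> pos_tc X \<Longrightarrow> tr (A * \<rho>) \<le> tr (B * \<rho>)"
  using tr_pos[of "B - A" \<rho>] by (simp add: tr_diff_mult pos_tc_tc less_eq_complex_def)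

lemma pos_tc_tr: "\<rho> \<in> pos_tc X \<Longrightarrow> 0 \<le> tr \<rho>"
  using tr_pos[of "idop UNIV" \<rho>] by simp

lemma pos_tc_sandwich:
  assumes "\<rho> \<in> pos_tc X" "K \<in> bops X" shows "K * \<rho> * K\<^sup>\<dagger> \<in> pos_tc X"
  using pos_tc_decomp[OF assms(1)] tc_decomp_sandwich tc_decomp_pos_tc
  by (metis assms bops_adj bops_mult pos_tcD(1))

lemma tc_sandwich:
  assumes "\<rho> \<in> tc X" "K \<in> bops X" shows "K * \<rho> * K\<^sup>\<dagger> \<in> tc X"
  using assms(1)
proof (induction rule: tc_induct)
  case (pos \<rho>)
  then show ?case using pos_tc_sandwich assms(2) pos_tc_tc by blast
qed (auto simp: algebra_simps mult_scaleC intro: tc_diff tc_add tc_scaleC)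

text \<open>An instance of cyclicity: \<open>K *\<^sub>V v n\<close> decomposes the conjugated
  operator, so for positive \<rho> both sides are the same series.\<close>

lemma tr_sandwich:
  assumes "\<rho> \<in> tc X" "K \<in> bops X" shows "tr (A * (K * \<rho> * K\<^sup>\<dagger>)) = tr (K\<^sup>\<dagger> * A * K * \<rho>)"
  using assms(1)
proof (induction rule: tc_induct)
  case (pos \<rho>)
  then obtain v where v: "tc_decomp \<rho> v" using pos_tc_decomp by blast
  have "((\<lambda>n. cinner (v n) ((K\<^sup>\<dagger> * A * K) *\<^sub>V v n)) has_sum tr (A * (K * \<rho> * K\<^sup>\<dagger>))) UNIV"
    using tc_decomp_has_sum_trace[OF tc_decomp_sandwich[OF v, of K], of A]
    by (simp add: op_apply_simps cinner_adj_right)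
  then show ?case by (rule has_sum_unique[OF _ tc_decomp_has_sum_trace[OF v]])
next
  case (diff B C)
  have "A * (K * (B - C) * K\<^sup>\<dagger>) = A * (K * B * K\<^sup>\<dagger> - K * C * K\<^sup>\<dagger>)" by (simp add: algebra_simps)
  then show ?case using diff by (simp only: tr_mult_diff tc_sandwich assms(2))
next
  case (imag B C)
  have "A * (K * (B + \<i> *\<^sub>C C) * K\<^sup>\<dagger>) = A * (K * B * K\<^sup>\<dagger> + \<i> *\<^sub>C (K * C * K\<^sup>\<dagger>))"
    by (simp add: algebra_simps mult_scaleC)
  then show ?case using imag by (simp only: tr_mult_add tr_mult_scaleC tc_scaleC tc_sandwich assms(2))
qed

lemma tc_pos_iff: "\<rho> \<in> pos_tc X \<longleftrightarrow> \<rho> \<in> tc X \<and> 0 \<le> \<rho>"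
  using diag_summable[of \<rho> "idop UNIV"] by (auto intro: pos_tc_tc pos_tcD simp: pos_tc_def tc_bops)

lemma pos_tc_le:
  assumes "\<rho> \<in> pos_tc X" "\<sigma> \<in> bops X" "0 \<le> \<sigma>" "\<sigma> \<le> \<rho>" shows "\<sigma> \<in> pos_tc X"
proof -
  have "(\<lambda>s. Re (cinner (ket s) (\<sigma> *\<^sub>V ket s))) summable_on UNIV"
  proof (rule summable_on_comparison_test)
    show "(\<lambda>s. Re (cinner (ket s) (\<rho> *\<^sub>V ket s))) summable_on UNIV"
      using assms(1) summable_on_Re by (auto simp: pos_tc_def)
  qed (use assms in \<open>auto simp: less_eq_operator_iff less_eq_complex_def op_apply_simps\<close>)
  then have "(\<lambda>s. complex_of_real (Re (cinner (ket s) (\<sigma> *\<^sub>V ket s)))) summable_on UNIV"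
    by (rule summable_on_of_real)
  then have "(\<lambda>s. cinner (ket s) (\<sigma> *\<^sub>V ket s)) summable_on UNIV"
    by (simp flip: pos_operator_real[OF assms(3)])
  then show ?thesis using assms by (simp add: pos_tc_def)
qed

text \<open>The remainder is positive and trace class, which allows a trace-nonincreasing map to
  bound the error by a trace that tends to zero.\<close>

lemma pos_tc_finite_rank_tendsto:
  assumes "tc_decomp \<rho> v" "\<And>n. v n \<in> vecs X" "\<rho> \<in> bops X"
  defines "\<rho>\<^sub>N \<equiv> \<lambda>N. \<Sum>n<N. ketbra (v n) (v n)"
  shows "\<rho>\<^sub>N N \<in> pos_tc X" "\<rho> - \<rho>\<^sub>N N \<in> pos_tc X" "(\<lambda>N. tr (A * \<rho>\<^sub>N N)) \<longlonglongrightarrow> tr (A * \<rho>)"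
proof -
  have p: "\<rho> \<in> pos_tc X" by (rule tc_decomp_pos_tc[OF assms(1,3)])
  have "incseq \<rho>\<^sub>N" by (rule incseq_SucI) (simp add: \<rho>\<^sub>N_def ketbra_pos)
  moreover have "wot_lim \<rho>\<^sub>N sequentially \<rho>"
    unfolding wot_lim_def
  proof (intro allI)
    fix x y
    have "((\<lambda>n. cinner x (ketbra (v n) (v n) *\<^sub>V y)) has_sum cinner x (\<rho> *\<^sub>V y)) UNIV"
      using assms(1) by (simp add: tc_decomp_def op_has_sum_def)
    from has_sum_imp_sums[OF this]
    show "(\<lambda>N. cinner x (\<rho>\<^sub>N N *\<^sub>V y)) \<longlonglongrightarrow> cinner x (\<rho> *\<^sub>V y)"
      by (simp add: sums_def \<rho>\<^sub>N_def op_apply_sum cinner_sum_right)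
  qed
  ultimately have le: "\<rho>\<^sub>N N \<le> \<rho>" for N by (rule incseq_wot_lim_le)
  have b: "\<rho>\<^sub>N N \<in> bops X" for N unfolding \<rho>\<^sub>N_def by (intro bops_sum bops_ketbra assms)
  have pos: "0 \<le> \<rho>\<^sub>N N" for N unfolding \<rho>\<^sub>N_def by (intro sum_nonneg ketbra_pos)
  show "\<rho>\<^sub>N N \<in> pos_tc X" by (rule pos_tc_le[OF p b pos le])
  show "\<rho> - \<rho>\<^sub>N N \<in> pos_tc X"
    by (rule pos_tc_le[OF p]) (use b pos le assms in \<open>auto intro: bops_diff\<close>)
  have "tr (A * \<rho>\<^sub>N N) = (\<Sum>n<N. cinner (v n) (A *\<^sub>V v n))" for N
    unfolding \<rho>\<^sub>N_def using assms(2) 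
    by (subst tr_mult_sum) (auto intro: pos_tc_tc ketbra_pos_tc simp: tr_mult_ketbra)
  then show "(\<lambda>N. tr (A * \<rho>\<^sub>N N)) \<longlonglongrightarrow> tr (A * \<rho>)"
    using has_sum_imp_sums[OF tc_decomp_has_sum_trace[OF assms(1), of A]] by (simp add: sums_def)
qed

end

section \<open>Quantum operations and their duals\<close>

lemma ketbra_linear:
  "ketbra (x + y) z = ketbra x z + ketbra y z" "ketbra z (x + y) = ketbra z x + ketbra z y"
  "ketbra (c *\<^sub>C x) y = c *\<^sub>C ketbra x y" "ketbra x (c *\<^sub>C y) = cnj c *\<^sub>C ketbra x y"
  by (auto intro!: operator_eqI simp: ketbra_apply op_apply_simps cinner_linear scaleC_ell2_simps mult.commute)

lemma vecs_closed: 
  "x \<in> vecs X \<Longrightarrow> y \<in> vecs X \<Longrightarrow> x + y \<in> vecs X" "x \<in> vecs X \<Longrightarrow> y \<in> vecs X \<Longrightarrow> x - y \<in> vecs X"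
  "x \<in> vecs X \<Longrightarrow> c *\<^sub>C x \<in> vecs X"
  by (simp_all add: vecs_def plus_ell2.rep_eq minus_ell2.rep_eq scaleC_ell2.rep_eq)

text \<open>Polarization writes an off-diagonal rank-one operator as a combination of four positive
  ones.\<close>

lemma ketbra_tc:
  assumes "x \<in> vecs X" "y \<in> vecs X" shows "ketbra x y \<in> tc X"
proof -
  have m: "u - v = u + (- 1) *\<^sub>C v" for u v :: "'a ell2" by (simp add: scaleC_zero_minus_one)
  have "ketbra x y = (1 / 4) *\<^sub>C (ketbra (x + y) (x + y) - ketbra (x - y) (x - y)
    + \<i> *\<^sub>C (ketbra (x + \<i> *\<^sub>C y) (x + \<i> *\<^sub>C y) - ketbra (x - \<i> *\<^sub>C y) (x - \<i> *\<^sub>C y)))"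
    by (rule operator_cinner_eqI)
      (simp add: m ketbra_linear op_apply_simps cinner_linear cinner_ketbra, simp add: algebra_simps)
  also have "\<dots> \<in> tc X"
    by (intro tc_scaleC tc_add tc_diff pos_tc_tc ketbra_pos_tc vecs_closed assms)
  finally show ?thesis .
qed

lemma operator_scaleC_sum: "c *\<^sub>C (\<Sum>i\<in>I. f i) = (\<Sum>i\<in>I. c *\<^sub>C (f i :: 'a operator))"
  by (induction I rule: infinite_finite_induct) (simp_all add: operator_scaleC_simps)

text \<open>Quantum predicates over an abstract basis. Duals of quantum operations and complements
  stay in this class, so it can serve as the invariant of the inductions over programs.\<close>

definition predicate_on :: "'a set \<Rightarrow> 'a operator \<Rightarrow> bool"
  where "predicate_on X P \<longleftrightarrow> P \<in> bops X \<and> 0 \<le> P \<and> P \<le> idop X"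

lemma predicate_on_idop: "predicate_on X (idop X)"
  by (simp add: predicate_on_def)

lemma predicate_on_compl: "predicate_on X P \<Longrightarrow> predicate_on X (idop X - P)"
  by (simp add: predicate_on_def bops_diff)

lemma complex_sum_nonneg: "(\<And>i. i \<in> I \<Longrightarrow> 0 \<le> f i) \<Longrightarrow> 0 \<le> (\<Sum>i\<in>I. f i :: complex)"
  by (auto simp: less_eq_complex_def intro!: sum_nonneg sum.neutral)

lemma block_pos_1: "block_pos (Suc 0) R \<longleftrightarrow> 0 \<le> R 0 0"
  by (auto simp: block_pos_def pos_operator_iff lessThan_Suc dest: spec[of _ "\<lambda>_. _"])

lemma qop_tc: "qop X E \<Longrightarrow> \<rho> \<in> tc X \<Longrightarrow> E \<rho> \<in> tc X"
  by (auto simp: qop_def)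

lemma qop_add: "qop X E \<Longrightarrow> \<rho> \<in> tc X \<Longrightarrow> \<sigma> \<in> tc X \<Longrightarrow> E (\<rho> + \<sigma>) = E \<rho> + E \<sigma>"
  by (auto simp: qop_def superop_linear_def)

lemma qop_scaleC: "qop X E \<Longrightarrow> \<rho> \<in> tc X \<Longrightarrow> E (c *\<^sub>C \<rho>) = c *\<^sub>C E \<rho>"
  by (auto simp: qop_def superop_linear_def)

lemma qop_diff: "qop X E \<Longrightarrow> \<rho> \<in> tc X \<Longrightarrow> \<sigma> \<in> tc X \<Longrightarrow> E (\<rho> - \<sigma>) = E \<rho> - E \<sigma>"
  using qop_add[of X E \<rho> "(-1) *\<^sub>C \<sigma>"] qop_scaleC[of X E \<sigma> "-1"] tc_scaleC[of \<sigma> X "-1"]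
  by (simp add: operator_scaleC_simps)

lemma qop_extensional: "qop X E \<Longrightarrow> E \<in> extensional (tc X)"
  by (auto simp: qop_def PiE_def)

lemma qop_tr_le: "qop X E \<Longrightarrow> \<rho> \<in> pos_tc X \<Longrightarrow> tr (E \<rho>) \<le> tr \<rho>"
  by (auto simp: qop_def pos_tc_tc pos_tcD)

text \<open>Complete positivity with a one-dimensional ancilla.\<close>

lemma qop_pos:
  assumes "qop X E" "\<rho> \<in> pos_tc X" shows "0 \<le> E \<rho>"
proof -
  have "completely_positive X E" using assms(1) by (simp add: qop_def)
  then have "block_pos (Suc 0) (\<lambda>_ _. E \<rho>)"
    unfolding completely_positive_def
    by (rule allE[of _ "Suc 0"], elim allE[of _ "\<lambda>_ _. \<rho>"] impE)
      (use assms(2) in \<open>auto simp: block_pos_1 pos_tc_tc pos_tcD\<close>)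
  then show ?thesis by (simp add: block_pos_1)
qed

lemma superop_leD: "superop_le X E F \<Longrightarrow> \<rho> \<in> pos_tc X \<Longrightarrow> E \<rho> \<le> F \<rho>"
  by (simp add: superop_le_def pos_tc_tc pos_tcD)

lemma linear_eq_on_tc:
  assumes E: "superop_linear X E" "E \<in> extensional (tc X)" and F: "superop_linear X F" "F \<in> extensional (tc X)"
    and eq: "\<And>\<rho>. \<rho> \<in> pos_tc X \<Longrightarrow> E \<rho> = F \<rho>"
  shows "E = F"
proof (rule extensionalityI[OF E(2) F(2)])
  have d: "G (\<rho> - \<sigma>) = G \<rho> - G \<sigma>" if "superop_linear X G" "\<rho> \<in> tc X" "\<sigma> \<in> tc X" for G \<rho> \<sigma>
  proof -
    have "G (\<rho> + (-1) *\<^sub>C \<sigma>) = G \<rho> + (-1) *\<^sub>C G \<sigma>"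
      using that tc_scaleC[of \<sigma> X "-1"] by (simp add: superop_linear_def)
    then show ?thesis by (simp add: operator_scaleC_simps)
  qed
  fix \<rho> assume "\<rho> \<in> tc X"
  then show "E \<rho> = F \<rho>"
  proof (induction rule: tc_induct)
    case (imag A B)
    then show ?case using E(1) F(1) by (simp add: superop_linear_def tc_scaleC)
  qed (simp_all add: eq d E F)
qed

text \<open>Testing on \<open>ketbra x x\<close> reads off the quadratic form, so the operator in
  the definite description is unique.\<close>

lemma dual_eqI:
  assumes "W \<in> bops X" "\<And>\<rho>. \<rho> \<in> tc X \<Longrightarrow> tr (P * E \<rho>) = tr (W * \<rho>)"
  shows "dual X E P = W"
  unfolding dual_def
proof (rule the_equality)
  show "W \<in> bops X \<and> (\<forall>\<rho>\<in>tc X. tr (P * E \<rho>) = tr (W * \<rho>))" using assms by blast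
  fix B assume B: "B \<in> bops X \<and> (\<forall>\<rho>\<in>tc X. tr (P * E \<rho>) = tr (B * \<rho>))"
  show "B = W"
  proof (rule bops_quad_eqI)
    fix x assume "x \<in> vecs X"
    then have "ketbra x x \<in> tc X" by (simp add: ketbra_tc)
    then show "cinner x (B *\<^sub>V x) = cinner x (W *\<^sub>V x)"
      using B assms(2) by (metis tr_mult_ketbra)
  qed (use B assms in auto)
qed

section \<open>Existence and laws of the dual\<close>

context countable_basis
begin

lemma qop_pos_tc: "qop X E \<Longrightarrow> \<rho> \<in> pos_tc X \<Longrightarrow> E \<rho> \<in> pos_tc X"
  by (simp add: tc_pos_iff qop_tc qop_pos)

lemma tr_predicate_le:
  assumes "predicate_on X P" "\<rho> \<in> pos_tc X" shows "tr (P * \<rho>) \<le> tr \<rho>"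
proof -
  have "tr (P * \<rho>) \<le> tr (idop X * \<rho>)" using assms by (intro tr_mono) (auto simp: predicate_on_def)
  also have "idop X * \<rho> = \<rho>" using assms pos_tcD bopsD by blast
  finally show ?thesis .
qed

lemma tr_predicate_qop:
  assumes "qop X E" "predicate_on X P" "\<rho> \<in> pos_tc X"
  shows "0 \<le> tr (P * E \<rho>)" "tr (P * E \<rho>) \<le> tr \<rho>"
proof -
  have "E \<rho> \<in> pos_tc X" using assms qop_pos_tc by blast
  then show "0 \<le> tr (P * E \<rho>)" "tr (P * E \<rho>) \<le> tr \<rho>"
    using assms tr_pos order_trans[OF tr_predicate_le qop_tr_le] by (auto simp: predicate_on_def)
qed

text \<open>The form fixes \<open>W\<close> through rank-one operators, and linearity covers finite
  rank. For the tail, positivity and trace non-increase place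
  \<open>tr (P * E (\<rho> - \<rho>\<^sub>N N))\<close> between zero and the trace of the remainder,
  so no separate continuity of \<open>E\<close> has to be established.\<close>

lemma dual_exists:
  assumes E: "qop X E" and P: "predicate_on X P"
  shows "\<exists>W. predicate_on X W \<and> (\<forall>\<rho>\<in>tc X. tr (P * E \<rho>) = tr (W * \<rho>))"
proof -
  let ?r = "restrict_vec X"
  \<comment> \<open>The restrictions keep the argument of \<open>E\<close> inside
    \<open>tc X\<close>, the only place where linearity of \<open>E\<close> is available. The
    arguments are swapped because \<open>ketbra\<close> is conjugate-linear in its second
    argument.\<close>
  define B where "B x y = tr (P * E (ketbra (?r y) (?r x)))" for x y
  have r: "?r (x + y) = ?r x + ?r y" "?r (c *\<^sub>C x) = c *\<^sub>C ?r x" for x y c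
    using op_apply_linear(1)[of "idop X" x y] op_apply_scaleC[of "idop X" c x] by (simp_all add: op_apply_simps)
  interpret sesquilinear B
  proof
    fix x y z c
    note simps = B_def r ketbra_linear ketbra_tc tc_scaleC qop_add[OF E] qop_scaleC[OF E] qop_tc[OF E]
      tr_mult_add tr_mult_scaleC
    show "B (x + y) z = B x z + B y z" by (simp add: simps)
    show "B x (y + z) = B x y + B x z" by (simp add: simps)
    show "B (c *\<^sub>C x) y = cnj c * B x y" by (simp add: simps)
    show "B x (c *\<^sub>C y) = c * B x y" by (simp add: simps)
  qed
  have quad: "0 \<le> B x x" "B x x \<le> complex_of_real ((norm (?r x))\<^sup>2)" for x
    using tr_predicate_qop[OF E P ketbra_pos_tc[OF restrict_vec_in_vecs]] unfolding tr_ketbra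
    by (simp_all add: B_def)
  have Re_le: "Re (B x x) \<le> (norm x)\<^sup>2" for x
  proof -
    have "Re (B x x) \<le> (norm (?r x))\<^sup>2" using quad(2)[of x] by (simp add: less_eq_complex_def)
    also have "\<dots> \<le> (norm x)\<^sup>2" by (intro power_mono norm_restrict_vec) simp
    finally show ?thesis .
  qed
  have "cmod (B x y) \<le> 1 * norm x * norm y" for x y
  proof -
    have "(cmod (B x y))\<^sup>2 \<le> (norm x)\<^sup>2 * (norm y)\<^sup>2"
      using cauchy_schwarz[OF quad(1), of x y] mult_mono[OF Re_le Re_le, of x y] quad(1)[of y]
      by (simp add: less_eq_complex_def)
    then have "(cmod (B x y))\<^sup>2 \<le> (norm x * norm y)\<^sup>2" by (simp add: power_mult_distrib)
    then show ?thesis by (simp add: power2_le_iff_abs_le)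
  qed
  from operator_exists[OF zero_le_one this]
  obtain W where W: "\<And>x y. cinner x (W *\<^sub>V y) = B x y" by blast
  have Wb: "W \<in> bops X"
    unfolding bops_def
    by (auto intro!: operator_cinner_eqI simp: op_apply_simps cinner_restrict_vec[symmetric] W)
      (simp add: B_def restrict_vec_restrict_vec)
  have Wp: "predicate_on X W"
    unfolding predicate_on_def pos_operator_iff unfolding less_eq_operator_iff
  proof (intro conjI Wb allI)
    fix x
    show "0 \<le> cinner x (W *\<^sub>V x)" by (simp add: W quad)
    have "cinner x (idop X *\<^sub>V x) = complex_of_real ((norm (?r x))\<^sup>2)"
      by (simp add: op_apply_simps cinner_norm[symmetric] cinner_restrict_vec restrict_vec_restrict_vec del: of_real_power)
    then show "cinner x (W *\<^sub>V x) \<le> cinner x (idop X *\<^sub>V x)" using quad(2)[of x] by (simp add: W)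
  qed
  have rank1: "tr (P * E (ketbra x x)) = tr (W * ketbra x x)" if "x \<in> vecs X" for x
    using that by (simp add: tr_mult_ketbra W B_def vecs_iff)
  have "tr (P * E \<rho>) = tr (W * \<rho>)" if "\<rho> \<in> tc X" for \<rho>
    using that
  proof (induction rule: tc_induct)
    case (pos \<rho>)
    then obtain v where v: "tc_decomp \<rho> v" "\<And>n. v n \<in> vecs X" using pos_tc_decomp by blast
    define \<rho>\<^sub>N where "\<rho>\<^sub>N N = (\<Sum>n<N. ketbra (v n) (v n))" for N
    note fin = pos_tc_finite_rank_tendsto[OF v pos_tcD(1)[OF pos], folded \<rho>\<^sub>N_def]
    have fr: "tr (P * E (\<rho>\<^sub>N N)) = tr (W * \<rho>\<^sub>N N)" for N
    proof (induction N)
      case 0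
      have "E 0 = 0" using qop_scaleC[OF E zero_tc, of 0] by (simp add: operator_scaleC_simps)
      then show ?case by (simp add: \<rho>\<^sub>N_def tr_mult_zero)
    next
      case (Suc N)
      have "\<rho>\<^sub>N (Suc N) = \<rho>\<^sub>N N + ketbra (v N) (v N)" by (simp add: \<rho>\<^sub>N_def)
      then show ?case
        using Suc by (simp add: qop_add[OF E] pos_tc_tc fin ketbra_tc v tr_mult_add qop_tc[OF E] rank1
            del: distrib_left)
    qed
    \<comment> \<open>The error is the value at a positive remainder, hence real, nonnegative and at
      most the trace of that remainder.\<close>
    have "(\<lambda>N. tr (P * E \<rho>) - tr (P * E (\<rho>\<^sub>N N))) \<longlonglongrightarrow> 0"
    proof (rule Lim_null_comparison)
      have "(\<lambda>N. tr \<rho> - tr (\<rho>\<^sub>N N)) \<longlonglongrightarrow> tr \<rho> - tr \<rho>"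
        using fin(3)[of "idop UNIV"] by (intro tendsto_intros) simp
      then show "(\<lambda>N. Re (tr \<rho> - tr (\<rho>\<^sub>N N))) \<longlonglongrightarrow> 0"
        using tendsto_Re by fastforce
      have "norm (tr (P * E \<rho>) - tr (P * E (\<rho>\<^sub>N N))) \<le> Re (tr \<rho> - tr (\<rho>\<^sub>N N))" for N
      proof -
        have "tr (P * E (\<rho> - \<rho>\<^sub>N N)) = tr (P * E \<rho>) - tr (P * E (\<rho>\<^sub>N N))"
          by (simp add: qop_diff[OF E] pos_tc_tc fin pos tr_mult_diff qop_tc[OF E] del: right_diff_distrib)
        moreover have "tr (\<rho> - \<rho>\<^sub>N N) = tr \<rho> - tr (\<rho>\<^sub>N N)"
          by (simp add: tr_diff pos_tc_tc fin pos)
        ultimately show ?thesis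
          using tr_predicate_qop[OF E P fin(2)[of N]] by (simp add: less_eq_complex_def cmod_eq_Re)
      qed
      then show "\<forall>\<^sub>F N in sequentially. norm (tr (P * E \<rho>) - tr (P * E (\<rho>\<^sub>N N))) \<le> Re (tr \<rho> - tr (\<rho>\<^sub>N N))"
        by simp
    qed
    then have "(\<lambda>N. tr (P * E \<rho>) - tr (W * \<rho>\<^sub>N N)) \<longlonglongrightarrow> 0" by (simp add: fr)
    moreover have "(\<lambda>N. tr (P * E \<rho>) - tr (W * \<rho>\<^sub>N N)) \<longlonglongrightarrow> tr (P * E \<rho>) - tr (W * \<rho>)"
      by (intro tendsto_intros fin(3))
    ultimately show ?case using LIMSEQ_unique by fastforce
  next
    case (diff A B)
    then show ?case by (simp add: qop_diff[OF E] tr_mult_diff qop_tc[OF E] del: right_diff_distrib)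
  next
    case (imag A B)
    then show ?case
      by (simp add: qop_add[OF E] qop_scaleC[OF E] tr_mult_add tr_mult_scaleC tc_scaleC qop_tc[OF E]
          del: distrib_left)
  qed
  then show ?thesis using Wp by blast
qed

lemma dual_predicate:
  assumes "qop X E" "predicate_on X P"
  shows "predicate_on X (dual X E P)" "\<rho> \<in> tc X \<Longrightarrow> tr (P * E \<rho>) = tr (dual X E P * \<rho>)"
proof -
  obtain W where W: "predicate_on X W" "\<And>\<rho>. \<rho> \<in> tc X \<Longrightarrow> tr (P * E \<rho>) = tr (W * \<rho>)"
    using dual_exists[OF assms] by blast
  then have "dual X E P = W" by (intro dual_eqI) (auto simp: predicate_on_def)
  then show "predicate_on X (dual X E P)" "\<rho> \<in> tc X \<Longrightarrow> tr (P * E \<rho>) = tr (dual X E P * \<rho>)"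
    using W by auto
qed

lemma cinner_dual:
  assumes "qop X E" "predicate_on X P" "x \<in> vecs X"
  shows "cinner x (dual X E P *\<^sub>V x) = tr (P * E (ketbra x x))"
  using dual_predicate(2)[OF assms(1,2) ketbra_tc[OF assms(3,3)]] by (simp add: tr_mult_ketbra)

lemma dual_quad_eqI:
  assumes "qop X E" "predicate_on X P" "W \<in> bops X"
    and "\<And>x. x \<in> vecs X \<Longrightarrow> cinner x (W *\<^sub>V x) = tr (P * E (ketbra x x))"
  shows "dual X E P = W"
  using dual_predicate(1)[OF assms(1,2)] cinner_dual[OF assms(1,2)]
  by (intro bops_quad_eqI[OF _ assms(3)]) (simp_all add: predicate_on_def assms(4))

lemma dual_mono:
  assumes "qop X E" "qop X F" "predicate_on X P" "superop_le X E F"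
  shows "dual X E P \<le> dual X F P"
proof (rule bops_leI[of _ X])
  fix x assume x: "x \<in> vecs X"
  have "E (ketbra x x) \<le> F (ketbra x x)"
    using assms(4) x by (simp add: superop_le_def ketbra_tc ketbra_pos)
  then have p: "F (ketbra x x) - E (ketbra x x) \<in> pos_tc X"
    unfolding tc_pos_iff using x assms by (simp add: tc_diff qop_tc ketbra_tc)
  have "0 \<le> tr (P * (F (ketbra x x) - E (ketbra x x)))"
    using assms(3) p by (intro tr_pos) (auto simp: predicate_on_def)
  then show "cinner x (dual X E P *\<^sub>V x) \<le> cinner x (dual X F P *\<^sub>V x)"
    using assms x by (simp add: cinner_dual tr_mult_diff qop_tc ketbra_tc less_eq_complex_def del: right_diff_distrib)
qed (use assms dual_predicate in \<open>auto simp: predicate_on_def\<close>)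

lemma dual_add:
  assumes "qop X E" "predicate_on X P" "predicate_on X R" "predicate_on X (P + R)"
  shows "dual X E (P + R) = dual X E P + dual X E R"
  using assms dual_predicate(1)
  by (intro dual_quad_eqI)
    (auto simp: predicate_on_def bops_add op_apply_simps cinner_linear cinner_dual tr_add_mult qop_tc ketbra_tc
      simp del: distrib_right)

subsection \<open>Constructions of quantum operations\<close>

lemma qopI:
  assumes "\<And>\<rho>. \<rho> \<in> tc X \<Longrightarrow> E \<rho> \<in> tc X" "E \<in> extensional (tc X)" "superop_linear X E" "completely_positive X E"
    "\<And>\<rho>. \<rho> \<in> pos_tc X \<Longrightarrow> tr (E \<rho>) \<le> tr \<rho>"
  shows "qop X E"
  using assms by (auto simp: qop_def PiE_def tc_pos_iff)

text \<open>The outer factors move onto the test vectors of the block form, so no new positivity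
  argument arises.\<close>

lemma completely_positive_sandwich:
  assumes "completely_positive X E" "\<And>\<rho>. \<rho> \<in> tc X \<Longrightarrow> F \<rho> = K * E \<rho> * K\<^sup>\<dagger>"
  shows "completely_positive X F"
  unfolding completely_positive_def
proof (intro allI impI)
  fix n R assume R: "(\<forall>i<n. \<forall>j<n. R i j \<in> tc X) \<and> block_pos n R"
  then have b: "block_pos n (\<lambda>i j. E (R i j))" using assms(1) by (simp add: completely_positive_def)
  show "block_pos n (\<lambda>i j. F (R i j))"
    unfolding block_pos_def
  proof
    fix x :: "nat \<Rightarrow> 'a ell2"
    have "(\<Sum>i<n. \<Sum>j<n. cinner (x i) (F (R i j) *\<^sub>V x j)) =
      (\<Sum>i<n. \<Sum>j<n. cinner (K\<^sup>\<dagger> *\<^sub>V x i) (E (R i j) *\<^sub>V (K\<^sup>\<dagger> *\<^sub>V x j)))"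
      using R by (intro sum.cong refl) (simp add: assms(2) op_apply_simps cinner_adj_left)
    then show "0 \<le> (\<Sum>i<n. \<Sum>j<n. cinner (x i) (F (R i j) *\<^sub>V x j))"
      using b[unfolded block_pos_def, THEN spec, of "\<lambda>i. K\<^sup>\<dagger> *\<^sub>V x i"] by simp
  qed
qed

lemma completely_positive_id: "completely_positive X (\<lambda>\<rho>. \<rho>)"
  by (auto simp: completely_positive_def)

lemma qop_conj:
  assumes "K \<in> bops X" "K\<^sup>\<dagger> * K \<le> idop X"
  shows "qop X (diamond X K (K\<^sup>\<dagger>))"
proof (rule qopI)
  show "completely_positive X (diamond X K (K\<^sup>\<dagger>))"
    by (rule completely_positive_sandwich[OF completely_positive_id]) (simp add: diamond_def)
  show "superop_linear X (diamond X K (K\<^sup>\<dagger>))"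
    by (simp add: superop_linear_def diamond_def tc_add tc_scaleC mult_scaleC algebra_simps)
  fix \<rho> assume \<rho>: "\<rho> \<in> pos_tc X"
  have "tr (idop UNIV * (K * \<rho> * K\<^sup>\<dagger>)) = tr (K\<^sup>\<dagger> * idop UNIV * K * \<rho>)"
    using \<rho> assms by (intro tr_sandwich pos_tc_tc)
  also have "\<dots> \<le> tr (idop X * \<rho>)" using \<rho> assms by (intro tr_mono) simp_all
  also have "idop X * \<rho> = \<rho>" using \<rho> pos_tcD bopsD by blast
  finally show "tr (diamond X K (K\<^sup>\<dagger>) \<rho>) \<le> tr \<rho>" using \<rho> by (simp add: diamond_def pos_tc_tc)
qed (use assms in \<open>auto simp: diamond_def tc_sandwich\<close>)

lemma qop_zero: "qop X (diamond X 0 0)"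
proof -
  have "(0 :: 'a operator)\<^sup>\<dagger> = 0" by (rule adj_eqI) (simp add: op_apply_simps)
  then show ?thesis using qop_conj[of 0] by simp
qed

lemma qop_compose:
  assumes E: "qop X E" and F: "qop X F" shows "qop X (compose (tc X) F E)"
proof (rule qopI)
  show "superop_linear X (compose (tc X) F E)"
    using assms by (simp add: superop_linear_def compose_def qop_add qop_scaleC tc_add tc_scaleC qop_tc)
  show "completely_positive X (compose (tc X) F E)"
    unfolding completely_positive_def
  proof (intro allI impI)
    fix n R assume R: "(\<forall>i<n. \<forall>j<n. R i j \<in> tc X) \<and> block_pos n R"
    then have "block_pos n (\<lambda>i j. E (R i j))" using E by (simp add: qop_def completely_positive_def)
    moreover have "\<forall>i<n. \<forall>j<n. E (R i j) \<in> tc X" using R qop_tc[OF E] by blast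
    moreover have "completely_positive X F" using F by (simp add: qop_def)
    ultimately have "block_pos n (\<lambda>i j. F (E (R i j)))" by (simp add: completely_positive_def)
    then show "block_pos n (\<lambda>i j. compose (tc X) F E (R i j))"
      using R by (simp add: block_pos_def compose_def)
  qed
  show "tr (compose (tc X) F E \<rho>) \<le> tr \<rho>" if "\<rho> \<in> pos_tc X" for \<rho>
    using that qop_tr_le[OF F qop_pos_tc[OF E that]] qop_tr_le[OF E that]
    by (simp add: compose_def pos_tc_tc)
qed (use assms in \<open>auto simp: qop_tc compose_def\<close>)

lemma dual_conj:
  assumes "K \<in> bops X" "K\<^sup>\<dagger> * K \<le> idop X" "predicate_on X P"
  shows "dual X (diamond X K (K\<^sup>\<dagger>)) P = K\<^sup>\<dagger> * P * K"
  using assms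
  by (intro dual_eqI) (auto simp: predicate_on_def diamond_def tr_sandwich intro: bops_mult bops_adj)

lemma dual_zero: "dual X (diamond X 0 0) P = 0"
  by (rule dual_eqI) (simp_all add: diamond_def tr_mult_zero)

lemma dual_compose:
  assumes "qop X E" "qop X F" "predicate_on X P"
  shows "dual X (compose (tc X) F E) P = dual X E (dual X F P)"
  using dual_predicate[OF assms(2,3)] dual_predicate[OF assms(1) dual_predicate(1)[OF assms(2,3)]]
  by (intro dual_eqI) (auto simp: predicate_on_def compose_def qop_tc[OF assms(1)])

subsection \<open>Limits of quantum operations\<close>

lemma pos_tc_finite_sum_le:
  assumes "\<sigma> \<in> pos_tc X" "finite G"
  shows "(\<Sum>s\<in>G. Re (cinner (ket s) (\<sigma> *\<^sub>V ket s))) \<le> Re (tr \<sigma>)"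
proof -
  have "(\<lambda>s. cinner (ket s) (\<sigma> *\<^sub>V ket s)) summable_on UNIV" using assms by (simp add: pos_tc_def)
  then have "((\<lambda>s. cinner (ket s) (\<sigma> *\<^sub>V ket s)) has_sum tr \<sigma>) UNIV" by (simp add: tr_def)
  from has_sum_Re[OF this] show ?thesis
    by (rule finite_sum_le_has_sum) (use assms(2) pos_operator_Re[OF pos_tcD(2)[OF assms(1)]] in auto)
qed

lemma pos_tc_has_sum_tr:
  assumes "\<sigma> \<in> pos_tc X"
  shows "((\<lambda>s. Re (cinner (ket s) (\<sigma> *\<^sub>V ket s))) has_sum Re (tr \<sigma>)) UNIV" "tr \<sigma> = complex_of_real (Re (tr \<sigma>))"
proof -
  have "(\<lambda>s. cinner (ket s) (\<sigma> *\<^sub>V ket s)) summable_on UNIV" using assms by (simp add: pos_tc_def)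
  then have "((\<lambda>s. cinner (ket s) (\<sigma> *\<^sub>V ket s)) has_sum tr \<sigma>) UNIV" by (simp add: tr_def)
  from has_sum_Re[OF this] show "((\<lambda>s. Re (cinner (ket s) (\<sigma> *\<^sub>V ket s))) has_sum Re (tr \<sigma>)) UNIV" .
  show "tr \<sigma> = complex_of_real (Re (tr \<sigma>))"
    using pos_tc_tr[OF assms] by (simp add: less_eq_complex_def complex_eq_iff)
qed

lemma pos_tcI_bounded:
  assumes "\<sigma> \<in> bops X" "0 \<le> \<sigma>" "\<And>G. finite G \<Longrightarrow> (\<Sum>s\<in>G. Re (cinner (ket s) (\<sigma> *\<^sub>V ket s))) \<le> c"
  shows "\<sigma> \<in> pos_tc X" "Re (tr \<sigma>) \<le> c"
proof -
  have "(\<lambda>s. Re (cinner (ket s) (\<sigma> *\<^sub>V ket s))) summable_on UNIV"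
    by (rule nonneg_bdd_above_summable_on)
      (auto intro!: bdd_aboveI[where M = c] simp: assms pos_operator_Re)
  then have "(\<lambda>s. complex_of_real (Re (cinner (ket s) (\<sigma> *\<^sub>V ket s)))) summable_on UNIV"
    by (rule summable_on_of_real)
  then have "(\<lambda>s. cinner (ket s) (\<sigma> *\<^sub>V ket s)) summable_on UNIV"
    by (simp flip: pos_operator_real[OF assms(2)])
  then show p: "\<sigma> \<in> pos_tc X" using assms by (simp add: pos_tc_def)
  show "Re (tr \<sigma>) \<le> c"
    using pos_tc_has_sum_tr(1)[OF p] by (rule has_sum_le_finite_sums) (rule assms)
qed

text \<open>The operator norm is at most the trace: Cauchy-Schwarz in each term of a rank-one
  decomposition. It leads to a bound on \<open>E \<rho>\<close> that does not depend on
  \<open>E\<close>, as existence of weak limits requires.\<close>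

lemma pos_tc_le_tr:
  assumes "\<sigma> \<in> pos_tc X" shows "\<sigma> \<le> tr \<sigma> *\<^sub>C idop UNIV"
proof -
  obtain v where v: "tc_decomp \<sigma> v" using pos_tc_decomp[OF assms] by blast
  have "((\<lambda>n. cinner (v n) (idop UNIV *\<^sub>V v n)) has_sum tr \<sigma>) UNIV"
    using tc_decomp_has_sum_trace[OF v, of "idop UNIV"] by simp
  from has_sum_Re[OF this] have t: "((\<lambda>n. (norm (v n))\<^sup>2) has_sum Re (tr \<sigma>)) UNIV"
    by (simp add: op_apply_simps cinner_norm)
  show ?thesis
    unfolding less_eq_operator_iff
  proof
    fix x
    have "((\<lambda>n. cinner x (ketbra (v n) (v n) *\<^sub>V x)) has_sum cinner x (\<sigma> *\<^sub>V x)) UNIV"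
      using v by (simp add: tc_decomp_def op_has_sum_def)
    from has_sum_Re[OF this] have "((\<lambda>n. (cmod (cinner (v n) x))\<^sup>2) has_sum Re (cinner x (\<sigma> *\<^sub>V x))) UNIV"
      by (simp add: cinner_ketbra_self)
    moreover have "((\<lambda>n. (norm (v n))\<^sup>2 * (norm x)\<^sup>2) has_sum Re (tr \<sigma>) * (norm x)\<^sup>2) UNIV"
      by (intro has_sum_cmult_left t)
    ultimately have "Re (cinner x (\<sigma> *\<^sub>V x)) \<le> Re (tr \<sigma>) * (norm x)\<^sup>2"
    proof (rule has_sum_mono)
      fix n show "(cmod (cinner (v n) x))\<^sup>2 \<le> (norm (v n))\<^sup>2 * (norm x)\<^sup>2"
        using power_mono[OF cinner_cauchy_schwarz, of "v n" x 2] by (simp add: power_mult_distrib)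
    qed
    moreover have "cinner x ((tr \<sigma> *\<^sub>C idop UNIV) *\<^sub>V x) = complex_of_real (Re (tr \<sigma>) * (norm x)\<^sup>2)"
      by (subst pos_tc_has_sum_tr(2)[OF assms]) (simp add: op_apply_simps cinner_linear cinner_norm)
    ultimately show "cinner x (\<sigma> *\<^sub>V x) \<le> cinner x ((tr \<sigma> *\<^sub>C idop UNIV) *\<^sub>V x)"
      by (subst pos_operator_real[OF pos_tcD(2)[OF assms]]) (simp add: less_eq_complex_def)
  qed
qed

lemma qop_le_tr:
  assumes E: "qop X E" and \<rho>: "\<rho> \<in> pos_tc X" shows "E \<rho> \<le> tr \<rho> *\<^sub>C idop UNIV"
proof -
  have "E \<rho> \<le> tr (E \<rho>) *\<^sub>C idop UNIV" by (rule pos_tc_le_tr[OF qop_pos_tc[OF E \<rho>]])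
  also have "\<dots> \<le> tr \<rho> *\<^sub>C idop UNIV"
    using qop_tr_le[OF E \<rho>]
    by (simp add: less_eq_operator_iff op_apply_simps cinner_linear cinner_norm less_eq_complex_def mult_right_mono)
  finally show ?thesis .
qed

text \<open>Under weak convergence of positive operators the trace is only lower semicontinuous,
  since mass may escape; domination by the limit supplies the upper half.\<close>

lemma tr_tendsto:
  assumes F: "F \<noteq> bot" and lim: "wot_lim f F \<sigma>" and \<sigma>: "\<sigma> \<in> pos_tc X"
    and f: "\<forall>\<^sub>F i in F. f i \<in> pos_tc X \<and> f i \<le> \<sigma>"
  shows "((\<lambda>i. tr (f i)) \<longlongrightarrow> tr \<sigma>) F"
proof -
  have "((\<lambda>i. Re (tr (f i))) \<longlongrightarrow> Re (tr \<sigma>)) F"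
  proof (rule order_tendstoI)
    \<comment> \<open>Finitely many diagonal entries of \<sigma> already exceed \<open>a\<close>,
      and a finite sum of entries does pass to the weak limit.\<close>
    fix a assume "a < Re (tr \<sigma>)"
    then have "\<forall>\<^sub>F G in finite_subsets_at_top UNIV. a < (\<Sum>s\<in>G. Re (cinner (ket s) (\<sigma> *\<^sub>V ket s)))"
      using pos_tc_has_sum_tr(1)[OF \<sigma>] unfolding has_sum_def by (rule order_tendstoD(1)[rotated])
    then obtain G where G: "finite G" "a < (\<Sum>s\<in>G. Re (cinner (ket s) (\<sigma> *\<^sub>V ket s)))"
      unfolding eventually_finite_subsets_at_top by blast
    have "((\<lambda>i. \<Sum>s\<in>G. Re (cinner (ket s) (f i *\<^sub>V ket s))) \<longlongrightarrow> (\<Sum>s\<in>G. Re (cinner (ket s) (\<sigma> *\<^sub>V ket s)))) F"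
      by (intro tendsto_sum tendsto_Re wot_limD lim)
    from order_tendstoD(1)[OF this G(2)] f show "\<forall>\<^sub>F i in F. a < Re (tr (f i))"
      by eventually_elim (use pos_tc_finite_sum_le[OF _ G(1)] in fastforce)
  next
    fix a assume a: "Re (tr \<sigma>) < a"
    from f show "\<forall>\<^sub>F i in F. Re (tr (f i)) < a"
    proof eventually_elim
      case (elim i)
      then have "\<sigma> - f i \<in> pos_tc X" using \<sigma> by (simp add: tc_pos_iff tc_diff)
      from pos_tc_tr[OF this] show ?case
        using elim \<sigma> a by (simp add: tr_diff pos_tc_tc less_eq_complex_def)
    qed
  qed
  from tendsto_of_real[OF this, where ?'a = complex]
  have "((\<lambda>i. complex_of_real (Re (tr (f i)))) \<longlongrightarrow> tr \<sigma>) F"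
    using pos_tc_has_sum_tr(2)[OF \<sigma>] by simp
  then show ?thesis
    by (rule Lim_transform_eventually) (use f in eventually_elim, use pos_tc_has_sum_tr(2) in metis)
qed

text \<open>Least upper bounds of increasing sequences and infinite Kraus sums are both instances of the
  following limit along a filter.\<close>

lemma qop_limit:
  fixes E :: "'i \<Rightarrow> 'a superop"
  assumes F: "F \<noteq> bot" and E: "\<forall>\<^sub>F i in F. qop X (E i)"
    and lim: "\<And>\<rho> x. \<rho> \<in> pos_tc X \<Longrightarrow> \<exists>l. ((\<lambda>i. cinner x (E i \<rho> *\<^sub>V x)) \<longlongrightarrow> l) F"
  shows "\<exists>L. qop X L \<and> (\<forall>\<rho>\<in>tc X. wot_lim (\<lambda>i. E i \<rho>) F (L \<rho>))"
proof -
  have ex: "\<exists>A. wot_lim (\<lambda>i. E i \<rho>) F A" if "\<rho> \<in> tc X" for \<rho>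
    using that
  proof (induction rule: tc_induct)
    case (pos \<rho>)
    show ?case
    proof (rule wot_lim_exists[OF _ F lim[OF pos]])
      show "\<forall>\<^sub>F i in F. 0 \<le> E i \<rho> \<and> E i \<rho> \<le> tr \<rho> *\<^sub>C idop UNIV"
        using E by eventually_elim (use pos qop_pos qop_le_tr in blast)
    qed
  next
    case (diff A B)
    then obtain A' B' where "wot_lim (\<lambda>i. E i A) F A'" "wot_lim (\<lambda>i. E i B) F B'" by blast
    from wot_lim_diff[OF this] have "wot_lim (\<lambda>i. E i (A - B)) F (A' - B')"
      by (rule wot_lim_cong) (use E in eventually_elim, simp add: qop_diff diff)
    then show ?case ..
  next
    case (imag A B)
    then obtain A' B' where "wot_lim (\<lambda>i. E i A) F A'" "wot_lim (\<lambda>i. E i B) F B'" by blast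
    from wot_lim_add[OF this(1) wot_lim_scaleC[OF this(2), of \<i>]]
    have "wot_lim (\<lambda>i. E i (A + \<i> *\<^sub>C B)) F (A' + \<i> *\<^sub>C B')"
      by (rule wot_lim_cong) (use E in eventually_elim, simp add: qop_add qop_scaleC tc_scaleC imag)
    then show ?case ..
  qed
  then obtain L' where L': "\<And>\<rho>. \<rho> \<in> tc X \<Longrightarrow> wot_lim (\<lambda>i. E i \<rho>) F (L' \<rho>)" by metis
  define L where "L = (\<lambda>\<rho>\<in>tc X. L' \<rho>)"
  have L: "wot_lim (\<lambda>i. E i \<rho>) F (L \<rho>)" if "\<rho> \<in> tc X" for \<rho> using L' that by (simp add: L_def)
  have add: "L (\<rho> + \<sigma>) = L \<rho> + L \<sigma>" if "\<rho> \<in> tc X" "\<sigma> \<in> tc X" for \<rho> \<sigma>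
  proof (rule wot_lim_unique[OF L[OF tc_add[OF that]] _ F])
    show "wot_lim (\<lambda>i. E i (\<rho> + \<sigma>)) F (L \<rho> + L \<sigma>)"
      by (rule wot_lim_cong[OF wot_lim_add[OF L L, OF that]])
        (use E in eventually_elim, simp add: qop_add that)
  qed
  have scale: "L (c *\<^sub>C \<rho>) = c *\<^sub>C L \<rho>" if "\<rho> \<in> tc X" for \<rho> c
  proof (rule wot_lim_unique[OF L[OF tc_scaleC[OF that]] _ F])
    show "wot_lim (\<lambda>i. E i (c *\<^sub>C \<rho>)) F (c *\<^sub>C L \<rho>)"
      by (rule wot_lim_cong[OF wot_lim_scaleC[OF L[OF that]]])
        (use E in eventually_elim, simp add: qop_scaleC that)
  qed
  have lin: "superop_linear X L" by (simp add: superop_linear_def add scale)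
  have L_pos: "L \<rho> \<in> pos_tc X" "Re (tr (L \<rho>)) \<le> Re (tr \<rho>)" if \<rho>: "\<rho> \<in> pos_tc X" for \<rho>
  proof -
    note L\<rho> = L[OF pos_tc_tc[OF \<rho>]]
    have b: "L \<rho> \<in> bops X"
      by (rule wot_lim_bops[OF L\<rho> _ F])
        (use E in eventually_elim, rule tc_bops[OF qop_tc[OF _ pos_tc_tc[OF \<rho>]]])
    have p: "0 \<le> L \<rho>"
      by (rule wot_lim_le[OF wot_lim_const L\<rho> _ F]) (use E in eventually_elim, rule qop_pos[OF _ \<rho>])
    \<comment> \<open>The full trace need not pass to the limit, but its finite partial sums do, and
      each stays below the trace of \<rho>. Summability of the limit and its trace bound both follow
      from this.\<close>
    have t: "(\<Sum>s\<in>G. Re (cinner (ket s) (L \<rho> *\<^sub>V ket s))) \<le> Re (tr \<rho>)" if G: "finite G" for G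
    proof (rule tendsto_upperbound[OF _ _ F])
      show "((\<lambda>i. \<Sum>s\<in>G. Re (cinner (ket s) (E i \<rho> *\<^sub>V ket s))) \<longlongrightarrow> (\<Sum>s\<in>G. Re (cinner (ket s) (L \<rho> *\<^sub>V ket s)))) F"
        by (intro tendsto_sum tendsto_Re wot_limD L\<rho>)
      show "\<forall>\<^sub>F i in F. (\<Sum>s\<in>G. Re (cinner (ket s) (E i \<rho> *\<^sub>V ket s))) \<le> Re (tr \<rho>)"
        using E
      proof eventually_elim
        case (elim i)
        show ?case
          using pos_tc_finite_sum_le[OF qop_pos_tc[OF elim \<rho>] G] qop_tr_le[OF elim \<rho>]
          by (simp add: less_eq_complex_def)
      qed
    qed
    show "L \<rho> \<in> pos_tc X" "Re (tr (L \<rho>)) \<le> Re (tr \<rho>)"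
      by (rule pos_tcI_bounded[OF b p t]; assumption)+
  qed
  have L_tc: "L \<rho> \<in> tc X" if "\<rho> \<in> tc X" for \<rho>
    using that
  proof (induction rule: tc_induct)
    case (diff A B)
    have "L (A + (-1) *\<^sub>C B) = L A + (-1) *\<^sub>C L B" by (simp only: add scale tc_scaleC diff)
    then show ?case using tc_diff[OF diff(1,2)] by (simp add: operator_scaleC_simps)
  next
    case (imag A B)
    then show ?case by (simp add: add scale tc_scaleC tc_add)
  qed (simp add: L_pos pos_tc_tc)
  have "qop X L"
  proof (rule qopI)
    show "L \<in> extensional (tc X)" by (simp add: L_def)
    show "tr (L \<rho>) \<le> tr \<rho>" if \<rho>: "\<rho> \<in> pos_tc X" for \<rho>
      using L_pos[OF \<rho>] pos_tc_tr[OF \<rho>] pos_tc_tr[OF L_pos(1)[OF \<rho>]] by (simp add: less_eq_complex_def)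
    \<comment> \<open>Block positivity involves finitely many matrix elements, so it is closed under
      weak limits.\<close>
    show "completely_positive X L"
      unfolding completely_positive_def
    proof (intro allI impI)
      fix n R assume R: "(\<forall>i<n. \<forall>j<n. R i j \<in> tc X) \<and> block_pos n R"
      show "block_pos n (\<lambda>i j. L (R i j))"
        unfolding block_pos_def
      proof
        fix x :: "nat \<Rightarrow> 'a ell2"
        show "0 \<le> (\<Sum>i<n. \<Sum>j<n. cinner (x i) (L (R i j) *\<^sub>V x j))"
        proof (rule tendsto_complex_le[OF tendsto_const _ _ F])
          show "((\<lambda>k. \<Sum>i<n. \<Sum>j<n. cinner (x i) (E k (R i j) *\<^sub>V x j)) \<longlongrightarrow>
            (\<Sum>i<n. \<Sum>j<n. cinner (x i) (L (R i j) *\<^sub>V x j))) F"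
            using R by (intro tendsto_sum wot_limD L) auto
          show "\<forall>\<^sub>F k in F. 0 \<le> (\<Sum>i<n. \<Sum>j<n. cinner (x i) (E k (R i j) *\<^sub>V x j))"
            using E
          proof eventually_elim
            case (elim k)
            then have "block_pos n (\<lambda>i j. E k (R i j))" using R by (simp add: qop_def completely_positive_def)
            then show ?case by (simp add: block_pos_def)
          qed
        qed
      qed
    qed
  qed (simp_all add: lin L_tc)
  then show ?thesis using L by blast
qed

text \<open>The difference between \<open>L\<close> and \<open>E i\<close> at a rank-one operator is
  positive, so weighting it by \<open>P\<close> costs at most its trace, which vanishes by
  \<open>tr_tendsto\<close>.\<close>

lemma dual_wot_lim:
  assumes F: "F \<noteq> bot" and E: "\<forall>\<^sub>F i in F. qop X (E i) \<and> superop_le X (E i) L" and L: "qop X L"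
    and lim: "\<And>\<rho>. \<rho> \<in> pos_tc X \<Longrightarrow> wot_lim (\<lambda>i. E i \<rho>) F (L \<rho>)"
    and P: "predicate_on X P"
  shows "wot_lim (\<lambda>i. dual X (E i) P) F (dual X L P)"
proof (rule wot_limI)
  fix x
  let ?x = "restrict_vec X x"
  let ?\<rho> = "ketbra ?x ?x"
  have \<rho>: "?\<rho> \<in> pos_tc X" by (simp add: ketbra_pos_tc)
  have d: "cinner x (dual X G P *\<^sub>V x) = tr (P * G ?\<rho>)" if "qop X G" for G
    using cinner_dual[OF that P restrict_vec_in_vecs, of x] bops_cinner[of "dual X G P" X x x]
      dual_predicate(1)[OF that P] by (simp add: predicate_on_def)
  have le: "\<forall>\<^sub>F i in F. E i ?\<rho> \<in> pos_tc X \<and> E i ?\<rho> \<le> L ?\<rho>"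
    using E by eventually_elim (simp add: qop_pos_tc[OF _ \<rho>] superop_leD[OF _ \<rho>])
  have "((\<lambda>i. tr (L ?\<rho>) - tr (E i ?\<rho>)) \<longlongrightarrow> tr (L ?\<rho>) - tr (L ?\<rho>)) F"
    by (intro tendsto_intros tr_tendsto[OF F lim[OF \<rho>] qop_pos_tc[OF L \<rho>] le])
  then have t0: "((\<lambda>i. Re (tr (L ?\<rho>) - tr (E i ?\<rho>))) \<longlongrightarrow> 0) F"
    using tendsto_Re by fastforce
  have "((\<lambda>i. tr (P * E i ?\<rho>) - tr (P * L ?\<rho>)) \<longlongrightarrow> 0) F"
  proof (rule Lim_null_comparison[OF _ t0])
    show "\<forall>\<^sub>F i in F. norm (tr (P * E i ?\<rho>) - tr (P * L ?\<rho>)) \<le> Re (tr (L ?\<rho>) - tr (E i ?\<rho>))"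
      using E le
    proof eventually_elim
      case (elim i)
      have tcs: "L ?\<rho> \<in> tc X" "E i ?\<rho> \<in> tc X" using L elim \<rho> by (simp_all add: qop_tc pos_tc_tc)
      then have p: "L ?\<rho> - E i ?\<rho> \<in> pos_tc X" using elim by (simp add: tc_pos_iff tc_diff)
      have "0 \<le> tr (P * (L ?\<rho> - E i ?\<rho>))" "tr (P * (L ?\<rho> - E i ?\<rho>)) \<le> tr (L ?\<rho> - E i ?\<rho>)"
        using P p tr_pos tr_predicate_le by (auto simp: predicate_on_def)
      then show ?case
        using tcs by (simp add: tr_mult_diff tr_diff less_eq_complex_def cmod_eq_Re del: right_diff_distrib)
    qed
  qed
  then have "((\<lambda>i. tr (P * E i ?\<rho>)) \<longlongrightarrow> tr (P * L ?\<rho>)) F" by (simp add: LIM_zero_iff)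
  then show "((\<lambda>i. cinner x (dual X (E i) P *\<^sub>V x)) \<longlongrightarrow> cinner x (dual X L P *\<^sub>V x)) F"
    unfolding d[OF L]
    by (rule Lim_transform_eventually) (use E in eventually_elim, simp add: d)
qed

text \<open>The pointwise weak limit lies below every pointwise upper bound, hence is the least one.
  Any other least upper bound agrees with it on positive operators and, by linearity, on their
  span.\<close>

lemma
  fixes E :: "nat \<Rightarrow> 'a superop"
  assumes E: "\<And>k. qop X (E k)" and inc: "\<And>k. superop_le X (E k) (E (Suc k))"
  shows qop_qop_Lub: "qop X (qop_Lub X E)"
    and incseq_dual: "predicate_on X P \<Longrightarrow> incseq (\<lambda>k. dual X (E k) P)"
    and dual_qop_Lub_wot_lim: "predicate_on X P \<Longrightarrow> wot_lim (\<lambda>k. dual X (E k) P) sequentially (dual X (qop_Lub X E) P)"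
proof -
  have incr: "incseq (\<lambda>k. E k \<rho>)" if "\<rho> \<in> pos_tc X" for \<rho>
    by (rule incseq_SucI) (rule superop_leD[OF inc that])
  have "\<exists>l. (\<lambda>k. cinner x (E k \<rho> *\<^sub>V x)) \<longlonglongrightarrow> l" if \<rho>: "\<rho> \<in> pos_tc X" for \<rho> x
    using incseq_wot_lim_exists[OF incr[OF \<rho>] qop_pos[OF E \<rho>] qop_le_tr[OF E \<rho>]] wot_limD by blast
  from qop_limit[where E = E and F = sequentially, OF _ _ this] E obtain L where
    L: "qop X L" "\<And>\<rho>. \<rho> \<in> tc X \<Longrightarrow> wot_lim (\<lambda>i. E i \<rho>) sequentially (L \<rho>)" by auto
  have ub: "superop_le X (E k) L" for k
    using incseq_wot_lim_le[OF incr L(2)] by (auto simp: superop_le_def tc_pos_iff)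
  have least: "superop_le X L F" if "\<And>k. superop_le X (E k) F" for F
    unfolding superop_le_def
  proof (intro ballI impI)
    fix \<rho> assume "\<rho> \<in> tc X" "0 \<le> \<rho>"
    then show "L \<rho> \<le> F \<rho>"
      using that by (intro wot_lim_le[OF L(2) wot_lim_const]) (auto simp: superop_le_def)
  qed
  have eq: "qop_Lub X E = L"
    unfolding qop_Lub_def
  proof (rule the_equality)
    fix L' assume L': "qop X L' \<and> (\<forall>k. superop_le X (E k) L') \<and>
      (\<forall>F. qop X F \<and> (\<forall>k. superop_le X (E k) F) \<longrightarrow> superop_le X L' F)"
    then have "superop_le X L' L" "superop_le X L L'" using L ub least by auto
    then have "L' \<rho> = L \<rho>" if "\<rho> \<in> pos_tc X" for \<rho>
      using that by (auto simp: superop_le_def tc_pos_iff intro: antisym)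
    then show "L' = L"
      using L' L(1) qop_extensional by (intro linear_eq_on_tc) (auto simp: qop_def)
  qed (use L ub least in auto)
  show "qop X (qop_Lub X E)" using L eq by simp
  assume P: "predicate_on X P"
  show "incseq (\<lambda>k. dual X (E k) P)"
    by (rule incseq_SucI) (rule dual_mono[OF E E P inc])
  show "wot_lim (\<lambda>k. dual X (E k) P) sequentially (dual X (qop_Lub X E) P)"
    unfolding eq using E ub L P by (intro dual_wot_lim) (auto intro: pos_tc_tc)
qed

lemma op_has_sum_pos_le:
  assumes "op_has_sum f I A" "\<And>i. i \<in> I \<Longrightarrow> 0 \<le> f i" "finite F" "F \<subseteq> I"
  shows "sum f F \<le> A"
proof (rule wot_lim_le[OF wot_lim_const])
  show "wot_lim (sum f) (finite_subsets_at_top I) A" using assms(1) by (simp add: op_has_sum_wot_lim)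
  show "\<forall>\<^sub>F G in finite_subsets_at_top I. sum f F \<le> sum f G"
    unfolding eventually_finite_subsets_at_top
    using assms by (intro exI[of _ F]) (auto intro!: sum_mono2)
qed simp

text \<open>One statement for measurements, with \<open>E i\<close> the meaning of a branch, and for
  initialisation, with \<open>E i\<close> the identity. As \<open>I\<close> may be infinite, the sum
  is the limit of its finite parts.\<close>

lemma
  fixes K :: "'i \<Rightarrow> 'a operator" and E :: "'i \<Rightarrow> 'a superop"
  assumes K: "\<And>i. i \<in> I \<Longrightarrow> K i \<in> bops X" and KK: "op_has_sum (\<lambda>i. (K i)\<^sup>\<dagger> * K i) I (idop X)"
    and E: "\<And>i. i \<in> I \<Longrightarrow> qop X (E i)"
  defines "G \<equiv> \<lambda>i. compose (tc X) (E i) (diamond X (K i) ((K i)\<^sup>\<dagger>))"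
  shows qop_kraus_sum: "qop X (superop_sum X G I)"
    and kraus_sum_has_sum: "\<rho> \<in> tc X \<Longrightarrow> op_has_sum (\<lambda>i. G i \<rho>) I (superop_sum X G I \<rho>)"
    and dual_kraus_sum: "predicate_on X P \<Longrightarrow>
      op_has_sum (\<lambda>i. (K i)\<^sup>\<dagger> * dual X (E i) P * K i) I (dual X (superop_sum X G I) P)"
proof -
  let ?F = "finite_subsets_at_top I"
  have KK1: "(\<Sum>i\<in>F. (K i)\<^sup>\<dagger> * K i) \<le> idop X" if "finite F" "F \<subseteq> I" for F
    by (rule op_has_sum_pos_le[OF KK]) (simp_all add: that adj_mult_self_pos)
  have qG: "qop X (G i)" if "i \<in> I" for i
    unfolding G_def using KK1[of "{i}"] that by (intro qop_compose qop_conj K E) auto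
  define GF where "GF F = (\<lambda>\<rho>\<in>tc X. \<Sum>i\<in>F. G i \<rho>)" for F
  \<comment> \<open>\<open>E i\<close> can only lose trace, and cyclicity turns what remains into a
    trace against a partial sum of \<open>KK\<close>, which lies below the identity.\<close>
  have trG: "tr (\<Sum>i\<in>F. G i \<rho>) \<le> tr \<rho>" if F: "finite F" "F \<subseteq> I" and \<rho>: "\<rho> \<in> pos_tc X" for F \<rho>
  proof -
    have "tr (\<Sum>i\<in>F. G i \<rho>) = (\<Sum>i\<in>F. tr (G i \<rho>))"
      using F qop_tc[OF qG pos_tc_tc[OF \<rho>]] by (intro tr_sum) auto
    also have "\<dots> \<le> (\<Sum>i\<in>F. tr ((K i)\<^sup>\<dagger> * K i * \<rho>))"
    proof -
      have "tr (G i \<rho>) \<le> tr ((K i)\<^sup>\<dagger> * K i * \<rho>)" if "i \<in> F" for i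
      proof -
        have i: "i \<in> I" using F that by auto
        have "tr (G i \<rho>) \<le> tr (K i * \<rho> * (K i)\<^sup>\<dagger>)"
          using qop_tr_le[OF E[OF i] pos_tc_sandwich[OF \<rho> K[OF i]]] \<rho>
          by (simp add: G_def compose_def diamond_def pos_tc_tc)
        also have "\<dots> = tr ((K i)\<^sup>\<dagger> * K i * \<rho>)"
          using tr_sandwich[OF pos_tc_tc[OF \<rho>] K[OF i], of "idop UNIV"] by simp
        finally show ?thesis .
      qed
      then show ?thesis by (auto simp: less_eq_complex_def intro!: sum_mono)
    qed
    also have "(\<Sum>i\<in>F. tr ((K i)\<^sup>\<dagger> * K i * \<rho>)) = tr ((\<Sum>i\<in>F. (K i)\<^sup>\<dagger> * K i) * \<rho>)"
      using F(1)
    proof (induction F)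
      case empty
      show ?case by (simp add: tr_def op_apply_simps)
    next
      case (insert i F)
      then show ?case by (simp add: tr_add_mult pos_tc_tc[OF \<rho>] del: distrib_right)
    qed
    also have "\<dots> \<le> tr (idop X * \<rho>)" by (intro tr_mono KK1 F \<rho>)
    also have "idop X * \<rho> = \<rho>" using \<rho> pos_tcD bopsD by blast
    finally show ?thesis .
  qed
  have qGF: "qop X (GF F)" if F: "finite F" "F \<subseteq> I" for F
  proof (rule qopI)
    have i: "i \<in> I" if "i \<in> F" for i using F that by auto
    show "GF F \<rho> \<in> tc X" if "\<rho> \<in> tc X" for \<rho>
      using that by (simp add: GF_def, intro tc_sum) (rule qop_tc[OF qG[OF i]])
    show "superop_linear X (GF F)"
      using qop_add[OF qG[OF i]] qop_scaleC[OF qG[OF i]]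
      by (simp add: superop_linear_def GF_def tc_add tc_scaleC operator_scaleC_sum flip: sum.distrib)
    show "tr (GF F \<rho>) \<le> tr \<rho>" if "\<rho> \<in> pos_tc X" for \<rho>
      using trG[OF F that] that by (simp add: GF_def pos_tc_tc)
    show "completely_positive X (GF F)"
      unfolding completely_positive_def
    proof (intro allI impI)
      fix n R assume R: "(\<forall>i<n. \<forall>j<n. R i j \<in> tc X) \<and> block_pos n R"
      show "block_pos n (\<lambda>i j. GF F (R i j))"
        unfolding block_pos_def
      proof
        fix x :: "nat \<Rightarrow> 'a ell2"
        have "(\<Sum>i<n. \<Sum>j<n. cinner (x i) (GF F (R i j) *\<^sub>V x j)) =
          (\<Sum>i<n. \<Sum>j<n. \<Sum>m\<in>F. cinner (x i) (G m (R i j) *\<^sub>V x j))"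
          using R by (intro sum.cong refl) (simp add: GF_def op_apply_sum cinner_sum_right)
        also have "\<dots> = (\<Sum>i<n. \<Sum>m\<in>F. \<Sum>j<n. cinner (x i) (G m (R i j) *\<^sub>V x j))"
          by (rule sum.cong[OF refl]) (rule sum.swap)
        also have "\<dots> = (\<Sum>m\<in>F. \<Sum>i<n. \<Sum>j<n. cinner (x i) (G m (R i j) *\<^sub>V x j))"
          by (rule sum.swap)
        also have "0 \<le> \<dots>"
        proof -
          have "0 \<le> (\<Sum>i<n. \<Sum>j<n. cinner (x i) (G m (R i j) *\<^sub>V x j))" if "m \<in> F" for m
          proof -
            have "block_pos n (\<lambda>i j. G m (R i j))"
              using qG[OF i[OF that]] R by (simp add: qop_def completely_positive_def)
            then show ?thesis by (simp add: block_pos_def)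
          qed
          then show ?thesis by (rule complex_sum_nonneg)
        qed
        finally show "0 \<le> (\<Sum>i<n. \<Sum>j<n. cinner (x i) (GF F (R i j) *\<^sub>V x j))" .
      qed
    qed
  qed (simp add: GF_def)
  have ev: "\<forall>\<^sub>F F in ?F. qop X (GF F)"
    by (rule eventually_finite_subsets_at_top_weakI) (rule qGF)
  have ex: "\<exists>A. op_has_sum (\<lambda>i. G i \<rho>) I A" if \<rho>: "\<rho> \<in> pos_tc X" for \<rho>
  proof (rule op_has_sum_exists)
    show "0 \<le> G i \<rho>" if "i \<in> I" for i using qop_pos[OF qG[OF that] \<rho>] .
    fix F assume F: "finite F" "F \<subseteq> I"
    show "(\<Sum>i\<in>F. G i \<rho>) \<le> tr \<rho> *\<^sub>C idop UNIV"
      using qop_le_tr[OF qGF[OF F] \<rho>] \<rho> by (simp add: GF_def pos_tc_tc)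
  qed
  have "\<exists>l. ((\<lambda>F. cinner x (GF F \<rho> *\<^sub>V x)) \<longlongrightarrow> l) ?F" if \<rho>: "\<rho> \<in> pos_tc X" for \<rho> x
    using ex[OF \<rho>] \<rho> unfolding op_has_sum_wot_lim wot_lim_def by (auto simp: GF_def pos_tc_tc)
  from qop_limit[OF _ ev this] obtain L where
    L: "qop X L" "\<And>\<rho>. \<rho> \<in> tc X \<Longrightarrow> wot_lim (\<lambda>F. GF F \<rho>) ?F (L \<rho>)" by auto
  have L': "op_has_sum (\<lambda>i. G i \<rho>) I (L \<rho>)" if "\<rho> \<in> tc X" for \<rho>
    using L(2)[OF that] that unfolding op_has_sum_wot_lim by (simp add: GF_def)
  have eq: "superop_sum X G I = L"
  proof (rule extensionalityI)
    show "superop_sum X G I \<in> extensional (tc X)" by (simp add: superop_sum_def)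
    show "L \<in> extensional (tc X)" by (rule qop_extensional[OF L(1)])
    show "superop_sum X G I \<rho> = L \<rho>" if "\<rho> \<in> tc X" for \<rho>
      using that by (simp add: superop_sum_def op_sum_eqI[OF L'])
  qed
  show "qop X (superop_sum X G I)" "\<rho> \<in> tc X \<Longrightarrow> op_has_sum (\<lambda>i. G i \<rho>) I (superop_sum X G I \<rho>)"
    using L L' eq by auto
  assume P: "predicate_on X P"
  have dGF: "dual X (GF F) P = (\<Sum>i\<in>F. (K i)\<^sup>\<dagger> * dual X (E i) P * K i)" if F: "finite F" "F \<subseteq> I" for F
  proof (rule dual_quad_eqI[OF qGF[OF F] P])
    have i: "i \<in> I" if "i \<in> F" for i using F that by auto
    have b: "dual X (E m) P \<in> bops X" if "m \<in> I" for m
      using dual_predicate(1)[OF E[OF that] P] by (simp add: predicate_on_def)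
    show "(\<Sum>i\<in>F. (K i)\<^sup>\<dagger> * dual X (E i) P * K i) \<in> bops X"
      by (intro bops_sum bops_mult bops_adj K b i)
    fix x assume x: "x \<in> vecs X"
    have "cinner x ((\<Sum>i\<in>F. (K i)\<^sup>\<dagger> * dual X (E i) P * K i) *\<^sub>V x) = (\<Sum>i\<in>F. tr (P * G i (ketbra x x)))"
      unfolding op_apply_sum cinner_sum_right
    proof (rule sum.cong[OF refl])
      fix m assume m: "m \<in> F"
      have "cinner x (((K m)\<^sup>\<dagger> * dual X (E m) P * K m) *\<^sub>V x) = cinner (K m *\<^sub>V x) (dual X (E m) P *\<^sub>V (K m *\<^sub>V x))"
        by (simp add: op_apply_simps cinner_adj_right)
      also have "\<dots> = tr (P * E m (ketbra (K m *\<^sub>V x) (K m *\<^sub>V x)))"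
        by (intro cinner_dual E P bops_apply_in_vecs K i m)
      also have "\<dots> = tr (P * G m (ketbra x x))"
        using x by (simp add: G_def compose_def diamond_def ketbra_tc ketbra_sandwich)
      finally show "cinner x (((K m)\<^sup>\<dagger> * dual X (E m) P * K m) *\<^sub>V x) = tr (P * G m (ketbra x x))" .
    qed
    also have "\<dots> = tr (P * GF F (ketbra x x))"
      using x qop_tc[OF qG[OF i] ketbra_tc[OF x x]] by (simp add: GF_def ketbra_tc tr_mult_sum)
    finally show "cinner x ((\<Sum>i\<in>F. (K i)\<^sup>\<dagger> * dual X (E i) P * K i) *\<^sub>V x) = tr (P * GF F (ketbra x x))" .
  qed
  \<comment> \<open>All summands are positive, so each finite part lies below \<open>L\<close>: the
    domination that convergence of the duals needs.\<close>
  have "wot_lim (\<lambda>F. dual X (GF F) P) ?F (dual X L P)"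
  proof (rule dual_wot_lim[OF _ _ L(1) _ P])
    show "\<forall>\<^sub>F F in ?F. qop X (GF F) \<and> superop_le X (GF F) L"
    proof (rule eventually_finite_subsets_at_top_weakI, intro conjI qGF)
      fix F assume F: "finite F" "F \<subseteq> I"
      show "superop_le X (GF F) L"
        unfolding superop_le_def
      proof (intro ballI impI)
        fix \<rho> assume \<rho>: "\<rho> \<in> tc X" "0 \<le> \<rho>"
        then show "GF F \<rho> \<le> L \<rho>"
          using op_has_sum_pos_le[OF L'[OF \<rho>(1)] qop_pos[OF qG] F] by (simp add: GF_def tc_pos_iff)
      qed
    qed
  qed (use L(2) pos_tc_tc in auto)
  then have "wot_lim (sum (\<lambda>i. (K i)\<^sup>\<dagger> * dual X (E i) P * K i)) ?F (dual X L P)"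
    by (rule wot_lim_cong) (auto intro!: eventually_finite_subsets_at_top_weakI dGF)
  then show "op_has_sum (\<lambda>i. (K i)\<^sup>\<dagger> * dual X (E i) P * K i) I (dual X (superop_sum X G I) P)"
    by (simp add: op_has_sum_wot_lim eq)
qed

end

section \<open>Products of commuting positive operators\<close>

primrec square_remainder :: "'a operator \<Rightarrow> nat \<Rightarrow> 'a operator" where
  "square_remainder S 0 = S"
| "square_remainder S (Suc n) = square_remainder S n - square_remainder S n * square_remainder S n"

lemma cinner_square:
  assumes "0 \<le> S"
  shows "cinner x ((S * S) *\<^sub>V y) = cinner (S *\<^sub>V x) (S *\<^sub>V y)"
  using pos_operator_hermitian[OF assms] by (metis cinner_adj_left times_operator.rep_eq)

text \<open>Cauchy-Schwarz for the form of \<open>S\<close> at \<open>S *\<^sub>V x\<close> and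
  \<open>x\<close>, together with \<open>S \<le> idop UNIV\<close>, bounds \<open>?n * ?n\<close> by
  \<open>?n * ?q\<close>; cancelling \<open>?n\<close> gives the claim.\<close>

lemma square_le:
  assumes S: "0 \<le> S" "S \<le> idop UNIV" shows "S * S \<le> S"
  unfolding less_eq_operator_iff
proof
  fix x
  let ?n = "(norm (S *\<^sub>V x))\<^sup>2" and ?q = "Re (cinner x (S *\<^sub>V x))"
  have "?n\<^sup>2 = (cmod (cinner (S *\<^sub>V x) (S *\<^sub>V x)))\<^sup>2" by (simp add: cinner_norm norm_power)
  also have "\<dots> \<le> Re (cinner (S *\<^sub>V x) (S *\<^sub>V (S *\<^sub>V x))) * ?q"
    by (rule pos_operator_cauchy_schwarz[OF S(1)])
  also have "\<dots> \<le> ?n * ?q"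
  proof (rule mult_right_mono[OF _ pos_operator_Re[OF S(1)]])
    have "cinner (S *\<^sub>V x) (S *\<^sub>V (S *\<^sub>V x)) \<le> cinner (S *\<^sub>V x) (idop UNIV *\<^sub>V (S *\<^sub>V x))"
      using S(2) unfolding less_eq_operator_iff by blast
    then show "Re (cinner (S *\<^sub>V x) (S *\<^sub>V (S *\<^sub>V x))) \<le> ?n"
      by (simp add: op_apply_simps cinner_norm less_eq_complex_def)
  qed
  finally have "?n * ?n \<le> ?n * ?q" by (simp add: power2_eq_square)
  then have "?n \<le> ?q"
  proof (cases "?n = 0")
    case False
    then have "0 < ?n" by simp
    with \<open>?n * ?n \<le> ?n * ?q\<close> show ?thesis by (simp only: mult_le_cancel_left_pos)
  qed (use pos_operator_Re[OF S(1), of x] in simp)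
  then show "cinner x ((S * S) *\<^sub>V x) \<le> cinner x (S *\<^sub>V x)"
    unfolding cinner_square[OF S(1)] cinner_norm
    by (subst pos_operator_real[OF S(1)]) (simp add: less_eq_complex_def)
qed

lemma square_remainder_bounds:
  assumes "0 \<le> S" "S \<le> idop UNIV"
  shows "0 \<le> square_remainder S n \<and> square_remainder S n \<le> idop UNIV"
proof (induction n)
  case (Suc n)
  let ?R = "square_remainder S n"
  have "0 \<le> ?R * ?R" using adj_mult_self_pos[of ?R] pos_operator_hermitian[of ?R] Suc by simp
  then show ?case using Suc square_le[of ?R] by (auto intro: order_trans[of "?R - ?R * ?R" ?R])
qed (use assms in simp)

lemma square_remainder_commute: "S * T = T * S \<Longrightarrow> square_remainder S n * T = T * square_remainder S n"
  by (induction n) (simp_all add: algebra_simps, metis mult.assoc)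

text \<open>With \<open>S\<^sub>0 = S\<close> and \<open>S\<^sub>n\<^sub>+\<^sub>1 = S\<^sub>n - S\<^sub>n\<^sup>2\<close> one has \<open>S = (\<Sum>n. S\<^sub>n\<^sup>2)\<close> strongly, hence
  \<open>S T = (\<Sum>n. S\<^sub>n T S\<^sub>n)\<close>; this avoids square roots.\<close>

lemma commuting_pos_operator_mult:
  assumes S: "0 \<le> S" "S \<le> idop UNIV" and T: "0 \<le> T" and comm: "S * T = T * S"
  shows "0 \<le> S * T"
  unfolding pos_operator_iff
proof
  fix x
  define R where "R = square_remainder S"
  have R: "0 \<le> R n" "R n * T = T * R n" for n
    unfolding R_def using square_remainder_bounds[OF S] square_remainder_commute[OF comm] by auto
  \<comment> \<open>The recursion telescopes.\<close>
  have sum: "S = (\<Sum>k<n. R k * R k) + R n" for n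
    by (induction n) (simp_all add: R_def algebra_simps)
  have "(\<Sum>k<n. (norm (R k *\<^sub>V x))\<^sup>2) \<le> Re (cinner x (S *\<^sub>V x))" for n
  proof -
    have "cinner x (S *\<^sub>V x) = (\<Sum>k<n. cinner (R k *\<^sub>V x) (R k *\<^sub>V x)) + cinner x (R n *\<^sub>V x)"
      by (subst sum[of n], unfold plus_operator.rep_eq op_apply_sum cinner_add_right cinner_sum_right)
        (simp only: cinner_square[OF R(1)])
    then show ?thesis using pos_operator_Re[OF R(1), of x n] by (simp add: cinner_norm)
  qed
  \<comment> \<open>Bounded partial sums force \<open>R k *\<^sub>V x\<close> to zero, which removes
    the remainder term from the product in the limit.\<close>
  then have "summable (\<lambda>k. (norm (R k *\<^sub>V x))\<^sup>2)"
    by (intro summableI_nonneg_bounded) auto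
  then have "(\<lambda>k. (norm (R k *\<^sub>V x))\<^sup>2) \<longlonglongrightarrow> 0" by (rule summable_LIMSEQ_zero)
  from tendsto_real_sqrt[OF this] have R0: "(\<lambda>k. norm (R k *\<^sub>V x)) \<longlonglongrightarrow> 0" by simp
  have "(\<lambda>n. cinner (R n *\<^sub>V x) (T *\<^sub>V x)) \<longlonglongrightarrow> 0"
  proof (rule Lim_null_comparison)
    show "\<forall>\<^sub>F n in sequentially. norm (cinner (R n *\<^sub>V x) (T *\<^sub>V x)) \<le> norm (R n *\<^sub>V x) * norm (T *\<^sub>V x)"
      by (simp add: cinner_cauchy_schwarz)
    show "(\<lambda>n. norm (R n *\<^sub>V x) * norm (T *\<^sub>V x)) \<longlonglongrightarrow> 0" by (rule tendsto_mult_left_zero[OF R0])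
  qed
  then have lim: "(\<lambda>n. cinner x ((S * T) *\<^sub>V x) - cinner (R n *\<^sub>V x) (T *\<^sub>V x)) \<longlonglongrightarrow> cinner x ((S * T) *\<^sub>V x) - 0"
    by (intro tendsto_intros)
  \<comment> \<open>Each \<open>R k\<close> is self-adjoint and commutes with \<open>T\<close>, so
    every term of the finite sum is the form of \<open>T\<close> at
    \<open>R k *\<^sub>V x\<close>.\<close>
  have "0 \<le> cinner x ((S * T) *\<^sub>V x) - cinner (R n *\<^sub>V x) (T *\<^sub>V x)" for n
  proof -
    have herm: "cinner (R k *\<^sub>V u) w = cinner u (R k *\<^sub>V w)" for k u w
      using cinner_adj_left[of "R k" u w] pos_operator_hermitian[OF R(1)[of k]] by simp
    have RT: "R k *\<^sub>V (T *\<^sub>V x) = T *\<^sub>V (R k *\<^sub>V x)" for k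
      using R(2)[of k] by (metis times_operator.rep_eq)
    have "cinner x ((S * T) *\<^sub>V x) =
      (\<Sum>k<n. cinner x (R k *\<^sub>V (R k *\<^sub>V (T *\<^sub>V x)))) + cinner x (R n *\<^sub>V (T *\<^sub>V x))"
      by (subst sum[of n]) (simp add: op_apply_simps op_apply_sum cinner_sum_right cinner_add_right)
    then have "cinner x ((S * T) *\<^sub>V x) - cinner (R n *\<^sub>V x) (T *\<^sub>V x) =
      (\<Sum>k<n. cinner (R k *\<^sub>V x) (T *\<^sub>V (R k *\<^sub>V x)))"
      by (simp add: herm RT)
    then show ?thesis using T by (auto simp: pos_operator_iff intro: complex_sum_nonneg)
  qed
  then show "0 \<le> cinner x ((S * T) *\<^sub>V x)"
    using tendsto_complex_le[OF tendsto_const lim] by simp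
qed

section \<open>Subsystems\<close>

definition merge :: "qvar set \<Rightarrow> cstate \<Rightarrow> cstate \<Rightarrow> cstate"
  where "merge V a t = (\<lambda>q. if q \<in> V then a q else t q)"

lemma inj_on_merge: "inj_on (\<lambda>a. merge V a t) (cstates V)"
proof (rule inj_onI)
  fix a b assume ab: "a \<in> cstates V" "b \<in> cstates V" "merge V a t = merge V b t"
  have eq: "merge V a t q = merge V b t q" for q by (simp add: ab(3))
  have "a q = b q" for q
  proof (cases "q \<in> V")
    case True
    then show ?thesis using eq[of q] by (simp add: merge_def)
  next
    case False
    then show ?thesis using ab(1,2) by (simp add: cstates_def PiE_arb[of _ V vdom])
  qed
  then show "a = b" by blast
qed

text \<open>Fixing the configuration \<open>t\<close> of the other variables splits a joint vector
  into vectors over \<open>V\<close>. An operator on \<open>V\<close> tensored with the identity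
  acts on each slice separately.\<close>

lift_definition slice :: "qvar set \<Rightarrow> cstate \<Rightarrow> cstate ell2 \<Rightarrow> cstate ell2"
  is "\<lambda>V t x a. if a \<in> cstates V then x (merge V a t) else 0"
proof -
  fix V t and x :: "cstate \<Rightarrow> complex"
  assume x: "(\<lambda>i. (cmod (x i))\<^sup>2) summable_on UNIV"
  have "(\<lambda>i. (cmod (x i))\<^sup>2) summable_on (\<lambda>a. merge V a t) ` cstates V"
    using x by (rule summable_on_subset_banach) simp
  then have "(\<lambda>a. (cmod (x (merge V a t)))\<^sup>2) summable_on cstates V"
    by (simp add: summable_on_reindex[OF inj_on_merge] o_def)
  then show "(\<lambda>a. (cmod (if a \<in> cstates V then x (merge V a t) else 0))\<^sup>2) summable_on UNIV"
    by (rule summable_on_cong_neutral[THEN iffD1, rotated -1]) auto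
qed

lemma slice_linear: "slice V t (x + y) = slice V t x + slice V t y" "slice V t (c *\<^sub>C x) = c *\<^sub>C slice V t x"
  by (auto intro!: ell2_eqI simp: slice.rep_eq plus_ell2.rep_eq scaleC_ell2.rep_eq)

lemma slice_in_vecs: "slice V t x \<in> vecs (cstates V)"
  by (simp add: vecs_def slice.rep_eq)

locale disjoint_registers =
  fixes V W :: "qvar set"
  assumes disjoint: "V \<inter> W = {}"
begin

lemma bij_merge: "bij_betw (\<lambda>(t, a). merge V a t) (cstates W \<times> cstates V) (cstates (V \<union> W))"
proof (rule bij_betwI[where g = "\<lambda>s. (restrict s W, restrict s V)"])
  show "(\<lambda>(t, a). merge V a t) \<in> cstates W \<times> cstates V \<rightarrow> cstates (V \<union> W)"
    by (auto simp: cstates_def merge_def PiE_def extensional_def)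
  show "(\<lambda>s. (restrict s W, restrict s V)) \<in> cstates (V \<union> W) \<rightarrow> cstates W \<times> cstates V"
    by (auto simp: cstates_def)
  show "(restrict (case p of (t, a) \<Rightarrow> merge V a t) W, restrict (case p of (t, a) \<Rightarrow> merge V a t) V) = p"
    if "p \<in> cstates W \<times> cstates V" for p
    using that disjoint by (auto simp: cstates_def merge_def PiE_def extensional_def fun_eq_iff)
  show "(case (restrict s W, restrict s V) of (t, a) \<Rightarrow> merge V a t) = s" if "s \<in> cstates (V \<union> W)" for s
    using that by (auto simp: cstates_def merge_def PiE_def extensional_def fun_eq_iff)
qed

lemma merge_restrict: "s \<in> cstates (V \<union> W) \<Longrightarrow> merge V (restrict s V) (restrict s W) = s"
  by (auto simp: cstates_def merge_def PiE_def extensional_def fun_eq_iff)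

lemma merge_simps:
  assumes "a \<in> cstates V" "t \<in> cstates W"
  shows "merge V a t \<in> cstates (V \<union> W)" "restrict (merge V a t) V = a" "restrict (merge V a t) W = t"
  using assms disjoint by (auto simp: cstates_def merge_def PiE_def extensional_def fun_eq_iff)

lemma has_sum_slice:
  "((\<lambda>t. cinner (slice V t x) (slice V t y)) has_sum cinner x (restrict_vec (cstates (V \<union> W)) y)) (cstates W)"
proof -
  define f where "f s = cnj (coord x s) * coord y s" for s
  have "(f has_sum cinner x (restrict_vec (cstates (V \<union> W)) y)) (cstates (V \<union> W))"
    using has_sum_cinner[of x "restrict_vec (cstates (V \<union> W)) y"]
    by (rule has_sum_cong_neutral[THEN iffD1, rotated -1]) (auto simp: f_def restrict_vec.rep_eq)
  then have "((\<lambda>p. f (case p of (t, a) \<Rightarrow> merge V a t)) has_sum cinner x (restrict_vec (cstates (V \<union> W)) y)) (cstates W \<times> cstates V)"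
    by (subst has_sum_reindex_bij_betw[OF bij_merge])
  then show ?thesis
  proof (rule has_sum_SigmaD)
    fix t
    show "((\<lambda>a. f (case (t, a) of (t, a) \<Rightarrow> merge V a t)) has_sum cinner (slice V t x) (slice V t y)) (cstates V)"
      using has_sum_cinner[of "slice V t x" "slice V t y"]
      by (rule has_sum_cong_neutral[THEN iffD1, rotated -1]) (auto simp: f_def slice.rep_eq)
  qed
qed

lemma has_sum_norm_slice:
  "((\<lambda>t. (norm (slice V t x))\<^sup>2) has_sum (norm (restrict_vec (cstates (V \<union> W)) x))\<^sup>2) (cstates W)"
proof -
  have "cinner x (restrict_vec (cstates (V \<union> W)) x) =
    cinner (restrict_vec (cstates (V \<union> W)) x) (restrict_vec (cstates (V \<union> W)) x)"
    by (simp add: cinner_restrict_vec restrict_vec_restrict_vec)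
  then show ?thesis using has_sum_Re[OF has_sum_slice[of x x]] by (simp add: cinner_norm)
qed

lemma slice_eqI:
  assumes "x \<in> vecs (cstates (V \<union> W))" "y \<in> vecs (cstates (V \<union> W))"
    and "\<And>t. t \<in> cstates W \<Longrightarrow> slice V t x = slice V t y"
  shows "x = y"
proof (rule ell2_eqI)
  fix s
  show "coord x s = coord y s"
  proof (cases "s \<in> cstates (V \<union> W)")
    case True
    then have "restrict s W \<in> cstates W" "restrict s V \<in> cstates V" by (auto simp: cstates_def)
    then show ?thesis
      using arg_cong[OF assms(3), of "restrict s W" "\<lambda>z. coord z (restrict s V)"] True
      by (simp add: slice.rep_eq merge_restrict)
  qed (use assms in \<open>simp add: vecs_def\<close>)
qed

lemma slice_restrict_vec:
  assumes "t \<in> cstates W" shows "slice V t (restrict_vec (cstates (V \<union> W)) x) = slice V t x"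
  by (rule ell2_eqI) (simp add: slice.rep_eq restrict_vec.rep_eq merge_simps assms)

text \<open>The definition of tensor products prescribes values on product vectors only; slices say
  how to act on every vector. The bound of \<open>A\<close> carries over because a squared norm is
  the sum over the slices.\<close>

lemma ampliation_exists:
  assumes A: "A \<in> bops_on V"
  shows "\<exists>C\<in>bops_on (V \<union> W). \<forall>x. \<forall>t\<in>cstates W. slice V t (C *\<^sub>V x) = A *\<^sub>V slice V t x"
proof -
  let ?Z = "cstates (V \<union> W)"
  define g where "g x s = (if s \<in> ?Z then coord (A *\<^sub>V slice V (restrict s W) x) (restrict s V) else 0)" for x s
  obtain C where C: "C \<ge> 0" "\<And>x. norm (A *\<^sub>V x) \<le> C * norm x" using operator_bound[of A] by auto
  have out: "coord (A *\<^sub>V x) a = 0" if "a \<notin> cstates V" for x a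
    using bops_apply_in_vecs[OF A, of x] that by (simp add: vecs_def)
  have gm: "g x (merge V a t) = coord (A *\<^sub>V slice V t x) a" if "a \<in> cstates V" "t \<in> cstates W" for x a t
    using that by (simp add: g_def merge_simps)
  have "(\<lambda>s. (cmod (g x s))\<^sup>2) summable_on UNIV" for x
  proof -
    have "(\<lambda>p. (cmod (g x (case p of (t, a) \<Rightarrow> merge V a t)))\<^sup>2) summable_on cstates W \<times> cstates V"
    proof (rule summable_on_SigmaI)
      fix t assume t: "t \<in> cstates W"
      show "((\<lambda>a. (cmod (g x (case (t, a) of (t, a) \<Rightarrow> merge V a t)))\<^sup>2) has_sum (norm (A *\<^sub>V slice V t x))\<^sup>2) (cstates V)"
        using has_sum_norm[of "A *\<^sub>V slice V t x"]
        by (rule has_sum_cong_neutral[THEN iffD1, rotated -1]) (auto simp: gm t out)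
    next
      show "(\<lambda>t. (norm (A *\<^sub>V slice V t x))\<^sup>2) summable_on cstates W"
      proof (rule summable_on_comparison_test)
        show "(\<lambda>t. C\<^sup>2 * (norm (slice V t x))\<^sup>2) summable_on cstates W"
          using has_sum_norm_slice[of x] by (intro summable_on_cmult_right) (auto simp: summable_on_def)
        show "(norm (A *\<^sub>V slice V t x))\<^sup>2 \<le> C\<^sup>2 * (norm (slice V t x))\<^sup>2" for t
          using power_mono[OF C(2), of "slice V t x" 2] by (simp add: power_mult_distrib)
      qed simp
    qed simp
    then have "(\<lambda>s. (cmod (g x s))\<^sup>2) summable_on ?Z"
      using summable_on_reindex_bij_betw[OF bij_merge, of "\<lambda>s. (cmod (g x s))\<^sup>2"] by simp
    then show ?thesis
      by (rule summable_on_cong_neutral[THEN iffD1, rotated -1]) (auto simp: g_def)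
  qed
  then have coord_g: "coord (Abs_ell2 (g x)) = g x" for x by (simp add: Abs_ell2_inverse)
  define f where "f x = Abs_ell2 (g x)" for x
  have cf: "coord (f x) s = g x s" for x s by (simp add: f_def coord_g)
  have fv: "f x \<in> vecs ?Z" for x by (simp add: vecs_def cf g_def)
  have sf: "slice V t (f x) = A *\<^sub>V slice V t x" if "t \<in> cstates W" for t x
    by (rule ell2_eqI) (simp add: slice.rep_eq cf gm that out)
  have lin: "bounded_linear f"
  proof (rule bounded_linear_intro[of _ C])
    fix x y :: "cstate ell2" and r :: real
    show "f (x + y) = f x + f y"
      by (rule ell2_eqI) (simp add: cf g_def plus_ell2.rep_eq slice_linear op_apply_linear)
    show "f (r *\<^sub>R x) = r *\<^sub>R f x"
      unfolding scaleR_scaleC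
      by (rule ell2_eqI) (simp add: cf g_def scaleC_ell2.rep_eq slice_linear op_apply_linear)
    have "((\<lambda>t. (norm (A *\<^sub>V slice V t x))\<^sup>2) has_sum (norm (f x))\<^sup>2) (cstates W)"
      using has_sum_norm_slice[of "f x"] fv[of x]
      by (subst has_sum_cong[of _ _ "\<lambda>t. (norm (slice V t (f x)))\<^sup>2"]) (simp_all add: sf vecs_iff)
    moreover have "((\<lambda>t. C\<^sup>2 * (norm (slice V t x))\<^sup>2) has_sum C\<^sup>2 * (norm (restrict_vec ?Z x))\<^sup>2) (cstates W)"
      by (intro has_sum_cmult_right has_sum_norm_slice)
    ultimately have "(norm (f x))\<^sup>2 \<le> C\<^sup>2 * (norm (restrict_vec ?Z x))\<^sup>2"
      by (rule has_sum_mono) (use power_mono[OF C(2), of _ 2] in \<open>simp add: power_mult_distrib\<close>)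
    also have "\<dots> \<le> C\<^sup>2 * (norm x)\<^sup>2"
      by (intro mult_left_mono power_mono norm_restrict_vec) auto
    finally have "(norm (f x))\<^sup>2 \<le> (norm x * C)\<^sup>2" by (simp add: power_mult_distrib mult.commute)
    then show "norm (f x) \<le> norm x * C" using C(1) by (auto intro: power2_le_imp_le)
  qed
  moreover have "f (c *\<^sub>C x) = c *\<^sub>C f x" for c x
    by (rule ell2_eqI) (simp add: cf g_def scaleC_ell2.rep_eq slice_linear op_apply_linear)
  ultimately have app: "Abs_operator f *\<^sub>V y = f y" for y
    by (subst Abs_operator_inverse) auto
  have "Abs_operator f \<in> bops_on (V \<union> W)"
  proof (rule bopsI)
    show "\<one>\<^bsub>V \<union> W\<^esub> * Abs_operator f = Abs_operator f"
      using fv by (intro operator_eqI) (simp add: op_apply_simps app vecs_iff)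
    show "Abs_operator f * \<one>\<^bsub>V \<union> W\<^esub> = Abs_operator f"
      by (rule operator_eqI, rule slice_eqI) (simp_all add: op_apply_simps app fv sf slice_restrict_vec)
  qed
  then show ?thesis by (intro bexI[of _ "Abs_operator f"]) (simp_all add: app sf)
qed

text \<open>\<open>ampliation A\<close> is \<open>A \<otimes> I\<close> on \<open>V \<union> W\<close>.\<close>

definition ampliation :: "cstate operator \<Rightarrow> cstate operator"
  where "ampliation A =
    (SOME C. C \<in> bops_on (V \<union> W) \<and> (\<forall>x. \<forall>t\<in>cstates W. slice V t (C *\<^sub>V x) = A *\<^sub>V slice V t x))"

lemma
  assumes "A \<in> bops_on V"
  shows ampliation_bops: "ampliation A \<in> bops_on (V \<union> W)"
    and slice_ampliation: "t \<in> cstates W \<Longrightarrow> slice V t (ampliation A *\<^sub>V x) = A *\<^sub>V slice V t x"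
  using someI_ex[OF ampliation_exists[OF assms, unfolded Bex_def]] unfolding ampliation_def by blast+

lemma ampliation_eqI:
  assumes "A \<in> bops_on V" "C \<in> bops_on (V \<union> W)"
    and "\<And>x t. t \<in> cstates W \<Longrightarrow> slice V t (C *\<^sub>V x) = A *\<^sub>V slice V t x"
  shows "ampliation A = C"
  by (rule operator_eqI, rule slice_eqI)
    (simp_all add: bops_apply_in_vecs ampliation_bops slice_ampliation assms)

lemma ampliation_mult:
  assumes "A \<in> bops_on V" "B \<in> bops_on V"
  shows "ampliation (A * B) = ampliation A * ampliation B"
  using assms by (intro ampliation_eqI)
    (simp_all add: bops_mult ampliation_bops op_apply_simps slice_ampliation)

lemma ampliation_diff:
  assumes "A \<in> bops_on V" "B \<in> bops_on V"
  shows "ampliation (A - B) = ampliation A - ampliation B"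
proof (rule ampliation_eqI)
  have "slice V t (x - y) = slice V t x - slice V t y" for t x y
    using slice_linear(1)[of V t "x - y" y] by simp
  then show "slice V t ((ampliation A - ampliation B) *\<^sub>V x) = (A - B) *\<^sub>V slice V t x" if "t \<in> cstates W" for t x
    using assms that by (simp add: op_apply_simps slice_ampliation)
qed (use assms in \<open>simp_all add: bops_diff ampliation_bops\<close>)

lemma ampliation_idop: "ampliation \<one>\<^bsub>V\<^esub> = \<one>\<^bsub>V \<union> W\<^esub>"
  using slice_in_vecs[unfolded vecs_iff]
  by (intro ampliation_eqI) (simp_all add: op_apply_simps slice_restrict_vec)

lemma has_sum_ampliation:
  assumes "A \<in> bops_on V"
  shows "((\<lambda>t. cinner (slice V t x) (A *\<^sub>V slice V t y)) has_sum cinner x (ampliation A *\<^sub>V y)) (cstates W)"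
proof -
  have "((\<lambda>t. cinner (slice V t x) (slice V t (ampliation A *\<^sub>V y))) has_sum cinner x (ampliation A *\<^sub>V y)) (cstates W)"
    using has_sum_slice[of x "ampliation A *\<^sub>V y"]
    by (simp add: bops_restrict_vec_apply ampliation_bops assms)
  then show ?thesis by (rule has_sum_cong[THEN iffD1, rotated]) (simp add: slice_ampliation assms)
qed

lemma ampliation_adj:
  assumes "A \<in> bops_on V" shows "ampliation (A\<^sup>\<dagger>) = (ampliation A)\<^sup>\<dagger>"
proof (rule operator_cinner_eqI)
  fix x y
  have "((\<lambda>t. cnj (cinner (slice V t y) (A *\<^sub>V slice V t x))) has_sum cnj (cinner y (ampliation A *\<^sub>V x))) (cstates W)"
    using has_sum_ampliation[OF assms, of y x] by simp
  moreover have "cnj (cinner u (A *\<^sub>V w)) = cinner w (A\<^sup>\<dagger> *\<^sub>V u)" for u w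
    by (metis cinner_adj_right cinner_commute)
  ultimately have "((\<lambda>t. cinner (slice V t x) (A\<^sup>\<dagger> *\<^sub>V slice V t y)) has_sum cnj (cinner y (ampliation A *\<^sub>V x))) (cstates W)"
    by simp
  then have "cinner x (ampliation (A\<^sup>\<dagger>) *\<^sub>V y) = cnj (cinner y (ampliation A *\<^sub>V x))"
    using has_sum_ampliation[OF bops_adj[OF assms], of x y] has_sum_unique by blast
  also have "\<dots> = cinner x ((ampliation A)\<^sup>\<dagger> *\<^sub>V y)"
    by (metis cinner_adj_right cinner_commute)
  finally show "cinner x (ampliation (A\<^sup>\<dagger>) *\<^sub>V y) = cinner x ((ampliation A)\<^sup>\<dagger> *\<^sub>V y)" .
qed

lemma ampliation_pos:
  assumes "A \<in> bops_on V" "0 \<le> A" shows "0 \<le> ampliation A"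
  unfolding pos_operator_iff
proof
  fix x
  show "0 \<le> cinner x (ampliation A *\<^sub>V x)"
    by (rule tendsto_complex_le[OF tendsto_const has_sum_ampliation[OF assms(1), of x x, unfolded has_sum_def]])
      (use assms(2) in \<open>auto simp: pos_operator_iff intro!: always_eventually complex_sum_nonneg\<close>)
qed

lemma predicate_on_ampliation:
  assumes "predicate_on (cstates V) A" shows "predicate_on (cstates (V \<union> W)) (ampliation A)"
proof -
  have "0 \<le> ampliation (\<one>\<^bsub>V\<^esub> - A)"
    using assms by (intro ampliation_pos) (auto simp: predicate_on_def bops_diff)
  then show ?thesis
    using assms by (simp add: predicate_on_def ampliation_bops ampliation_pos ampliation_diff ampliation_idop)
qed

text \<open>Positive terms justify exchanging the sum over \<open>i\<close> with the sum over
  slices. This transports the completeness of a measurement to a larger register.\<close>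

lemma ampliation_op_has_sum:
  assumes f: "\<And>i. i \<in> I \<Longrightarrow> f i \<in> bops_on V" "\<And>i. i \<in> I \<Longrightarrow> 0 \<le> f i"
    and A: "A \<in> bops_on V" "0 \<le> A" "op_has_sum f I A"
  shows "op_has_sum (\<lambda>i. ampliation (f i)) I (ampliation A)"
proof (rule op_has_sumI)
  fix x
  define g where "g = (\<lambda>(t, i). Re (cinner (slice V t x) (f i *\<^sub>V slice V t x)))"
  have rows: "((\<lambda>i. g (t, i)) has_sum Re (cinner (slice V t x) (A *\<^sub>V slice V t x))) I" for t
  proof -
    have "((\<lambda>i. cinner (slice V t x) (f i *\<^sub>V slice V t x)) has_sum cinner (slice V t x) (A *\<^sub>V slice V t x)) I"
      using A(3) by (simp add: op_has_sum_def)
    from has_sum_Re[OF this] show ?thesis by (simp add: g_def)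
  qed
  have outer: "((\<lambda>t. Re (cinner (slice V t x) (A *\<^sub>V slice V t x))) has_sum Re (cinner x (ampliation A *\<^sub>V x))) (cstates W)"
    using has_sum_Re[OF has_sum_ampliation[OF A(1), of x x]] .
  have nonneg: "0 \<le> g (t, i)" if "i \<in> I" for t i
    using pos_operator_Re[OF f(2)[OF that]] by (simp add: g_def)
  have "g summable_on cstates W \<times> I"
    by (rule summable_on_SigmaI[OF rows]) (use outer nonneg in \<open>auto simp: summable_on_def\<close>)
  then have "(g has_sum Re (cinner x (ampliation A *\<^sub>V x))) (cstates W \<times> I)"
    by (rule has_sum_SigmaI[OF rows outer])
  then have "((\<lambda>(i, t). g (t, i)) has_sum Re (cinner x (ampliation A *\<^sub>V x))) (I \<times> cstates W)"
    by (subst (asm) has_sum_swap)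
  then have "((\<lambda>i. Re (cinner x (ampliation (f i) *\<^sub>V x))) has_sum Re (cinner x (ampliation A *\<^sub>V x))) I"
  proof (rule has_sum_SigmaD)
    show "((\<lambda>t. case (i, t) of (i, t) \<Rightarrow> g (t, i)) has_sum Re (cinner x (ampliation (f i) *\<^sub>V x))) (cstates W)"
      if "i \<in> I" for i
      using has_sum_Re[OF has_sum_ampliation[OF f(1)[OF that], of x x]] by (simp add: g_def)
  qed
  then have "((\<lambda>i. cinner x (ampliation (f i) *\<^sub>V x)) has_sum complex_of_real (Re (cinner x (ampliation A *\<^sub>V x)))) I"
    by (subst has_sum_pos_Re) (use f ampliation_pos in auto)
  then show "((\<lambda>i. cinner x (ampliation (f i) *\<^sub>V x)) has_sum cinner x (ampliation A *\<^sub>V x)) I"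
    using pos_operator_real[OF ampliation_pos[OF A(1,2)], of x] by simp
qed

section \<open>Product vectors and tensor products of operators\<close>

lemma tensor_vec_in_vecs: "tensor_vec V W x y \<in> vecs (cstates (V \<union> W))"
  by (simp add: vecs_def tensor_vec.rep_eq)

lemma slice_tensor_vec:
  assumes "x \<in> vecs (cstates V)" "t \<in> cstates W"
  shows "slice V t (tensor_vec V W x y) = coord y t *\<^sub>C x"
  using assms
  by (intro ell2_eqI) (auto simp: slice.rep_eq tensor_vec.rep_eq merge_simps scaleC_ell2.rep_eq vecs_def)

lemma ampliation_tensor_vec:
  assumes "A \<in> bops_on V" "x \<in> vecs (cstates V)"
  shows "ampliation A *\<^sub>V tensor_vec V W x y = tensor_vec V W (A *\<^sub>V x) y"
  by (rule slice_eqI) (simp_all add: bops_apply_in_vecs ampliation_bops tensor_vec_in_vecs slice_ampliation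
      slice_tensor_vec op_apply_linear assms)

text \<open>Every basis vector of the joint register is itself a product vector.\<close>

lemma tensor_operator_eqI:
  assumes "C \<in> bops_on (V \<union> W)" "D \<in> bops_on (V \<union> W)"
    and "\<And>x y. x \<in> vecs (cstates V) \<Longrightarrow> y \<in> vecs (cstates W) \<Longrightarrow>
      C *\<^sub>V tensor_vec V W x y = D *\<^sub>V tensor_vec V W x y"
  shows "C = D"
proof (rule operator_ket_eqI)
  fix s
  show "C *\<^sub>V ket s = D *\<^sub>V ket s"
  proof (cases "s \<in> cstates (V \<union> W)")
    case True
    have "ket s = tensor_vec V W (ket (restrict s V)) (ket (restrict s W))"
    proof (rule ell2_eqI)
      fix r
      have "r = s" if "r \<in> cstates (V \<union> W)" "restrict r V = restrict s V" "restrict r W = restrict s W"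
        using that True merge_restrict by metis
      then show "coord (ket s) r = coord (tensor_vec V W (ket (restrict s V)) (ket (restrict s W))) r"
        using True by (auto simp: ket.rep_eq tensor_vec.rep_eq)
    qed
    moreover have "restrict s V \<in> cstates V" "restrict s W \<in> cstates W"
      using True by (auto simp: cstates_def)
    ultimately show ?thesis using assms(3) by (simp add: ket_in_vecs)
  next
    case False
    then have "restrict_vec (cstates (V \<union> W)) (ket s) = 0"
      by (intro ell2_eqI) (simp add: restrict_vec.rep_eq ket.rep_eq zero_ell2.rep_eq)
    then show ?thesis
      using bops_apply_restrict_vec[OF assms(1), of "ket s"] bops_apply_restrict_vec[OF assms(2), of "ket s"]
      by (simp add: op_apply_linear)
  qed
qed

end

text \<open>Tensor factors are labelled by their variables, so the order of the factors carries no
  information; results for one factor can be reused for the other.\<close>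

lemma tensor_vec_commute: "tensor_vec V W x y = tensor_vec W V y x"
  by (rule ell2_eqI) (simp add: tensor_vec.rep_eq Un_commute)

context disjoint_registers
begin

text \<open>With the roles exchanged, \<open>flip.ampliation B\<close> is the identity on
  \<open>V\<close> tensored with \<open>B\<close>.\<close>

sublocale flip: disjoint_registers W V
  using disjoint by unfold_locales auto

lemma flip_ampliation_bops: "B \<in> bops_on W \<Longrightarrow> flip.ampliation B \<in> bops_on (V \<union> W)"
  using flip.ampliation_bops[of B] by (simp add: Un_commute)

lemma flip_ampliation_tensor_vec:
  assumes "B \<in> bops_on W" "y \<in> vecs (cstates W)"
  shows "flip.ampliation B *\<^sub>V tensor_vec V W x y = tensor_vec V W x (B *\<^sub>V y)"
  using flip.ampliation_tensor_vec[OF assms, of x] by (simp add: tensor_vec_commute[of W V])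

text \<open>Factoring through the two ampliations provides the witness for the definite description,
  and reduces positivity of tensor products to positivity of commuting products.\<close>

lemma tensor_op_eq:
  assumes A: "A \<in> bops_on V" and B: "B \<in> bops_on W"
  shows "tensor_op V W A B = ampliation A * flip.ampliation B"
  unfolding tensor_op_def
proof (rule the_equality)
  have b: "ampliation A * flip.ampliation B \<in> bops_on (V \<union> W)"
    by (intro bops_mult ampliation_bops A flip_ampliation_bops B)
  have t: "(ampliation A * flip.ampliation B) *\<^sub>V tensor_vec V W x y = tensor_vec V W (A *\<^sub>V x) (B *\<^sub>V y)"
    if "x \<in> vecs (cstates V)" "y \<in> vecs (cstates W)" for x y
    using that by (simp add: op_apply_simps flip_ampliation_tensor_vec B ampliation_tensor_vec A)
  show "ampliation A * flip.ampliation B \<in> bops_on (V \<union> W) \<and>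
    (\<forall>x\<in>vecs (cstates V). \<forall>y\<in>vecs (cstates W).
      (ampliation A * flip.ampliation B) *\<^sub>V tensor_vec V W x y = tensor_vec V W (A *\<^sub>V x) (B *\<^sub>V y))"
    using b t by blast
  fix C assume "C \<in> bops_on (V \<union> W) \<and> (\<forall>x\<in>vecs (cstates V). \<forall>y\<in>vecs (cstates W).
      C *\<^sub>V tensor_vec V W x y = tensor_vec V W (A *\<^sub>V x) (B *\<^sub>V y))"
  then show "C = ampliation A * flip.ampliation B"
    using b t by (intro tensor_operator_eqI) auto
qed

lemma ampliation_commute:
  assumes A: "A \<in> bops_on V" and B: "B \<in> bops_on W"
  shows "ampliation A * flip.ampliation B = flip.ampliation B * ampliation A"
  using assms
  by (intro tensor_operator_eqI bops_mult ampliation_bops flip_ampliation_bops)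
    (simp_all add: op_apply_simps flip_ampliation_tensor_vec ampliation_tensor_vec bops_apply_in_vecs)

text \<open>The upper bound is again a positivity statement: the product of \<open>?A\<close> with
  the complement of \<open>?B\<close> is one of commuting positive operators, so the tensor product
  lies below \<open>?A\<close>.\<close>

lemma predicate_on_tensor_op:
  assumes A: "predicate_on (cstates V) A" and B: "predicate_on (cstates W) B"
  shows "predicate_on (cstates (V \<union> W)) (tensor_op V W A B)"
proof -
  let ?A = "ampliation A" and ?B = "flip.ampliation B"
  have Ab: "A \<in> bops_on V" "B \<in> bops_on W" using assms by (auto simp: predicate_on_def)
  note eq = tensor_op_eq[OF Ab]
  \<comment> \<open>A projection lies below the identity because its complement is a self-adjoint
    idempotent.\<close>
  have le: "idop X \<le> idop UNIV" for X :: "cstate set"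
  proof -
    have "idop UNIV - idop X = (idop UNIV - idop X)\<^sup>\<dagger> * (idop UNIV - idop X)"
    proof -
      have adj: "(idop UNIV - idop X)\<^sup>\<dagger> = idop UNIV - idop X"
        by (rule adj_eqI) (simp add: op_apply_simps cinner_linear cinner_restrict_vec)
      show ?thesis unfolding adj by (simp add: algebra_simps idop_mult)
    qed
    then have "0 \<le> idop UNIV - idop X" by (metis adj_mult_self_pos)
    then show ?thesis by simp
  qed
  have pA: "predicate_on (cstates (V \<union> W)) ?A" by (rule predicate_on_ampliation[OF A])
  have pB: "predicate_on (cstates (V \<union> W)) ?B"
    using flip.predicate_on_ampliation[OF B] by (simp add: Un_commute)
  have comm: "?A * ?B = ?B * ?A" by (rule ampliation_commute[OF Ab])
  have A1: "?A \<le> idop UNIV" using pA le order_trans unfolding predicate_on_def by blast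
  have pos: "0 \<le> ?A * ?B"
    using pA pB A1 comm by (intro commuting_pos_operator_mult) (auto simp: predicate_on_def)
  have "0 \<le> ?A * (\<one>\<^bsub>V \<union> W\<^esub> - ?B)"
  proof (rule commuting_pos_operator_mult)
    show "?A * (\<one>\<^bsub>V \<union> W\<^esub> - ?B) = (\<one>\<^bsub>V \<union> W\<^esub> - ?B) * ?A"
      using pA comm by (simp add: algebra_simps predicate_on_def bopsD)
  qed (use pA pB A1 in \<open>auto simp: predicate_on_def\<close>)
  then have "?A * ?B \<le> ?A" using pA by (simp add: algebra_simps predicate_on_def bopsD)
  then show ?thesis
    using pA pB pos order_trans unfolding eq predicate_on_def by (auto intro: bops_mult)
qed

lemma tensor_op_idop_right:
  assumes "A \<in> bops_on V" shows "tensor_op V W A \<one>\<^bsub>W\<^esub> = ampliation A"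
proof -
  have "flip.ampliation \<one>\<^bsub>W\<^esub> = \<one>\<^bsub>V \<union> W\<^esub>"
    using flip.ampliation_idop by (simp add: Un_commute)
  then show ?thesis using assms by (simp add: tensor_op_eq bopsD[OF ampliation_bops])
qed

end

section \<open>Cylinder extensions\<close>

locale subregister =
  fixes Q V :: "qvar set"
  assumes sub: "V \<subseteq> Q"
begin

sublocale disjoint_registers V "Q - V"
  by unfold_locales auto

lemma union_eq: "V \<union> (Q - V) = Q" "V \<union> Q = Q"
  using sub by auto

lemma lift_op_eq: "A \<in> bops_on V \<Longrightarrow> lift_op Q V A = ampliation A"
  by (simp add: lift_op_def tensor_op_idop_right)

lemma lift_op_bops: "A \<in> bops_on V \<Longrightarrow> lift_op Q V A \<in> bops_on Q"
  using ampliation_bops[of A] by (simp add: lift_op_eq union_eq)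

lemma lift_op_adj: "A \<in> bops_on V \<Longrightarrow> lift_op Q V (A\<^sup>\<dagger>) = (lift_op Q V A)\<^sup>\<dagger>"
  by (simp add: lift_op_eq bops_adj ampliation_adj)

lemma lift_op_mult: "A \<in> bops_on V \<Longrightarrow> B \<in> bops_on V \<Longrightarrow> lift_op Q V (A * B) = lift_op Q V A * lift_op Q V B"
  by (simp add: lift_op_eq bops_mult ampliation_mult)

lemma lift_op_idop: "lift_op Q V \<one>\<^bsub>V\<^esub> = \<one>\<^bsub>Q\<^esub>"
  using ampliation_idop by (simp add: lift_op_eq union_eq)

lemma predicate_on_lift_op: "predicate_on (cstates V) A \<Longrightarrow> predicate_on (cstates Q) (lift_op Q V A)"
  using predicate_on_ampliation[of A] by (simp add: lift_op_eq predicate_on_def union_eq)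

lemma lift_op_kraus:
  assumes M: "\<And>m. m \<in> I \<Longrightarrow> M m \<in> bops_on V" and sum: "op_has_sum (\<lambda>m. (M m)\<^sup>\<dagger> * M m) I \<one>\<^bsub>V\<^esub>"
  shows "op_has_sum (\<lambda>m. (lift_op Q V (M m))\<^sup>\<dagger> * lift_op Q V (M m)) I \<one>\<^bsub>Q\<^esub>"
proof -
  have "op_has_sum (\<lambda>m. ampliation ((M m)\<^sup>\<dagger> * M m)) I (ampliation \<one>\<^bsub>V\<^esub>)"
    by (rule ampliation_op_has_sum) (simp_all add: M sum bops_mult bops_adj adj_mult_self_pos)
  moreover have "ampliation ((M m)\<^sup>\<dagger> * M m) = (lift_op Q V (M m))\<^sup>\<dagger> * lift_op Q V (M m)" if "m \<in> I" for m
    using M[OF that] by (simp add: ampliation_mult bops_adj lift_op_eq ampliation_adj)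
  ultimately show ?thesis
    unfolding op_has_sum_def ampliation_idop union_eq by (simp cong: has_sum_cong)
qed

end

text \<open>The Kraus operators of initialisation send basis vector i to basis vector 0; each times
  its adjoint on the left is the projection onto basis vector i, and completeness is Parseval over
  one variable.\<close>

lemma ket_kraus:
  "op_has_sum (\<lambda>i. (ketbra (ket (\<lambda>_\<in>{q}. 0)) (ket (\<lambda>_\<in>{q}. i)))\<^sup>\<dagger> * ketbra (ket (\<lambda>_\<in>{q}. 0)) (ket (\<lambda>_\<in>{q}. i)))
    (vdom q) \<one>\<^bsub>{q}\<^esub>"
proof (rule op_has_sumI)
  fix x
  have bij: "bij_betw (\<lambda>i. \<lambda>_\<in>{q}. i) (vdom q) (cstates {q})"
    by (rule bij_betwI[where g = "\<lambda>s. s q"]) (auto simp: cstates_def PiE_def extensional_def fun_eq_iff)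
  have "(ketbra (ket (\<lambda>_\<in>{q}. 0)) (ket (\<lambda>_\<in>{q}. i)))\<^sup>\<dagger> * ketbra (ket (\<lambda>_\<in>{q}. 0)) (ket (\<lambda>_\<in>{q}. i)) =
    ketbra (ket (\<lambda>_\<in>{q}. i)) (ket (\<lambda>_\<in>{q}. i))" for i :: int
    unfolding adj_ketbra
    by (rule operator_eqI) (simp add: op_apply_simps ketbra_apply op_apply_linear cinner_linear cinner_ket_left ket.rep_eq
        scaleC_ell2_simps)
  moreover have "((\<lambda>s. cnj (coord x s) * coord (restrict_vec (cstates {q}) x) s) has_sum
    cinner x (restrict_vec (cstates {q}) x)) (cstates {q})"
    using has_sum_cinner[of x "restrict_vec (cstates {q}) x"]
    by (rule has_sum_cong_neutral[THEN iffD1, rotated -1]) (auto simp: restrict_vec.rep_eq)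
  then have "((\<lambda>i. cnj (coord x (\<lambda>_\<in>{q}. i)) * coord x (\<lambda>_\<in>{q}. i)) has_sum
    cinner x (restrict_vec (cstates {q}) x)) (vdom q)"
    unfolding has_sum_reindex_bij_betw[OF bij, symmetric]
    by (rule has_sum_cong[THEN iffD1, rotated])
      (use bij in \<open>auto simp: restrict_vec.rep_eq bij_betw_def\<close>)
  ultimately show "((\<lambda>i. cinner x (((ketbra (ket (\<lambda>_\<in>{q}. 0)) (ket (\<lambda>_\<in>{q}. i)))\<^sup>\<dagger> *
      ketbra (ket (\<lambda>_\<in>{q}. 0)) (ket (\<lambda>_\<in>{q}. i))) *\<^sub>V x)) has_sum cinner x (\<one>\<^bsub>{q}\<^esub> *\<^sub>V x)) (vdom q)"
    by (simp add: cinner_ketbra cinner_ket_left cinner_ket_right op_apply_simps)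
qed

lemma ketbra_zero_bops: "i \<in> vdom q \<Longrightarrow> ketbra (ket (\<lambda>_\<in>{q}. 0)) (ket (\<lambda>_\<in>{q}. i)) \<in> bops_on {q}"
  by (rule bops_ketbra; cases q) (auto simp: ket_in_vecs cstates_def)

section \<open>Semantics and weakest preconditions of programs\<close>

lemma op_has_sum_cong: "(\<And>i. i \<in> I \<Longrightarrow> f i = g i) \<Longrightarrow> op_has_sum f I A \<longleftrightarrow> op_has_sum g I A"
  unfolding op_has_sum_def by (simp cong: has_sum_cong)

lemma op_has_sum_diff:
  assumes "op_has_sum f I A" "op_has_sum g I B" shows "op_has_sum (\<lambda>i. f i - g i) I (A - B)"
proof -
  have "sum (\<lambda>i. f i - g i) = (\<lambda>F. sum f F - sum g F)"
    by (intro ext) (simp add: sum_subtractf)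
  then show ?thesis
    using wot_lim_diff[OF assms[unfolded op_has_sum_wot_lim]] by (simp add: op_has_sum_wot_lim)
qed

lemma op_has_sum_mono:
  assumes "op_has_sum f I A" "op_has_sum g I B" "\<And>i. i \<in> I \<Longrightarrow> f i \<le> g i" shows "A \<le> B"
  using assms unfolding op_has_sum_wot_lim
  by (elim wot_lim_le) (auto intro!: eventually_finite_subsets_at_top_weakI sum_mono)

text \<open>A finite product of countable domains is countable, whereas infinitely many variables
  would give an uncountable basis.\<close>

locale finite_register =
  fixes Q :: "qvar set"
  assumes finite_Q: "finite Q"
begin

abbreviation "QX \<equiv> cstates Q"

sublocale countable_basis QX
proof
  have "countable (vdom q)" for q by (cases q) auto
  then show "countable (cstates Q)" unfolding cstates_def by (intro countable_PiE finite_Q)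
qed

lemma diamond_idop: "\<rho> \<in> tc QX \<Longrightarrow> diamond QX \<one>\<^bsub>Q\<^esub> \<one>\<^bsub>Q\<^esub> \<rho> = \<rho>"
  using tc_bops[of \<rho> QX] by (simp add: diamond_def bops_def)

lemma qop_idop: "qop QX (diamond QX \<one>\<^bsub>Q\<^esub> \<one>\<^bsub>Q\<^esub>)"
  using qop_conj[of "\<one>\<^bsub>Q\<^esub>"] by (simp add: idop_mult)

lemma dual_idop: "predicate_on QX P \<Longrightarrow> dual QX (diamond QX \<one>\<^bsub>Q\<^esub> \<one>\<^bsub>Q\<^esub>) P = P"
  by (rule dual_eqI) (auto simp: diamond_idop predicate_on_def)

lemma compose_idop_left:
  assumes "qop QX E" shows "compose (tc QX) (diamond QX \<one>\<^bsub>Q\<^esub> \<one>\<^bsub>Q\<^esub>) E = E"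
  using qop_extensional[OF assms]
  by (intro extensionalityI[of _ "tc QX"]) (simp_all add: compose_def diamond_idop qop_tc[OF assms])

text \<open>Absorbs the \<open>Skip\<close> that precedes every unfolded call;
  \<open>compose_idop_left\<close> serves initialisation instead.\<close>

lemma compose_idop_right:
  assumes "qop QX E" shows "compose (tc QX) E (diamond QX \<one>\<^bsub>Q\<^esub> \<one>\<^bsub>Q\<^esub>) = E"
  using qop_extensional[OF assms]
  by (intro extensionalityI[of _ "tc QX"]) (simp_all add: compose_def diamond_idop)

lemma measurement_lift:
  assumes "V \<subseteq> Q" "measurement_on V I M"
  shows "m \<in> I \<Longrightarrow> lift_op Q V (M m) \<in> bops QX"
    and "op_has_sum (\<lambda>m. (lift_op Q V (M m))\<^sup>\<dagger> * lift_op Q V (M m)) I \<one>\<^bsub>Q\<^esub>"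
proof -
  interpret subregister Q V by unfold_locales (rule assms)
  show "m \<in> I \<Longrightarrow> lift_op Q V (M m) \<in> bops QX"
    using assms(2) by (simp add: measurement_on_def lift_op_bops)
  show "op_has_sum (\<lambda>m. (lift_op Q V (M m))\<^sup>\<dagger> * lift_op Q V (M m)) I \<one>\<^bsub>Q\<^esub>"
    using assms(2) by (intro lift_op_kraus) (auto simp: measurement_on_def)
qed

lemma init_lift:
  assumes "q \<in> Q"
  shows "i \<in> vdom q \<Longrightarrow> ketbra_var Q q 0 i \<in> bops QX"
    and "op_has_sum (\<lambda>i. (ketbra_var Q q 0 i)\<^sup>\<dagger> * ketbra_var Q q 0 i) (vdom q) \<one>\<^bsub>Q\<^esub>"
    and "i \<in> vdom q \<Longrightarrow> (ketbra_var Q q 0 i)\<^sup>\<dagger> = ketbra_var Q q i 0"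
proof -
  interpret subregister Q "{q}" by unfold_locales (use assms in simp)
  show "i \<in> vdom q \<Longrightarrow> ketbra_var Q q 0 i \<in> bops QX"
    by (simp add: ketbra_var_def lift_op_bops ketbra_zero_bops)
  show "op_has_sum (\<lambda>i. (ketbra_var Q q 0 i)\<^sup>\<dagger> * ketbra_var Q q 0 i) (vdom q) \<one>\<^bsub>Q\<^esub>"
    unfolding ketbra_var_def by (intro lift_op_kraus ketbra_zero_bops ket_kraus)
  show "i \<in> vdom q \<Longrightarrow> (ketbra_var Q q 0 i)\<^sup>\<dagger> = ketbra_var Q q i 0"
    unfolding ketbra_var_def by (simp add: ketbra_zero_bops adj_ketbra flip: lift_op_adj)
qed

lemma unitary_lift:
  assumes "V \<subseteq> Q" "unitary_on V U"
  shows "lift_op Q V U \<in> bops QX" "(lift_op Q V U)\<^sup>\<dagger> * lift_op Q V U = \<one>\<^bsub>Q\<^esub>"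
proof -
  interpret subregister Q V by unfold_locales (rule assms)
  have U: "U \<in> bops_on V" "U\<^sup>\<dagger> * U = \<one>\<^bsub>V\<^esub>" using assms(2) by (auto simp: unitary_on_def)
  show "lift_op Q V U \<in> bops QX" by (rule lift_op_bops[OF U(1)])
  show "(lift_op Q V U)\<^sup>\<dagger> * lift_op Q V U = \<one>\<^bsub>Q\<^esub>"
    using lift_op_mult[OF bops_adj[OF U(1)] U(1)] by (simp add: U(2) lift_op_adj[OF U(1)] lift_op_idop)
qed

lemma superop_sum_cong: "(\<And>i. i \<in> I \<Longrightarrow> E i = F i) \<Longrightarrow> superop_sum X E I = superop_sum X F I"
proof -
  assume "\<And>i. i \<in> I \<Longrightarrow> E i = F i"
  then have "op_has_sum (\<lambda>i. E i \<rho>) I = op_has_sum (\<lambda>i. F i \<rho>) I" for \<rho>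
    by (intro ext op_has_sum_cong) simp
  then show ?thesis unfolding superop_sum_def op_sum_def by simp
qed

text \<open>Rewrites initialisation as a Kraus sum followed by the identity in each branch, so that
  it falls under the lemmas for measurements.\<close>

lemma sem_rel_Init_eq:
  assumes "q \<in> Q"
  shows "sem_rel Q e (Init q) = superop_sum QX (\<lambda>i. compose (tc QX) (diamond QX \<one>\<^bsub>Q\<^esub> \<one>\<^bsub>Q\<^esub>)
    (diamond QX (ketbra_var Q q 0 i) ((ketbra_var Q q 0 i)\<^sup>\<dagger>))) (vdom q)"
  unfolding sem_rel.simps
proof (rule superop_sum_cong)
  fix i assume i: "i \<in> vdom q"
  have "(ketbra_var Q q 0 i)\<^sup>\<dagger> * ketbra_var Q q 0 i \<le> \<one>\<^bsub>Q\<^esub>"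
    using op_has_sum_pos_le[OF init_lift(2)[OF assms], of "{i}"] i by (simp add: adj_mult_self_pos)
  then have "qop QX (diamond QX (ketbra_var Q q 0 i) ((ketbra_var Q q 0 i)\<^sup>\<dagger>))"
    by (rule qop_conj[OF init_lift(1)[OF assms i]])
  from compose_idop_left[OF this] show "diamond QX (ketbra_var Q q 0 i) (ketbra_var Q q i 0) =
    compose (tc QX) (diamond QX \<one>\<^bsub>Q\<^esub> \<one>\<^bsub>Q\<^esub>) (diamond QX (ketbra_var Q q 0 i) ((ketbra_var Q q 0 i)\<^sup>\<dagger>))"
    by (simp add: init_lift(3)[OF assms i])
qed

lemma qop_sem_rel:
  assumes "\<And>p. qop QX (e p)" "wf_stmt Q S"
  shows "qop QX (sem_rel Q e S)"
  using assms(2)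
proof (induction S)
  case (Init q)
  then have q: "q \<in> Q" by simp
  show ?case unfolding sem_rel_Init_eq[OF q]
    by (rule qop_kraus_sum[OF init_lift(1,2)[OF q] qop_idop])
next
  case (Unitary V U)
  then show ?case using unitary_lift[of V U] by (simp add: qop_conj)
next
  case (If V I M S)
  then have V: "V \<subseteq> Q" "measurement_on V I M" by auto
  show ?case unfolding sem_rel.simps
    by (rule qop_kraus_sum[OF measurement_lift[OF V]]) (use If in auto)
qed (simp_all add: assms qop_zero qop_idop qop_compose)

text \<open>The meanings of calls are left abstract because they are instantiated twice: by the
  approximations of level k and by the limits. \<open>P\<close> is generalised since
  \<open>Seq\<close> passes on the precondition of its second part.\<close>

lemma xp_rel_wp:
  assumes e: "\<And>p. qop QX (e p)" and w: "\<And>p P. predicate_on QX P \<Longrightarrow> w p P = dual QX (e p) P"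
    and "wf_stmt Q S" "predicate_on QX P"
  shows "xp_rel Q 0 w S P = dual QX (sem_rel Q e S) P"
  using assms(3,4)
proof (induction S arbitrary: P)
  case Bottom
  then show ?case by (simp add: dual_zero)
next
  case Skip
  then show ?case by (simp add: dual_idop)
next
  case (Init q)
  then have q: "q \<in> Q" by simp
  have eq: "(ketbra_var Q q 0 i)\<^sup>\<dagger> * P * ketbra_var Q q 0 i = ketbra_var Q q i 0 * P * ketbra_var Q q 0 i"
    if "i \<in> vdom q" for i
    by (simp only: init_lift(3)[OF q that])
  have "op_has_sum (\<lambda>i. (ketbra_var Q q 0 i)\<^sup>\<dagger> * dual QX (diamond QX \<one>\<^bsub>Q\<^esub> \<one>\<^bsub>Q\<^esub>) P * ketbra_var Q q 0 i)
    (vdom q) (dual QX (sem_rel Q e (Init q)) P)"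
    unfolding sem_rel_Init_eq[OF q] by (rule dual_kraus_sum[OF init_lift(1,2)[OF q] qop_idop Init(2)])
  then have "op_has_sum (\<lambda>i. ketbra_var Q q i 0 * P * ketbra_var Q q 0 i) (vdom q) (dual QX (sem_rel Q e (Init q)) P)"
    unfolding dual_idop[OF Init(2)] by (rule op_has_sum_cong[THEN iffD1, rotated]) (rule eq)
  then show ?case by (simp add: op_sum_eqI del: sem_rel.simps)
next
  case (Unitary V U)
  then show ?case using unitary_lift[of V U] by (simp add: dual_conj)
next
  case (Seq S1 S2)
  then have S: "qop QX (sem_rel Q e S1)" "qop QX (sem_rel Q e S2)" using qop_sem_rel e by auto
  from Seq show ?case by (simp add: dual_compose[OF S] dual_predicate(1)[OF S(2)])
next
  case (If V I M S)
  then have V: "V \<subseteq> Q" "measurement_on V I M" by auto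
  have "op_has_sum (\<lambda>m. (lift_op Q V (M m))\<^sup>\<dagger> * dual QX (sem_rel Q e (S m)) P * lift_op Q V (M m)) I
    (dual QX (sem_rel Q e (If V I M S)) P)"
    unfolding sem_rel.simps
    by (rule dual_kraus_sum[OF measurement_lift[OF V]]) (use If.prems in \<open>auto intro: qop_sem_rel e\<close>)
  then have "op_has_sum (\<lambda>m. (lift_op Q V (M m))\<^sup>\<dagger> * xp_rel Q 0 w (S m) P * lift_op Q V (M m)) I
    (dual QX (sem_rel Q e (If V I M S)) P)"
    by (rule op_has_sum_cong[THEN iffD1, rotated]) (use If in simp)
  then show ?case by (simp add: op_sum_eqI del: sem_rel.simps)
next
  case (Call p)
  then show ?case by (simp add: w)
qed

text \<open>Completeness of the Kraus operators makes their weighted sum preserve the identity, and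
  therefore commute with complements.\<close>

lemma op_has_sum_kraus_compl:
  assumes K: "\<And>i. i \<in> I \<Longrightarrow> K i \<in> bops QX" and KK: "op_has_sum (\<lambda>i. (K i)\<^sup>\<dagger> * K i) I \<one>\<^bsub>Q\<^esub>"
    and T: "op_has_sum (\<lambda>i. (K i)\<^sup>\<dagger> * T i * K i) I A"
  shows "op_has_sum (\<lambda>i. (K i)\<^sup>\<dagger> * (\<one>\<^bsub>Q\<^esub> - T i) * K i) I (\<one>\<^bsub>Q\<^esub> - A)"
proof -
  have "op_has_sum (\<lambda>i. (K i)\<^sup>\<dagger> * K i - (K i)\<^sup>\<dagger> * T i * K i) I (\<one>\<^bsub>Q\<^esub> - A)"
    by (rule op_has_sum_diff[OF KK T])
  then show ?thesis
    by (rule op_has_sum_cong[THEN iffD1, rotated]) (simp add: algebra_simps bopsD[OF K])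
qed

text \<open>Complementation turns the wlp clauses into the wp clauses: for Kraus sums and unitaries
  by completeness, for \<open>Seq\<close> because the inner complements cancel, and for
  \<open>Bottom\<close> because the dual there is zero.\<close>

lemma xp_rel_wlp:
  assumes e: "\<And>p. qop QX (e p)"
    and w: "\<And>p P. predicate_on QX P \<Longrightarrow> w p P = \<one>\<^bsub>Q\<^esub> - dual QX (e p) (\<one>\<^bsub>Q\<^esub> - P)"
    and "wf_stmt Q S" "predicate_on QX P"
  shows "xp_rel Q \<one>\<^bsub>Q\<^esub> w S P = \<one>\<^bsub>Q\<^esub> - dual QX (sem_rel Q e S) (\<one>\<^bsub>Q\<^esub> - P)"
  using assms(3,4)
proof (induction S arbitrary: P)
  case Bottom
  then show ?case by (simp add: dual_zero)
next
  case Skip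
  then show ?case by (simp add: dual_idop predicate_on_compl)
next
  case (Init q)
  then have q: "q \<in> Q" by simp
  note P' = predicate_on_compl[OF Init(2)]
  \<comment> \<open>The double complement is the form in which \<open>op_has_sum_kraus_compl\<close>
    delivers the summands.\<close>
  have eq: "(ketbra_var Q q 0 i)\<^sup>\<dagger> * (\<one>\<^bsub>Q\<^esub> - (\<one>\<^bsub>Q\<^esub> - P)) * ketbra_var Q q 0 i =
    ketbra_var Q q i 0 * P * ketbra_var Q q 0 i" if "i \<in> vdom q" for i
    by (simp add: init_lift(3)[OF q that])
  have "op_has_sum (\<lambda>i. (ketbra_var Q q 0 i)\<^sup>\<dagger> * dual QX (diamond QX \<one>\<^bsub>Q\<^esub> \<one>\<^bsub>Q\<^esub>) (\<one>\<^bsub>Q\<^esub> - P) * ketbra_var Q q 0 i)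
    (vdom q) (dual QX (sem_rel Q e (Init q)) (\<one>\<^bsub>Q\<^esub> - P))"
    unfolding sem_rel_Init_eq[OF q] by (rule dual_kraus_sum[OF init_lift(1,2)[OF q] qop_idop P'])
  from op_has_sum_kraus_compl[OF _ init_lift(2)[OF q] this]
  have "op_has_sum (\<lambda>i. (ketbra_var Q q 0 i)\<^sup>\<dagger> * (\<one>\<^bsub>Q\<^esub> - (\<one>\<^bsub>Q\<^esub> - P)) * ketbra_var Q q 0 i) (vdom q)
    (\<one>\<^bsub>Q\<^esub> - dual QX (sem_rel Q e (Init q)) (\<one>\<^bsub>Q\<^esub> - P))"
    by (simp add: dual_idop[OF P'] init_lift(1)[OF q] del: sem_rel.simps)
  then have "op_has_sum (\<lambda>i. ketbra_var Q q i 0 * P * ketbra_var Q q 0 i) (vdom q)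
    (\<one>\<^bsub>Q\<^esub> - dual QX (sem_rel Q e (Init q)) (\<one>\<^bsub>Q\<^esub> - P))"
    by (rule op_has_sum_cong[THEN iffD1, rotated]) (rule eq)
  then show ?case by (simp add: op_sum_eqI del: sem_rel.simps)
next
  case (Unitary V U)
  then have U: "lift_op Q V U \<in> bops QX" "(lift_op Q V U)\<^sup>\<dagger> * lift_op Q V U = \<one>\<^bsub>Q\<^esub>"
    using unitary_lift[of V U] by auto
  then have "dual QX (sem_rel Q e (Unitary V U)) (\<one>\<^bsub>Q\<^esub> - P) =
    (lift_op Q V U)\<^sup>\<dagger> * (\<one>\<^bsub>Q\<^esub> - P) * lift_op Q V U"
    using Unitary by (simp add: dual_conj predicate_on_compl)
  also have "\<dots> = \<one>\<^bsub>Q\<^esub> - (lift_op Q V U)\<^sup>\<dagger> * P * lift_op Q V U"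
    using bopsD(1)[OF U(1)] U(2) by (simp add: algebra_simps)
  finally show ?case by simp
next
  case (Seq S1 S2)
  then have S: "qop QX (sem_rel Q e S1)" "qop QX (sem_rel Q e S2)" using qop_sem_rel e by auto
  note P' = predicate_on_compl[OF Seq.prems(2)]
  from Seq show ?case
    by (simp add: dual_compose[OF S P'] predicate_on_compl[OF dual_predicate(1)[OF S(2) P']])
next
  case (If V I M S)
  then have V: "V \<subseteq> Q" "measurement_on V I M" by auto
  note P' = predicate_on_compl[OF If.prems(2)]
  have sum: "op_has_sum (\<lambda>m. (lift_op Q V (M m))\<^sup>\<dagger> * dual QX (sem_rel Q e (S m)) (\<one>\<^bsub>Q\<^esub> - P) * lift_op Q V (M m)) I
    (dual QX (sem_rel Q e (If V I M S)) (\<one>\<^bsub>Q\<^esub> - P))"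
    unfolding sem_rel.simps
    by (rule dual_kraus_sum[OF measurement_lift[OF V] _ P']) (use If.prems in \<open>auto intro: qop_sem_rel e\<close>)
  have "op_has_sum (\<lambda>m. (lift_op Q V (M m))\<^sup>\<dagger> *
      (\<one>\<^bsub>Q\<^esub> - dual QX (sem_rel Q e (S m)) (\<one>\<^bsub>Q\<^esub> - P)) * lift_op Q V (M m)) I
    (\<one>\<^bsub>Q\<^esub> - dual QX (sem_rel Q e (If V I M S)) (\<one>\<^bsub>Q\<^esub> - P))"
    by (rule op_has_sum_kraus_compl[OF measurement_lift[OF V] sum])
  then have "op_has_sum (\<lambda>m. (lift_op Q V (M m))\<^sup>\<dagger> * xp_rel Q \<one>\<^bsub>Q\<^esub> w (S m) P * lift_op Q V (M m)) I
    (\<one>\<^bsub>Q\<^esub> - dual QX (sem_rel Q e (If V I M S)) (\<one>\<^bsub>Q\<^esub> - P))"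
    by (rule op_has_sum_cong[THEN iffD1, rotated]) (use If in simp)
  then show ?case by (simp add: op_sum_eqI del: sem_rel.simps)
next
  case (Call p)
  then show ?case by (simp add: w)
qed

lemma qop_mono:
  assumes "qop QX E" "\<rho> \<in> pos_tc QX" "\<sigma> \<in> pos_tc QX" "\<rho> \<le> \<sigma>"
  shows "E \<rho> \<le> E \<sigma>"
proof -
  have "\<sigma> - \<rho> \<in> pos_tc QX" using assms by (simp add: tc_pos_iff tc_diff)
  from qop_pos[OF assms(1) this] show ?thesis using assms by (simp add: qop_diff pos_tc_tc)
qed

text \<open>In \<open>Seq\<close> both the second operation and its argument grow, so monotonicity
  of a fixed operation on positive arguments enters. A measurement compares branch by
  branch.\<close>

lemma sem_rel_mono:
  assumes e: "\<And>p. qop QX (e p)" and e': "\<And>p. qop QX (e' p)" and le: "\<And>p. superop_le QX (e p) (e' p)"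
    and "wf_stmt Q S"
  shows "superop_le QX (sem_rel Q e S) (sem_rel Q e' S)"
  using assms(4)
proof (induction S)
  case (Seq S1 S2)
  then have S: "qop QX (sem_rel Q e S1)" "qop QX (sem_rel Q e S2)" "qop QX (sem_rel Q e' S1)"
    using qop_sem_rel e e' by auto
  have "sem_rel Q e S2 (sem_rel Q e S1 \<rho>) \<le> sem_rel Q e' S2 (sem_rel Q e' S1 \<rho>)" if \<rho>: "\<rho> \<in> pos_tc QX" for \<rho>
  proof -
    have "sem_rel Q e S2 (sem_rel Q e S1 \<rho>) \<le> sem_rel Q e S2 (sem_rel Q e' S1 \<rho>)"
      using Seq by (intro qop_mono[OF S(2) qop_pos_tc[OF S(1) \<rho>] qop_pos_tc[OF S(3) \<rho>]] superop_leD[OF _ \<rho>]) auto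
    also have "\<dots> \<le> sem_rel Q e' S2 (sem_rel Q e' S1 \<rho>)"
      using Seq by (intro superop_leD[OF _ qop_pos_tc[OF S(3) \<rho>]]) auto
    finally show ?thesis .
  qed
  then show ?case by (simp add: superop_le_def compose_def tc_pos_iff)
next
  case (If V I M S)
  then have V: "V \<subseteq> Q" "measurement_on V I M" by auto
  have q: "qop QX (sem_rel Q e (S m))" "qop QX (sem_rel Q e' (S m))" if "m \<in> I" for m
    using If.prems that by (auto intro: qop_sem_rel[OF e] qop_sem_rel[OF e'])
  show ?case
    unfolding superop_le_def
  proof (intro ballI impI)
    fix \<rho> assume \<rho>: "\<rho> \<in> tc QX" "0 \<le> \<rho>"
    show "sem_rel Q e (If V I M S) \<rho> \<le> sem_rel Q e' (If V I M S) \<rho>"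
      unfolding sem_rel.simps
    proof (rule op_has_sum_mono[OF kraus_sum_has_sum[OF measurement_lift[OF V] q(1) \<rho>(1)]
          kraus_sum_has_sum[OF measurement_lift[OF V] q(2) \<rho>(1)]])
      fix m assume m: "m \<in> I"
      have "lift_op Q V (M m) * \<rho> * (lift_op Q V (M m))\<^sup>\<dagger> \<in> pos_tc QX"
        using \<rho> measurement_lift(1)[OF V m] by (intro pos_tc_sandwich) (simp add: tc_pos_iff)
      from superop_leD[OF If.IH[OF rangeI] this]
      show "compose (tc QX) (sem_rel Q e (S m)) (diamond QX (lift_op Q V (M m)) ((lift_op Q V (M m))\<^sup>\<dagger>)) \<rho>
        \<le> compose (tc QX) (sem_rel Q e' (S m)) (diamond QX (lift_op Q V (M m)) ((lift_op Q V (M m))\<^sup>\<dagger>)) \<rho>"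
        using If.prems m \<rho> by (simp add: compose_def diamond_def)
    qed
  qed
qed (simp_all add: le, simp_all add: superop_le_def)

end

section \<open>Approximations of recursive calls\<close>

lemma sem_rel_subst_calls: "sem_rel Q e (subst_calls \<sigma> S) = sem_rel Q (\<lambda>p. sem_rel Q e (\<sigma> p)) S"
  by (induction S) simp_all

text \<open>Substituting statements for calls amounts to changing the meaning of the calls; this
  turns the syntactic unfolding into iteration of a semantic map.\<close>

lemma xp_rel_subst_calls: "xp_rel Q B w (subst_calls \<sigma> S) P = xp_rel Q B (\<lambda>p. xp_rel Q B w (\<sigma> p)) S P"
  by (induction S arbitrary: P) simp_all

locale program = finite_register Q for Q :: "qvar set" +
  fixes D :: "'p decl"
  assumes wf_decl: "\<And>p. wf_stmt Q (D p)"
begin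

abbreviation "sem_approx k p \<equiv> sem_rel Q (\<lambda>_. undefined) (approx D k p)"

text \<open>Proved simultaneously: removing the inserted \<open>Skip\<close> requires the
  approximations to be quantum operations, and that property climbs one level through the recursion
  equation.\<close>

lemma qop_sem_approx: "qop QX (sem_approx k p)"
  and sem_approx_Suc: "sem_approx (Suc k) p = sem_rel Q (sem_approx k) (D p)"
proof -
  have "qop QX (sem_approx k p) \<and> sem_approx (Suc k) p = sem_rel Q (sem_approx k) (D p)" for k p
  proof (induction k arbitrary: p)
    case 0
    show ?case by (simp add: qop_zero sem_rel_subst_calls compose_idop_right)
  next
    case (Suc k)
    have q: "qop QX (sem_approx (Suc k) p)" for p
      using Suc qop_sem_rel[OF _ wf_decl] by simp
    have "sem_approx (Suc (Suc k)) p =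
      sem_rel Q (\<lambda>j. compose (tc QX) (sem_approx (Suc k) j) (diamond QX \<one>\<^bsub>Q\<^esub> \<one>\<^bsub>Q\<^esub>)) (D p)"
      by (simp only: approx.simps(2)[of D "Suc k"] sem_rel_subst_calls sem_rel.simps)
    then show ?case using q by (simp only: compose_idop_right simp_thms)
  qed
  then show "qop QX (sem_approx k p)" "sem_approx (Suc k) p = sem_rel Q (sem_approx k) (D p)" by auto
qed

text \<open>The Kleene chain: it starts at zero, which is below every quantum operation, and
  continues by monotonicity in the meanings of the calls.\<close>

lemma sem_approx_incr: "superop_le QX (sem_approx k p) (sem_approx (Suc k) p)"
proof (induction k arbitrary: p)
  case 0
  show ?case
    unfolding superop_le_def
  proof (intro ballI impI)
    fix \<rho> assume "\<rho> \<in> tc QX" "0 \<le> \<rho>"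
    then show "sem_approx 0 p \<rho> \<le> sem_approx (Suc 0) p \<rho>"
      using qop_pos[OF qop_sem_approx, of \<rho> "Suc 0" p] by (simp add: diamond_def tc_pos_iff)
  qed
next
  case (Suc k)
  show ?case
    unfolding sem_approx_Suc[of "Suc k"] sem_approx_Suc[of k]
    using sem_rel_mono[OF qop_sem_approx qop_sem_approx Suc wf_decl] by (simp only: sem_approx_Suc)
qed

lemma wp_approx_dual:
  "predicate_on QX P \<Longrightarrow> xp_rel Q 0 (\<lambda>_. undefined) (approx D k p) P = dual QX (sem_approx k p) P"
proof (induction k arbitrary: p P)
  case 0
  then show ?case by (simp add: dual_zero)
next
  case (Suc k)
  have "xp_rel Q 0 (\<lambda>_. undefined) (approx D (Suc k) p) P =
    xp_rel Q 0 (\<lambda>j. xp_rel Q 0 (\<lambda>_. undefined) (Seq Skip (approx D k j))) (D p) P"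
    by (simp only: approx.simps(2) xp_rel_subst_calls)
  also have "\<dots> = dual QX (sem_rel Q (sem_approx k) (D p)) P"
    by (rule xp_rel_wp[OF qop_sem_approx _ wf_decl Suc.prems]) (simp add: Suc.IH)
  finally show ?case by (simp only: sem_approx_Suc)
qed

lemma wlp_approx_dual:
  "predicate_on QX P \<Longrightarrow>
    xp_rel Q \<one>\<^bsub>Q\<^esub> (\<lambda>_. undefined) (approx D k p) P = \<one>\<^bsub>Q\<^esub> - dual QX (sem_approx k p) (\<one>\<^bsub>Q\<^esub> - P)"
proof (induction k arbitrary: p P)
  case 0
  then show ?case by (simp add: dual_zero)
next
  case (Suc k)
  have "xp_rel Q \<one>\<^bsub>Q\<^esub> (\<lambda>_. undefined) (approx D (Suc k) p) P =
    xp_rel Q \<one>\<^bsub>Q\<^esub> (\<lambda>j. xp_rel Q \<one>\<^bsub>Q\<^esub> (\<lambda>_. undefined) (Seq Skip (approx D k j))) (D p) P"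
    by (simp only: approx.simps(2) xp_rel_subst_calls)
  also have "\<dots> = \<one>\<^bsub>Q\<^esub> - dual QX (sem_rel Q (sem_approx k) (D p)) (\<one>\<^bsub>Q\<^esub> - P)"
    by (rule xp_rel_wlp[OF qop_sem_approx _ wf_decl Suc.prems]) (simp add: Suc.IH)
  finally show ?case by (simp only: sem_approx_Suc)
qed

lemma qop_call: "qop QX (qop_Lub QX (\<lambda>k. sem_approx k p))"
  by (rule qop_qop_Lub) (rule qop_sem_approx, rule sem_approx_incr)

lemma qop_sem: "wf_stmt Q S \<Longrightarrow> qop QX (sem Q D S)"
  unfolding sem_def by (rule qop_sem_rel[OF qop_call])

text \<open>For a call, one side is a least upper bound of operators and the other the dual of a
  least upper bound of operations. They meet because both are the weak limit of the duals of the
  approximations.\<close>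

lemma wp_eq_dual:
  assumes "wf_stmt Q S" "predicate_on QX P"
  shows "wp Q D S P = dual QX (sem Q D S) P"
  unfolding wp_def sem_def
proof (rule xp_rel_wp[OF qop_call _ assms])
  fix p P assume P: "predicate_on QX P"
  note props = incseq_dual[where E = "\<lambda>k. sem_approx k p", OF qop_sem_approx sem_approx_incr P]
    dual_qop_Lub_wot_lim[where E = "\<lambda>k. sem_approx k p", OF qop_sem_approx sem_approx_incr P]
  have "dual QX (qop_Lub QX (\<lambda>k. sem_approx k p)) P \<in> bops QX"
    using dual_predicate(1)[OF qop_call P] by (simp add: predicate_on_def)
  then show "op_Lub QX (\<lambda>k. xp_rel Q 0 (\<lambda>_. undefined) (approx D k p) P) =
    dual QX (qop_Lub QX (\<lambda>k. sem_approx k p)) P"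
    by (simp add: wp_approx_dual[OF P] op_Lub_eqI[OF props])
qed

lemma wlp_eq_dual:
  assumes "wf_stmt Q S" "predicate_on QX P"
  shows "wlp Q D S P = \<one>\<^bsub>Q\<^esub> - dual QX (sem Q D S) (\<one>\<^bsub>Q\<^esub> - P)"
  unfolding wlp_def sem_def
proof (rule xp_rel_wlp[OF qop_call _ assms])
  fix p P assume P: "predicate_on QX P"
  note P' = predicate_on_compl[OF P]
  let ?w = "\<lambda>k. \<one>\<^bsub>Q\<^esub> - dual QX (sem_approx k p) (\<one>\<^bsub>Q\<^esub> - P)"
  let ?W = "\<one>\<^bsub>Q\<^esub> - dual QX (qop_Lub QX (\<lambda>k. sem_approx k p)) (\<one>\<^bsub>Q\<^esub> - P)"
  have "decseq ?w"
    using incseq_dual[where E = "\<lambda>k. sem_approx k p", OF qop_sem_approx sem_approx_incr P'] by (simp add: incseq_def decseq_def)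
  moreover have "wot_lim ?w sequentially ?W"
    by (intro wot_lim_diff wot_lim_const 
        dual_qop_Lub_wot_lim[where E = "\<lambda>k. sem_approx k p", OF qop_sem_approx sem_approx_incr P'])
  moreover have "?W \<in> bops QX"
    using dual_predicate(1)[OF qop_call P', of p] by (simp add: predicate_on_def bops_diff)
  ultimately show "op_Glb QX (\<lambda>k. xp_rel Q \<one>\<^bsub>Q\<^esub> (\<lambda>_. undefined) (approx D k p) P) = ?W"
    by (simp add: wlp_approx_dual[OF P] op_Glb_eqI)
qed

end

section \<open>Values of parameterized quantum predicate terms\<close>

lemma predicate_on_base_val:
  assumes "wf_base b" "\<forall>(x, V)\<in>base_pvars b. quantum_predicate V (v (x, V))"
  shows "predicate_on (cstates (base_reg b)) (base_val v b)"
  using assms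
proof (induction b)
  case (PTensor b c)
  then interpret disjoint_registers "base_reg b" "base_reg c" by unfold_locales simp
  show ?case using PTensor by (simp add: predicate_on_tensor_op)
qed (auto simp: predicate_on_def quantum_predicate_def)

text \<open>At \<open>ketbra x x\<close> the traces of the two operations add up to at most the
  squared norm of \<open>x\<close>, and weighting them by predicates only lowers them; this bounds
  the quadratic form of the value by that of the identity.\<close>

lemma predicate_on_pqpt_val:
  assumes fin: "finite (pqpt_reg P)" and wf: "wf_pqpt P" and v: "assignment_for v P"
  shows "predicate_on (cstates (pqpt_reg P)) (pqpt_val v P)"
proof -
  \<comment> \<open>The duals of the term are formed on its own register, so the theory is
    instantiated there and not on the register of the program.\<close>
  interpret finite_register "pqpt_reg P" by unfold_locales (rule fin)
  have E: "qop QX (pqpt_E P)" and F: "qop QX (pqpt_F P)"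
    and le: "superop_le QX (\<lambda>\<rho>\<in>tc QX. pqpt_E P \<rho> + pqpt_F P \<rho>) (diamond QX (idop QX) (idop QX))"
    using wf by (auto simp: wf_pqpt_def Let_def)
  have B: "predicate_on QX (base_val v (pqpt_base P))"
    using wf v predicate_on_base_val unfolding wf_pqpt_def assignment_for_def pqpt_reg_def Let_def by blast
  note dE = dual_predicate(1)[OF E B] and dF = dual_predicate(1)[OF F predicate_on_idop]
  let ?W = "dual QX (pqpt_E P) (base_val v (pqpt_base P)) + dual QX (pqpt_F P) (idop QX)"
  have b: "?W \<in> bops QX" using dE dF by (simp add: predicate_on_def bops_add)
  have "?W \<le> idop QX"
  proof (rule bops_leI[OF b idop_bops])
    fix x assume x: "x \<in> vecs QX"
    let ?\<rho> = "ketbra x x"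
    have \<rho>: "?\<rho> \<in> pos_tc QX" by (rule ketbra_pos_tc[OF x])
    note Ep = qop_pos_tc[OF E \<rho>] and Fp = qop_pos_tc[OF F \<rho>]
    have "pqpt_E P ?\<rho> + pqpt_F P ?\<rho> \<le> ?\<rho>"
      using superop_leD[OF le \<rho>] \<rho> by (simp add: diamond_idop pos_tc_tc)
    then have "?\<rho> - (pqpt_E P ?\<rho> + pqpt_F P ?\<rho>) \<in> pos_tc QX"
      using \<rho> Ep Fp by (simp add: tc_pos_iff tc_diff tc_add)
    from pos_tc_tr[OF this] have "tr (pqpt_E P ?\<rho> + pqpt_F P ?\<rho>) \<le> tr ?\<rho>"
      using \<rho> Ep Fp by (simp add: tr_diff tc_add pos_tc_tc less_eq_complex_def)
    moreover have "cinner x (?W *\<^sub>V x) = tr (base_val v (pqpt_base P) * pqpt_E P ?\<rho>) + tr (idop QX * pqpt_F P ?\<rho>)"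
      by (simp add: op_apply_simps cinner_add_right cinner_dual[OF E B x] cinner_dual[OF F predicate_on_idop x])
    moreover have "tr (base_val v (pqpt_base P) * pqpt_E P ?\<rho>) \<le> tr (pqpt_E P ?\<rho>)"
      "tr (idop QX * pqpt_F P ?\<rho>) \<le> tr (pqpt_F P ?\<rho>)"
      using tr_predicate_le B predicate_on_idop Ep Fp by auto
    moreover have "cinner x (idop QX *\<^sub>V x) = tr ?\<rho>"
      using x by (simp add: op_apply_simps tr_ketbra vecs_iff cinner_norm)
    ultimately show "cinner x (?W *\<^sub>V x) \<le> cinner x (idop QX *\<^sub>V x)"
      using Ep Fp by (simp add: tr_add pos_tc_tc less_eq_complex_def)
  qed
  then show ?thesis
    using b dE dF by (simp add: pqpt_val_def Let_def predicate_on_def)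
qed

theorem theorem4p20:
  fixes Q :: "qvar set" and D :: "'p::finite decl" and S :: "'p stmt"
    and P :: pqpt and v :: assignment
  assumes "finite Q"
    and "\<forall>p. wf_stmt Q (D p)" and "wf_stmt Q S"
    and "wf_pqpt P" and "pqpt_reg P \<subseteq> Q"
    and "assignment_for v P"
  shows "let Pv = lift_op Q (pqpt_reg P) (pqpt_val v P) in
      wp Q D S Pv = dual (cstates Q) (sem Q D S) Pv \<and>
      wlp Q D S Pv = \<one>\<^bsub>Q\<^esub> - wp Q D S (\<one>\<^bsub>Q\<^esub> - Pv) \<and>
      wlp Q D S Pv = wp Q D S Pv + (\<one>\<^bsub>Q\<^esub> - wp Q D S \<one>\<^bsub>Q\<^esub>)"
proof -
  interpret program Q D by unfold_locales (use assms in auto)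
  interpret subregister Q "pqpt_reg P" by unfold_locales (rule assms)
  define Pv where "Pv = lift_op Q (pqpt_reg P) (pqpt_val v P)"
  have Pv: "predicate_on QX Pv"
    unfolding Pv_def using assms finite_subset
    by (intro predicate_on_lift_op predicate_on_pqpt_val) auto
  note wp = wp_eq_dual[OF assms(3)]
  have wlp: "wlp Q D S Pv = \<one>\<^bsub>Q\<^esub> - wp Q D S (\<one>\<^bsub>Q\<^esub> - Pv)"
    by (simp add: wlp_eq_dual[OF assms(3) Pv] wp[OF predicate_on_compl[OF Pv]])
  \<comment> \<open>\<open>dual_add\<close> requires the sum to be a predicate as well; for this
    complementary pair it is the identity.\<close>
  have "dual QX (sem Q D S) (Pv + (\<one>\<^bsub>Q\<^esub> - Pv)) = dual QX (sem Q D S) Pv + dual QX (sem Q D S) (\<one>\<^bsub>Q\<^esub> - Pv)"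
    by (rule dual_add[OF qop_sem[OF assms(3)] Pv predicate_on_compl[OF Pv]]) (simp add: predicate_on_idop)
  then have "wp Q D S \<one>\<^bsub>Q\<^esub> = wp Q D S Pv + wp Q D S (\<one>\<^bsub>Q\<^esub> - Pv)"
    by (simp add: wp Pv predicate_on_compl predicate_on_idop)
  then show ?thesis
    unfolding Let_def Pv_def[symmetric] using wp[OF Pv] wlp by simp
qed

end
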